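(* Let $R$ be a hyperbolic Bessel process of index $\alpha\ge-\frac12$ starting from $x\ge0$, and let $t>0$. Then for every $\lambda>0$, $$\mathbb{E}\exp(-\lambda\cosh R_t)=e^{-\lambda}\,\mathbb{E}\Bigl[e^{-\lambda(\cosh(x)-1)\Gamma_t^{(\alpha+1/2)}}\Bigl(1+\lambda\int_0^te^{B_u+(\alpha+\frac12)u}\,du\Bigr)^{-\alpha-1}\Bigr],$$ where $B$ is a standard Brownian motion and $$\Gamma_t^{(\beta)}=\frac{e^{B_t+\beta t}}{1+\lambda\int_0^te^{B_u+\beta u}\,du},\qquad \beta\in\mathbb{R}.$$
   Context: Hyperbolic Bessel process. On a filtered probability space satisfying the usual conditions and carrying a standard Brownian motion $B$, a hyperbolic Bessel process of index $\alpha$ starting from $x\ge 0$ is defined as follows. For $\alpha\in(-\frac12,\infty)$ it is the nonnegative diffusion $R$ with $R_t=x+B_t+(\alpha+\frac12)\int_0^t\coth R_u\,du$; for $\alpha\in(-\frac12,0)$ the point $0$ is instantaneously reflecting and the equation is understood as $dR_t=dB_t+(\alpha+\frac12)\mathbf{1}_{\{R_t\ne0\}}\coth R_t\,dt$, $R_0=x$. For $\alpha=-\frac12$ it is $R_t=|x+B_t|$. The parameter $\lambda$ in $\Gamma^{(\beta)}$ is the same $\lambda$ as in the identity. *)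

theory Defs
  imports "HOL-Probability.Probability"
begin

text \<open>
  The library's \<^locale>\<open>filtration\<close> needs a linearly ordered index type, so filtrations are indexed
  by all reals. Only the times \<open>t \<ge> 0\<close> are ever constrained, and a filtration
  given on \<open>[0, \<infinity>)\<close> extends by \<open>F t = F 0\<close> for \<open>t < 0\<close>.
\<close>

locale usual_filtered_prob_space =
  prob_space M + complete_measure M + filtration "space M" F
  for M :: "'a measure" and F :: "real \<Rightarrow> 'a measure" +
  assumes subalgebra_F: "\<And>t. subalgebra M (F t)"
    and null_sets_F0: "null_sets M \<subseteq> sets (F 0)"
    and right_continuous_F: "\<And>t. 0 \<le> t \<Longrightarrow> sets (F t) = (\<Inter>s\<in>{t<..}. sets (F s))"

definition natural_filtration :: "'a measure \<Rightarrow> (real \<Rightarrow> 'a \<Rightarrow> real) \<Rightarrow> real \<Rightarrow> 'a measure" where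
  "natural_filtration M X t =
     sigma (space M) (\<Union>u\<in>{0..t}. {X u -` A \<inter> space M |A. A \<in> sets borel})"

definition brownian_motion_wrt ::
    "'a measure \<Rightarrow> (real \<Rightarrow> 'a measure) \<Rightarrow> (real \<Rightarrow> 'a \<Rightarrow> real) \<Rightarrow> bool" where
  "brownian_motion_wrt M F B \<longleftrightarrow>
     (\<forall>t\<ge>0. B t \<in> borel_measurable (F t)) \<and>
     (AE \<omega> in M. B 0 \<omega> = 0) \<and>
     (\<forall>\<omega>\<in>space M. continuous_on {0..} (\<lambda>t. B t \<omega>)) \<and>
     (\<forall>s t. 0 \<le> s \<longrightarrow> s < t \<longrightarrow>
        distributed M lborel (\<lambda>\<omega>. B t \<omega> - B s \<omega>) (normal_density 0 (sqrt (t - s))) \<and>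
        prob_space.indep_set M (sets (F s))
          (sets (vimage_algebra (space M) (\<lambda>\<omega>. B t \<omega> - B s \<omega>) borel)))"

definition standard_brownian_motion :: "'a measure \<Rightarrow> (real \<Rightarrow> 'a \<Rightarrow> real) \<Rightarrow> bool" where
  "standard_brownian_motion M B \<longleftrightarrow> brownian_motion_wrt M (natural_filtration M B) B"

definition coth :: "real \<Rightarrow> real" where
  "coth r = cosh r / sinh r"

text \<open>
  Since \<open>x / 0 = 0\<close>, we have \<open>coth 0 = 0\<close>, so \<open>coth (R u \<omega>)\<close> below literally is
  \<open>1\<^bsub>{R u \<omega> \<noteq> 0}\<^esub> coth (R u \<omega>)\<close>. That the time spent at \<open>0\<close> is Lebesgue-null is, for
  \<open>-1/2 < \<alpha> < 0\<close>, the instantaneous reflection at \<open>0\<close>; for \<open>\<alpha> \<ge> 0\<close> it is implicit in the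
  (finite) integral of \<open>coth (R u)\<close>, where \<open>coth 0 = \<infinity>\<close> by convention.
\<close>

definition hyperbolic_bessel ::
    "'a measure \<Rightarrow> (real \<Rightarrow> 'a measure) \<Rightarrow> (real \<Rightarrow> 'a \<Rightarrow> real) \<Rightarrow> real \<Rightarrow> real \<Rightarrow>
     (real \<Rightarrow> 'a \<Rightarrow> real) \<Rightarrow> bool" where
  "hyperbolic_bessel M F B \<alpha> x R \<longleftrightarrow>
     (\<forall>t\<ge>0. R t \<in> borel_measurable (F t)) \<and>
     (AE \<omega> in M. continuous_on {0..} (\<lambda>t. R t \<omega>) \<and> (\<forall>t\<ge>0. 0 \<le> R t \<omega>)) \<and>
     (\<alpha> = - 1 / 2 \<longrightarrow> (AE \<omega> in M. \<forall>t\<ge>0. R t \<omega> = \<bar>x + B t \<omega>\<bar>)) \<and>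
     (\<alpha> > - 1 / 2 \<longrightarrow>
        (AE \<omega> in M. {u. 0 \<le> u \<and> R u \<omega> = 0} \<in> null_sets lborel \<and>
           (\<forall>t\<ge>0. set_integrable lborel {0..t} (\<lambda>u. coth (R u \<omega>)) \<and>
              R t \<omega> = x + B t \<omega> + (\<alpha> + 1 / 2) * (LINT u:{0..t}|lborel. coth (R u \<omega>)))))"

definition exp_functional :: "(real \<Rightarrow> 'a \<Rightarrow> real) \<Rightarrow> real \<Rightarrow> real \<Rightarrow> 'a \<Rightarrow> real" where
  "exp_functional B \<beta> t \<omega> = (LINT u:{0..t}|lborel. exp (B u \<omega> + \<beta> * u))"

definition Gamma_process ::
    "(real \<Rightarrow> 'a \<Rightarrow> real) \<Rightarrow> real \<Rightarrow> real \<Rightarrow> real \<Rightarrow> 'a \<Rightarrow> real" where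
  "Gamma_process B l \<beta> t \<omega> = exp (B t \<omega> + \<beta> * t) / (1 + l * exp_functional B \<beta> t \<omega>)"

end

theory Submission
  imports Defs
begin

text \<open>
  The identity is a duality between the diffusion \<open>\<theta> = cosh R\<close> and the process \<open>\<Lambda> = l * \<Gamma>\<close>, which
  starts at \<open>l\<close>. Write \<open>A\<close> for the exponential functional, \<open>\<beta> = \<alpha> + 1/2\<close>,
  \<open>P = (1 + l * A) powr - (\<alpha> + 1)\<close>, and let \<open>V k \<tau> \<eta>\<close> be the expectation of
  \<open>\<Lambda>\<^sup>k * exp (- \<eta> * \<Lambda>) * P\<close> at time \<open>\<tau>\<close>. Then the right-hand side of the identity is
  \<open>exp (- l) * V 0 t (cosh x - 1)\<close>, while \<open>V 0 0 \<eta> = exp (- \<eta> * l)\<close>, so that the left-hand side is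
  \<open>exp (- l)\<close> times the expectation of \<open>V 0 0 (cosh (R t) - 1)\<close>. It has to be shown that the
  expectation of \<open>V 0 (t - u) (cosh (R u) - 1)\<close> does not change between \<open>u = 0\<close> and \<open>u = t\<close>.

  This follows from two applications of Ito's formula. The first is to \<open>exp (- \<eta> * \<Lambda>) * P\<close>: since
  \<open>d\<Lambda> = \<Lambda> dW + (\<alpha> + 1) \<Lambda> dt - \<Lambda>\<^sup>2 dt\<close> and \<open>dP = - (\<alpha> + 1) \<Lambda> P dt\<close>, the time derivative of \<open>V 0\<close> is
  \<open>1/2 * (\<eta>\<^sup>2 + 2 * \<eta>) * V 2 - (\<alpha> + 1) * (\<eta> + 1) * V 1\<close> (\<open>V_time_derivative\<close>). As differentiation in
  \<open>\<eta>\<close> turns \<open>V k\<close> into \<open>- V (k + 1)\<close>, this is the generator of \<open>\<theta>\<close>,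
  \<open>1/2 * (\<theta>\<^sup>2 - 1) * f'' + (\<alpha> + 1) * \<theta> * f'\<close>, applied to \<open>V 0\<close> at \<open>\<theta> = \<eta> + 1\<close>. The second
  application, to \<open>V 0 (t - u) (cosh (R u) - 1)\<close>, then has vanishing drift.

  Only the expectation of Ito's formula is used, and it is obtained without stochastic integrals
  (\<open>ito_expectation\<close>): along a grid, Taylor's theorem and the independence of the Brownian
  increments from the past identify the expected increments up to errors whose sum vanishes as
  the grid is refined. The formula
  covers functions of \<open>B + D\<close> where \<open>D\<close> is nondecreasing with a merely integrable density, as the
  drift \<open>coth R\<close> is singular at the origin.

  Two regularisations are needed for the second application. The estimate
  \<open>\<eta>\<^sup>k * V k \<le> k!\<close> bounds the derivatives of \<open>V 0\<close> only for \<open>\<eta>\<close> away from \<open>0\<close>, so \<open>cosh R - 1\<close> is replaced by \<open>cosh R - 1 + \<epsilon>\<close>; the drift that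
  this creates is at most a constant times \<open>\<epsilon>\<close>, by the moments of geometric Brownian motion
  (\<open>generator_mismatch\<close>). And as the accumulated drift of \<open>R\<close> is not known to be integrable, it is
  capped at a level that tends to infinity (\<open>truncated_estimate\<close>).
\<close>

section \<open>Riemann sums of increments along a path\<close>

lemma sum_integral_partition:
  fixes f :: "real \<Rightarrow> real"
  assumes p: "mono p" "p 0 = 0" and f: "f integrable_on {0..p m}"
  shows "(\<Sum>i<m. integral {p i..p (Suc i)} f) = integral {0..p m} f"
  using f
proof (induction m)
  case (Suc m)
  have le: "p 0 \<le> p m" "p m \<le> p (Suc m)" using p(1) by (auto simp: mono_def)
  have "f integrable_on {0..p m}"
    by (rule integrable_subinterval_real[OF Suc.prems]) (use le p in auto)
  with Suc have "(\<Sum>i<Suc m. integral {p i..p (Suc i)} f)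
      = integral {0..p m} f + integral {p m..p (Suc m)} f" by simp
  also have "\<dots> = integral {0..p (Suc m)} f"
    by (rule Henstock_Kurzweil_Integration.integral_combine) (use le p Suc in auto)
  finally show ?case .
qed (simp add: p)

definition grid :: "real \<Rightarrow> nat \<Rightarrow> nat \<Rightarrow> real" where
  "grid T n i = T * real i / real (Suc n)"

lemma grid_simps [simp]: "grid T n 0 = 0" "grid T n (Suc n) = T"
  unfolding grid_def by (simp, rule nonzero_mult_div_cancel_right, simp)

lemma grid_Suc: "grid T n (Suc i) - grid T n i = T / real (Suc n)"
  unfolding grid_def diff_divide_distrib[symmetric] right_diff_distrib[symmetric] by simp

lemma mono_grid: "0 \<le> T \<Longrightarrow> mono (grid T n)"
  unfolding mono_def grid_def by (intro allI impI divide_right_mono mult_left_mono) auto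

lemma grid_mem:
  assumes "0 \<le> T" "i < Suc n"
  shows "0 \<le> grid T n i" "grid T n i \<le> grid T n (Suc i)" "grid T n (Suc i) \<le> T"
  using monoD[OF mono_grid[OF assms(1), of n], of 0 i] monoD[OF mono_grid[OF assms(1), of n], of i "Suc i"]
    monoD[OF mono_grid[OF assms(1), of n], of "Suc i" "Suc n"] assms(2)
  by (simp_all del: grid_simps(2) add: grid_simps(2))

text \<open>
  Sewing: if the increment \<open>J u v\<close> agrees with an integral over \<open>{u..v}\<close> up to an error that is
  small relative to the additive quantity \<open>integral {u..v} k\<close>, then the errors still add up to
  something small, however many grid intervals there are.
\<close>

lemma grid_sum_tendsto_integral:
  fixes J :: "real \<Rightarrow> real \<Rightarrow> real" and g k :: "real \<Rightarrow> real"
  assumes T: "0 \<le> T" and g: "g integrable_on {0..T}" and k: "k integrable_on {0..T}"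
    and small: "\<And>e. 0 < e \<Longrightarrow> \<exists>d>0. \<forall>u v. 0 \<le> u \<longrightarrow> u \<le> v \<longrightarrow> v \<le> T \<longrightarrow> v - u < d \<longrightarrow>
        \<bar>J u v - integral {u..v} g\<bar> \<le> e * integral {u..v} k"
  shows "(\<lambda>n. \<Sum>i<Suc n. J (grid T n i) (grid T n (Suc i))) \<longlonglongrightarrow> integral {0..T} g"
proof (rule LIMSEQ_I)
  fix r :: real assume r: "0 < r"
  define e where "e = r / (2 * (1 + \<bar>integral {0..T} k\<bar>))"
  have e: "0 < e" using r by (simp add: e_def add_pos_nonneg)
  have er: "e * integral {0..T} k < r"
  proof -
    have "e * integral {0..T} k \<le> e * (1 + \<bar>integral {0..T} k\<bar>)" using e by (intro mult_left_mono) auto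
    also have "\<dots> = r / 2" unfolding e_def using abs_ge_zero[of "integral {0..T} k"]
      by (simp add: field_simps)
    finally show ?thesis using r by simp
  qed
  from small[OF e] obtain d where d: "0 < d" and
    D: "\<And>u v. 0 \<le> u \<Longrightarrow> u \<le> v \<Longrightarrow> v \<le> T \<Longrightarrow> v - u < d \<Longrightarrow>
        \<bar>J u v - integral {u..v} g\<bar> \<le> e * integral {u..v} k" by blast
  obtain N :: nat where N: "T / d < N" using reals_Archimedean2 by blast
  show "\<exists>no. \<forall>n\<ge>no. norm ((\<Sum>i<Suc n. J (grid T n i) (grid T n (Suc i))) - integral {0..T} g) < r"
  proof (intro exI allI impI)
    fix n assume n: "N \<le> n"
    have "T / d < real (Suc n)" using N n by simp
    then have mesh: "T / real (Suc n) < d" using d by (simp add: field_simps)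
    have sg: "integral {0..T} g = (\<Sum>i<Suc n. integral {grid T n i..grid T n (Suc i)} g)"
      using sum_integral_partition[OF mono_grid[OF T, of n], of g "Suc n"] g by simp
    have sk: "integral {0..T} k = (\<Sum>i<Suc n. integral {grid T n i..grid T n (Suc i)} k)"
      using sum_integral_partition[OF mono_grid[OF T, of n], of k "Suc n"] k by simp
    have "\<bar>(\<Sum>i<Suc n. J (grid T n i) (grid T n (Suc i))) - integral {0..T} g\<bar>
       \<le> (\<Sum>i<Suc n. \<bar>J (grid T n i) (grid T n (Suc i)) - integral {grid T n i..grid T n (Suc i)} g\<bar>)"
      unfolding sg sum_subtractf[symmetric] by (rule sum_abs)
    also have "\<dots> \<le> (\<Sum>i<Suc n. e * integral {grid T n i..grid T n (Suc i)} k)"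
      by (intro sum_mono D) (use grid_mem[OF T] mesh in \<open>auto simp: grid_Suc\<close>)
    also have "\<dots> = e * integral {0..T} k" by (simp add: sk sum_distrib_left del: sum.lessThan_Suc)
    finally show "norm ((\<Sum>i<Suc n. J (grid T n i) (grid T n (Suc i))) - integral {0..T} g) < r"
      using er by simp
  qed
qed

lemma continuous_on_slice:
  fixes f :: "real \<Rightarrow> real \<Rightarrow> real"
  assumes "continuous_on (S \<times> UNIV) (\<lambda>p. f (fst p) (snd p))" "continuous_on S h"
  shows "continuous_on S (\<lambda>r. f r (h r))"
proof -
  have "continuous_on S (\<lambda>r. (\<lambda>p. f (fst p) (snd p)) (r, h r))"
    by (rule continuous_on_compose2[OF assms(1)]) (use assms(2) in \<open>auto intro!: continuous_intros\<close>)
  then show ?thesis by simp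
qed

lemma integrable_continuous_mult:
  fixes f d :: "real \<Rightarrow> real"
  assumes f: "continuous_on {a..b} f" and d: "d integrable_on {a..b}" "\<And>r. r \<in> {a..b} \<Longrightarrow> 0 \<le> d r"
  shows "(\<lambda>r. f r * d r) integrable_on {a..b}"
proof -
  have "d absolutely_integrable_on {a..b}" using d by (intro nonnegative_absolutely_integrable_1) auto
  moreover have "f \<in> borel_measurable (lebesgue_on {a..b})"
    by (intro continuous_imp_measurable_on_sets_lebesgue f) auto
  moreover have "bounded (f ` {a..b})" using compact_continuous_image[OF f] compact_imp_bounded by auto
  ultimately have "(\<lambda>r. f r * d r) absolutely_integrable_on {a..b}"
    by (intro absolutely_integrable_bounded_measurable_product_real) auto
  then show ?thesis using absolutely_integrable_on_def by blast
qed

text \<open>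
  Change of \<open>\<phi> u y\<close> when time and the absolutely continuous part \<open>D\<close> of the path advance from \<open>u\<close>
  to \<open>v\<close> while the rough part \<open>b\<close> is held at its new value \<open>b v\<close>. The density \<open>d\<close> is merely
  integrable (it will be a singular drift), so \<open>D\<close> need not be differentiable at every
  time and the chain rule is only available in this integrated form. The error is a
  modulus of continuity times \<open>integral {u..v} (1 + d)\<close>, which is what the sewing lemma asks for.
\<close>

lemma increment_along_path:
  fixes \<phi> \<phi>t \<phi>1 :: "real \<Rightarrow> real \<Rightarrow> real" and b D d :: "real \<Rightarrow> real"
  assumes T: "0 \<le> T"
    and ct: "continuous_on ({0..T} \<times> UNIV) (\<lambda>p. \<phi>t (fst p) (snd p))"
    and c1: "continuous_on ({0..T} \<times> UNIV) (\<lambda>p. \<phi>1 (fst p) (snd p))"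
    and dt: "\<And>u y. u \<in> {0..T} \<Longrightarrow> ((\<lambda>u. \<phi> u y) has_real_derivative \<phi>t u y) (at u within {0..T})"
    and d1: "\<And>u y. u \<in> {0..T} \<Longrightarrow> (\<phi> u has_real_derivative \<phi>1 u y) (at y)"
    and b: "continuous_on {0..T} b" and D: "continuous_on {0..T} D"
    and d: "d integrable_on {0..T}" "\<And>r. r \<in> {0..T} \<Longrightarrow> 0 \<le> d r"
    and Dd: "\<And>u v. 0 \<le> u \<Longrightarrow> u \<le> v \<Longrightarrow> v \<le> T \<Longrightarrow> D v - D u = integral {u..v} d"
  defines "g \<equiv> \<lambda>r. \<phi>t r (b r + D r) + \<phi>1 r (b r + D r) * d r"
  shows "g integrable_on {0..T}"
    and "0 < e \<Longrightarrow> \<exists>\<eta>>0. \<forall>u v. 0 \<le> u \<longrightarrow> u \<le> v \<longrightarrow> v \<le> T \<longrightarrow> v - u < \<eta> \<longrightarrow>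
        \<bar>\<phi> v (b v + D v) - \<phi> u (b v + D u) - integral {u..v} g\<bar> \<le> e * integral {u..v} (\<lambda>r. 1 + d r)"
proof -
  let ?X = "\<lambda>r. b r + D r"
  have X: "continuous_on {0..T} ?X" using b D by (intro continuous_intros)
  have cX: "continuous_on {0..T} (\<lambda>r. \<phi>t r (?X r))" "continuous_on {0..T} (\<lambda>r. \<phi>1 r (?X r))"
    by (rule continuous_on_slice[OF ct X], rule continuous_on_slice[OF c1 X])
  show gi: "g integrable_on {0..T}" unfolding g_def
    by (intro integrable_add integrable_continuous_mult integrable_continuous_real cX d)
  assume e: "0 < e"
  \<comment> \<open>The path stays in a compact set, on which both partial derivatives are uniformly continuous.\<close>
  obtain Kb where Kb: "\<And>r. r \<in> {0..T} \<Longrightarrow> \<bar>b r\<bar> \<le> Kb"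
    using continuous_on_compact_bound[OF compact_Icc b] by auto
  obtain Kd where Kd: "\<And>r. r \<in> {0..T} \<Longrightarrow> \<bar>D r\<bar> \<le> Kd"
    using continuous_on_compact_bound[OF compact_Icc D] by auto
  let ?K = "{0..T} \<times> {-(Kb+Kd)..Kb+Kd}"
  have K: "compact ?K" by (intro compact_Times compact_Icc)
  have u1: "uniformly_continuous_on ?K (\<lambda>p. \<phi>1 (fst p) (snd p))"
    by (intro compact_uniformly_continuous K continuous_on_subset[OF c1]) auto
  have ut: "uniformly_continuous_on ?K (\<lambda>p. \<phi>t (fst p) (snd p))"
    by (intro compact_uniformly_continuous K continuous_on_subset[OF ct]) auto
  obtain h1 where h1: "0 < h1" "\<And>p q. p \<in> ?K \<Longrightarrow> q \<in> ?K \<Longrightarrow> dist p q < h1 \<Longrightarrow>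
      dist (\<phi>1 (fst p) (snd p)) (\<phi>1 (fst q) (snd q)) < e"
    using u1 e unfolding uniformly_continuous_on_def by metis
  obtain ht where ht: "0 < ht" "\<And>p q. p \<in> ?K \<Longrightarrow> q \<in> ?K \<Longrightarrow> dist p q < ht \<Longrightarrow>
      dist (\<phi>t (fst p) (snd p)) (\<phi>t (fst q) (snd q)) < e"
    using ut e unfolding uniformly_continuous_on_def by metis
  define h where "h = min h1 ht / 3"
  have h: "0 < h" using h1 ht by (simp add: h_def)
  have near: "dist (r, y) (s, z) < h1 \<and> dist (r, y) (s, z) < ht"
    if "\<bar>r - s\<bar> < h" "\<bar>y - z\<bar> < 2 * h" for r s y z :: real
  proof -
    have "dist (r, y) (s, z) \<le> \<bar>r - s\<bar> + \<bar>y - z\<bar>"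
      unfolding dist_Pair_Pair dist_real_def using sqrt_sum_squares_le_sum_abs by simp
    then show ?thesis using that unfolding h_def by linarith
  qed
  have "uniformly_continuous_on {0..T} b" "uniformly_continuous_on {0..T} D"
    using b D by (auto intro: compact_uniformly_continuous)
  then obtain eb ed where eb: "0 < eb" "\<And>r s. r \<in> {0..T} \<Longrightarrow> s \<in> {0..T} \<Longrightarrow> dist r s < eb \<Longrightarrow> dist (b r) (b s) < h"
    and ed: "0 < ed" "\<And>r s. r \<in> {0..T} \<Longrightarrow> s \<in> {0..T} \<Longrightarrow> dist r s < ed \<Longrightarrow> dist (D r) (D s) < h"
    using h unfolding uniformly_continuous_on_def by metis
  define \<eta> where "\<eta> = min h (min eb ed)"
  show "\<exists>\<eta>>0. \<forall>u v. 0 \<le> u \<longrightarrow> u \<le> v \<longrightarrow> v \<le> T \<longrightarrow> v - u < \<eta> \<longrightarrow>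
        \<bar>\<phi> v (b v + D v) - \<phi> u (b v + D u) - integral {u..v} g\<bar> \<le> e * integral {u..v} (\<lambda>r. 1 + d r)"
  proof (intro exI[of _ \<eta>] conjI allI impI)
    show "0 < \<eta>" using h eb ed by (simp add: \<eta>_def)
    fix u v assume uv: "0 \<le> u" "u \<le> v" "v \<le> T" "v - u < \<eta>"
    have sub: "{u..v} \<subseteq> {0..T}" using uv by auto
    have di: "d integrable_on {u..v}" by (rule integrable_subinterval_real[OF d(1) sub])
    have Dmono: "D r \<le> D s" if "0 \<le> r" "r \<le> s" "s \<le> T" for r s
    proof -
      have "0 \<le> integral {r..s} d"
        by (intro Henstock_Kurzweil_Integration.integral_nonneg integrable_subinterval_real[OF d(1)]) (use that d in auto)
      with Dd[OF that] show ?thesis by simp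
    qed
    have DD: "D u \<le> D v" using Dmono uv by simp
    obtain z where z: "D u \<le> z" "z \<le> D v" "\<phi> v (b v + D v) - \<phi> v (b v + D u) = (D v - D u) * \<phi>1 v (b v + z)"
    proof (cases "D u = D v")
      case True then show ?thesis using that[of "D u"] by simp
    next
      case False
      then have lt: "b v + D u < b v + D v" using DD by simp
      from MVT2[OF lt, of "\<phi> v" "\<phi>1 v"] d1[of v] uv obtain w where
        w: "b v + D u < w" "w < b v + D v" "\<phi> v (b v + D v) - \<phi> v (b v + D u) = (b v + D v - (b v + D u)) * \<phi>1 v w"
        by auto
      show ?thesis by (rule that[of "w - b v"]) (use w in auto)
    qed
    have ft: "((\<lambda>r. \<phi>t r (b v + D u)) has_integral (\<phi> v (b v + D u) - \<phi> u (b v + D u))) {u..v}"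
      using uv(2)
    proof (rule fundamental_theorem_of_calculus)
      fix r assume "r \<in> {u..v}"
      then show "((\<lambda>r. \<phi> r (b v + D u)) has_vector_derivative \<phi>t r (b v + D u)) (at r within {u..v})"
        using has_field_derivative_subset[OF dt sub, of r] sub
        by (auto simp: has_real_derivative_iff_has_vector_derivative)
    qed
    have f1: "((\<lambda>r. \<phi>1 v (b v + z) * d r) has_integral (D v - D u) * \<phi>1 v (b v + z)) {u..v}"
      using has_integral_mult_right[OF integrable_integral[OF di], of "\<phi>1 v (b v + z)"] Dd uv by (simp add: mult.commute)
    have hg: "(g has_integral integral {u..v} g) {u..v}"
      by (intro integrable_integral integrable_subinterval_real[OF gi sub])
    have eq: "((\<lambda>r. \<phi>1 v (b v + z) * d r + \<phi>t r (b v + D u) - g r) has_integral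
        (\<phi> v (b v + D v) - \<phi> u (b v + D u) - integral {u..v} g)) {u..v}"
      using has_integral_diff[OF has_integral_add[OF f1 ft] hg] z(3)[symmetric] by simp
    have bnd: "norm (\<phi>1 v (b v + z) * d r + \<phi>t r (b v + D u) - g r) \<le> e * (1 + d r)" if r: "r \<in> {u..v}" for r
    proof -
      have rT: "r \<in> {0..T}" "u \<in> {0..T}" "v \<in> {0..T}" using r sub uv by auto
      have mem: "(v, b v + z) \<in> ?K" "(r, b v + D u) \<in> ?K" "(r, ?X r) \<in> ?K"
        using Kb[OF rT(1)] Kb[OF rT(3)] Kd[OF rT(1)] Kd[OF rT(2)] Kd[OF rT(3)] z rT by (auto simp: abs_le_iff)
      have rv: "\<bar>v - r\<bar> < h" using r uv by (auto simp: \<eta>_def)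
      have bb: "\<bar>b v - b r\<bar> < h" using eb(2)[of v r] rT r uv by (auto simp: dist_real_def \<eta>_def)
      have dd: "\<bar>D v - D u\<bar> < h" using ed(2)[of v u] rT r uv by (auto simp: dist_real_def \<eta>_def)
      have Dr: "D u \<le> D r" "D r \<le> D v" using Dmono r uv by auto
      have n1: "\<bar>\<phi>1 v (b v + z) - \<phi>1 r (?X r)\<bar> \<le> e"
        using h1(2)[OF mem(1) mem(3)] near[of v r "b v + z" "?X r"] rv bb dd Dr z by (simp add: dist_real_def)
      have n2: "\<bar>\<phi>t r (b v + D u) - \<phi>t r (?X r)\<bar> \<le> e"
        using ht(2)[OF mem(2) mem(3)] near[of r r "b v + D u" "?X r"] rv bb dd Dr z h by (simp add: dist_real_def)
      have "\<phi>1 v (b v + z) * d r + \<phi>t r (b v + D u) - g r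
          = (\<phi>1 v (b v + z) - \<phi>1 r (?X r)) * d r + (\<phi>t r (b v + D u) - \<phi>t r (?X r))"
        by (simp add: g_def algebra_simps)
      also have "norm \<dots> \<le> \<bar>\<phi>1 v (b v + z) - \<phi>1 r (?X r)\<bar> * d r + \<bar>\<phi>t r (b v + D u) - \<phi>t r (?X r)\<bar>"
        using d(2)[OF rT(1)] abs_triangle_ineq[of "(\<phi>1 v (b v + z) - \<phi>1 r (?X r)) * d r"] by (simp add: abs_mult)
      also have "\<dots> \<le> e * d r + e" using n1 n2 d(2)[OF rT(1)] by (intro add_mono mult_right_mono) auto
      finally show ?thesis by (simp add: algebra_simps)
    qed
    have hk: "((\<lambda>r. e * (1 + d r)) has_integral e * integral {u..v} (\<lambda>r. 1 + d r)) {u..v}"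
      by (intro has_integral_mult_right integrable_integral integrable_add di) auto
    have "norm (integral {u..v} (\<lambda>r. \<phi>1 v (b v + z) * d r + \<phi>t r (b v + D u) - g r))
        \<le> integral {u..v} (\<lambda>r. e * (1 + d r))"
      by (rule Henstock_Kurzweil_Integration.integral_norm_bound_integral) (use eq hk bnd in \<open>auto simp: has_integral_iff\<close>)
    then show "\<bar>\<phi> v (b v + D v) - \<phi> u (b v + D u) - integral {u..v} g\<bar> \<le> e * integral {u..v} (\<lambda>r. 1 + d r)"
      using eq hk by (simp add: has_integral_iff)
  qed
qed


section \<open>Increments of Brownian motion\<close>

locale brownian_setting = prob_space M for M :: "'a measure" +
  fixes F :: "real \<Rightarrow> 'a measure" and B :: "real \<Rightarrow> 'a \<Rightarrow> real"
  assumes bm: "brownian_motion_wrt M F B"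
    and space_F: "\<And>u. space (F u) = space M"
begin

lemma B_start: "AE \<omega> in M. B 0 \<omega> = 0"
  using bm by (simp add: brownian_motion_wrt_def)

lemma B_continuous: "\<omega> \<in> space M \<Longrightarrow> continuous_on {0..T} (\<lambda>u. B u \<omega>)"
  using bm unfolding brownian_motion_wrt_def by (auto intro: continuous_on_subset)

lemma B_adapted: "0 \<le> u \<Longrightarrow> B u \<in> borel_measurable (F u)"
  using bm by (simp add: brownian_motion_wrt_def)

lemma increment_indep: "0 \<le> u \<Longrightarrow> u < v \<Longrightarrow> indep_set (sets (F u))
    (sets (vimage_algebra (space M) (\<lambda>\<omega>. B v \<omega> - B u \<omega>) borel))"
  using bm by (simp add: brownian_motion_wrt_def)

lemma increment_normal: "0 \<le> u \<Longrightarrow> u < v \<Longrightarrow>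
    distributed M lborel (\<lambda>\<omega>. B v \<omega> - B u \<omega>) (normal_density 0 (sqrt (v - u)))"
  using bm by (simp add: brownian_motion_wrt_def)

lemma subalgebra_F: "0 \<le> u \<Longrightarrow> subalgebra M (F u)"
  using indep_setD_ev1[OF increment_indep[of u "u + 1"]] space_F by (auto simp: subalgebra_def)

lemma adapted_measurable: "0 \<le> u \<Longrightarrow> f \<in> borel_measurable (F u) \<Longrightarrow> f \<in> borel_measurable M"
  using measurable_from_subalg[OF subalgebra_F] by blast

lemma B_measurable: "0 \<le> u \<Longrightarrow> B u \<in> borel_measurable M"
  by (rule adapted_measurable[OF _ B_adapted])

lemma increment_integral:
  fixes g :: "real \<Rightarrow> real"
  assumes "0 \<le> u" "u < v" "g \<in> borel_measurable borel"
  shows "expectation (\<lambda>\<omega>. g (B v \<omega> - B u \<omega>)) = (LINT z|lborel. normal_density 0 (sqrt (v - u)) z * g z)"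
    and "integrable M (\<lambda>\<omega>. g (B v \<omega> - B u \<omega>)) \<longleftrightarrow>
      integrable lborel (\<lambda>z. normal_density 0 (sqrt (v - u)) z * g z)"
  using distributed_integral[OF increment_normal[OF assms(1,2)], of g]
    distributed_integrable[OF increment_normal[OF assms(1,2)], of g] assms(3)
  by (simp_all add: normal_density_nonneg)

lemma increment_moments:
  assumes "0 \<le> u" "u < v"
  shows "integrable M (\<lambda>\<omega>. B v \<omega> - B u \<omega>)" "expectation (\<lambda>\<omega>. B v \<omega> - B u \<omega>) = 0"
    and "integrable M (\<lambda>\<omega>. (B v \<omega> - B u \<omega>)\<^sup>2)" "expectation (\<lambda>\<omega>. (B v \<omega> - B u \<omega>)\<^sup>2) = v - u"
    and "integrable M (\<lambda>\<omega>. \<bar>B v \<omega> - B u \<omega>\<bar> ^ 3)"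
    and "expectation (\<lambda>\<omega>. \<bar>B v \<omega> - B u \<omega>\<bar> ^ 3) \<le> 2 * sqrt (v - u) ^ 3"
proof -
  let ?s = "sqrt (v - u)"
  have s: "0 < ?s" using assms by simp
  show "integrable M (\<lambda>\<omega>. B v \<omega> - B u \<omega>)"
    using increment_integral(2)[OF assms, of "\<lambda>z. z"] integrable_normal_moment[OF s, of 0 1] by simp
  show "expectation (\<lambda>\<omega>. B v \<omega> - B u \<omega>) = 0"
    using increment_integral(1)[OF assms, of "\<lambda>z. z"] integral_normal_moment_odd[OF s, of 0 0] by simp
  show "integrable M (\<lambda>\<omega>. (B v \<omega> - B u \<omega>)\<^sup>2)"
    using increment_integral(2)[OF assms, of "\<lambda>z. z\<^sup>2"] integrable_normal_moment[OF s, of 0 2] by simp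
  show "expectation (\<lambda>\<omega>. (B v \<omega> - B u \<omega>)\<^sup>2) = v - u"
    using increment_integral(1)[OF assms, of "\<lambda>z. z\<^sup>2"] integral_normal_moment_even[OF s, of 0 1] assms
    by (simp add: fact_numeral)
  show "integrable M (\<lambda>\<omega>. \<bar>B v \<omega> - B u \<omega>\<bar> ^ 3)"
    using increment_integral(2)[OF assms, of "\<lambda>z. \<bar>z\<bar> ^ 3"] integrable_normal_moment_abs[OF s, of 0 3] by simp
  have "expectation (\<lambda>\<omega>. \<bar>B v \<omega> - B u \<omega>\<bar> ^ 3) = 2 * ?s ^ 3 * sqrt (2 / pi)"
    using increment_integral(1)[OF assms, of "\<lambda>z. \<bar>z\<bar> ^ 3"] integral_normal_moment_abs_odd[OF s, of 0 1]
    by (simp add: numeral_3_eq_3)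
  also have "\<dots> \<le> 2 * ?s ^ 3 * 1"
    using s pi_ge_two by (intro mult_left_mono) (auto intro!: real_le_lsqrt)
  finally show "expectation (\<lambda>\<omega>. \<bar>B v \<omega> - B u \<omega>\<bar> ^ 3) \<le> 2 * ?s ^ 3" by simp
qed

lemma adapted_times_increment:
  fixes g :: "real \<Rightarrow> real"
  assumes uv: "0 \<le> u" "u < v" and X: "X \<in> borel_measurable (F u)" "integrable M X"
    and g: "g \<in> borel_measurable borel" "integrable M (\<lambda>\<omega>. g (B v \<omega> - B u \<omega>))"
  shows "integrable M (\<lambda>\<omega>. X \<omega> * g (B v \<omega> - B u \<omega>))"
    and "expectation (\<lambda>\<omega>. X \<omega> * g (B v \<omega> - B u \<omega>)) = expectation X * expectation (\<lambda>\<omega>. g (B v \<omega> - B u \<omega>))"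
proof -
  let ?D = "\<lambda>\<omega>. B v \<omega> - B u \<omega>"
  have D: "?D \<in> borel_measurable M" using B_measurable uv by auto
  have "sigma_sets (space M) {X -` A \<inter> space M |A. A \<in> sets borel} \<subseteq> sets (F u)"
    using sets.sigma_sets_subset[of "{X -` A \<inter> space M |A. A \<in> sets borel}" "F u"]
      measurable_sets[OF X(1)] space_F by auto
  moreover have "sigma_sets (space M) {?D -` A \<inter> space M |A. A \<in> sets borel}
      \<subseteq> sets (vimage_algebra (space M) ?D borel)"
    by (subst sets_vimage_algebra) simp
  ultimately have "indep_set (sigma_sets (space M) {X -` A \<inter> space M |A. A \<in> sets borel})
      (sigma_sets (space M) {?D -` A \<inter> space M |A. A \<in> sets borel})"
    using increment_indep[OF uv] unfolding indep_set_def
    by (elim indep_sets_mono_sets) (auto split: bool.split)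
  then have "indep_var borel X borel ?D"
    unfolding indep_var_eq using adapted_measurable[OF uv(1) X(1)] D by simp
  then have "indep_var borel ((\<lambda>y. y) \<circ> X) borel (g \<circ> ?D)"
    by (rule indep_var_compose) (use g in auto)
  then have i: "indep_var borel X borel (\<lambda>\<omega>. g (?D \<omega>))" by (simp add: comp_def)
  show "integrable M (\<lambda>\<omega>. X \<omega> * g (?D \<omega>))" by (rule indep_var_integrable[OF i X(2) g(2)])
  show "expectation (\<lambda>\<omega>. X \<omega> * g (?D \<omega>)) = expectation X * expectation (\<lambda>\<omega>. g (?D \<omega>))"
    by (rule indep_var_lebesgue_integral[OF i X(2) g(2)])
qed

lemma adapted_bounded_integrable:
  fixes X :: "'a \<Rightarrow> real"
  assumes "0 \<le> u" "X \<in> borel_measurable (F u)" "\<And>\<omega>. \<omega> \<in> space M \<Longrightarrow> \<bar>X \<omega>\<bar> \<le> C"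
  shows "integrable M X"
  by (rule integrable_const_bound[where B = C]) (use assms adapted_measurable in auto)

lemma taylor2_bound:
  fixes f :: "real \<Rightarrow> real"
  assumes "\<And>y. (f has_real_derivative f1 y) (at y)" "\<And>y. (f1 has_real_derivative f2 y) (at y)"
    "\<And>y. (f2 has_real_derivative f3 y) (at y)" "\<And>y. \<bar>f3 y\<bar> \<le> C"
  shows "\<bar>f (y + h) - f y - f1 y * h - f2 y * h\<^sup>2 / 2\<bar> \<le> C * \<bar>h\<bar> ^ 3"
proof -
  define d :: "nat \<Rightarrow> real \<Rightarrow> real" where "d m = (\<lambda>z. ([f, f1, f2, f3] ! m) (y + z))" for m
  have s: "((\<lambda>z. g (y + z)) has_real_derivative g' (y + z)) (at z)"
    if "\<And>y. (g has_real_derivative g' y) (at y)" for g g' :: "real \<Rightarrow> real" and z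
    using that DERIV_shift[of g "g' (y + z)" z y] by (simp add: add.commute)
  have "\<exists>t. \<bar>t\<bar> \<le> \<bar>h\<bar> \<and> f (y + h) = (\<Sum>m<3. d m 0 / fact m * h ^ m) + d 3 t / fact 3 * h ^ 3"
  proof (rule Maclaurin_bi_le)
    show "d 0 = (\<lambda>h. f (y + h))" by (simp add: d_def)
    show "\<forall>m t. m < 3 \<and> \<bar>t\<bar> \<le> \<bar>h\<bar> \<longrightarrow> (d m has_real_derivative d (Suc m) t) (at t)"
      using s[OF assms(1)] s[OF assms(2)] s[OF assms(3)]
      by (auto simp: d_def less_Suc_eq numeral_3_eq_3)
  qed
  then obtain t where "f (y + h) = (\<Sum>m<3. d m 0 / fact m * h ^ m) + d 3 t / fact 3 * h ^ 3" by blast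
  then have "f (y + h) - f y - f1 y * h - f2 y * h\<^sup>2 / 2 = f3 (y + t) / 6 * h ^ 3"
    by (simp add: d_def numeral_3_eq_3 power2_eq_square)
  also have "\<bar>\<dots>\<bar> = \<bar>f3 (y + t)\<bar> / 6 * \<bar>h\<bar> ^ 3" by (simp add: abs_mult power_abs)
  also have "\<dots> \<le> C * \<bar>h\<bar> ^ 3"
    using assms(4)[of "y + t"] by (intro mult_right_mono) auto
  finally show ?thesis .
qed

text \<open>
  One Brownian step, up to order \<open>(v - u) powr (3/2)\<close>: in the second order Taylor expansion the
  linear term vanishes in expectation and the quadratic one contributes \<open>v - u\<close>, because the
  coefficients are known at time \<open>u\<close> and the increment is independent of that past; the third
  absolute moment controls the rest. Over \<open>n\<close> steps of size \<open>T / n\<close> these errors sum to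
  \<open>O(1 / sqrt n)\<close>.
\<close>

lemma expected_increment:
  fixes f f1 f2 f3 :: "'a \<Rightarrow> real \<Rightarrow> real" and D :: "'a \<Rightarrow> real"
  assumes uv: "0 \<le> u" "u < v"
    and d1: "\<And>\<omega> y. \<omega> \<in> space M \<Longrightarrow> (f \<omega> has_real_derivative f1 \<omega> y) (at y)"
    and d2: "\<And>\<omega> y. \<omega> \<in> space M \<Longrightarrow> (f1 \<omega> has_real_derivative f2 \<omega> y) (at y)"
    and d3: "\<And>\<omega> y. \<omega> \<in> space M \<Longrightarrow> (f2 \<omega> has_real_derivative f3 \<omega> y) (at y)"
    and bd: "\<And>\<omega> y. \<omega> \<in> space M \<Longrightarrow> \<bar>f \<omega> y\<bar> \<le> C" "\<And>\<omega> y. \<omega> \<in> space M \<Longrightarrow> \<bar>f1 \<omega> y\<bar> \<le> C"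
      "\<And>\<omega> y. \<omega> \<in> space M \<Longrightarrow> \<bar>f2 \<omega> y\<bar> \<le> C" "\<And>\<omega> y. \<omega> \<in> space M \<Longrightarrow> \<bar>f3 \<omega> y\<bar> \<le> C"
    and m: "(\<lambda>\<omega>. f \<omega> (B v \<omega> + D \<omega>)) \<in> borel_measurable M"
      "(\<lambda>\<omega>. f \<omega> (B u \<omega> + D \<omega>)) \<in> borel_measurable (F u)"
      "(\<lambda>\<omega>. f1 \<omega> (B u \<omega> + D \<omega>)) \<in> borel_measurable (F u)"
      "(\<lambda>\<omega>. f2 \<omega> (B u \<omega> + D \<omega>)) \<in> borel_measurable (F u)"
  shows "\<bar>expectation (\<lambda>\<omega>. f \<omega> (B v \<omega> + D \<omega>) - f \<omega> (B u \<omega> + D \<omega>) - f2 \<omega> (B u \<omega> + D \<omega>) / 2 * (v - u))\<bar>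
    \<le> 2 * C * sqrt (v - u) ^ 3"
proof -
  let ?h = "\<lambda>\<omega>. B v \<omega> - B u \<omega>" and ?y = "\<lambda>\<omega>. B u \<omega> + D \<omega>"
  note mom = increment_moments[OF uv]
  have i0: "integrable M (\<lambda>\<omega>. f \<omega> (B v \<omega> + D \<omega>))"
    by (rule integrable_const_bound[where B = C]) (use m bd in auto)
  have i0': "integrable M (\<lambda>\<omega>. f \<omega> (?y \<omega>))" by (rule adapted_bounded_integrable[OF uv(1) m(2) bd(1)])
  have i1: "integrable M (\<lambda>\<omega>. f1 \<omega> (?y \<omega>))" by (rule adapted_bounded_integrable[OF uv(1) m(3) bd(2)])
  have i2: "integrable M (\<lambda>\<omega>. f2 \<omega> (?y \<omega>))" by (rule adapted_bounded_integrable[OF uv(1) m(4) bd(3)])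
  have e1: "integrable M (\<lambda>\<omega>. f1 \<omega> (?y \<omega>) * ?h \<omega>)" "expectation (\<lambda>\<omega>. f1 \<omega> (?y \<omega>) * ?h \<omega>) = 0"
    using adapted_times_increment[OF uv m(3) i1, of "\<lambda>z. z"] mom(1,2) by auto
  have e2: "integrable M (\<lambda>\<omega>. f2 \<omega> (?y \<omega>) * (?h \<omega>)\<^sup>2)"
    "expectation (\<lambda>\<omega>. f2 \<omega> (?y \<omega>) * (?h \<omega>)\<^sup>2) = expectation (\<lambda>\<omega>. f2 \<omega> (?y \<omega>)) * (v - u)"
    using adapted_times_increment[OF uv m(4) i2, of "\<lambda>z. z\<^sup>2"] mom(3,4) by auto
  let ?R = "\<lambda>\<omega>. f \<omega> (B v \<omega> + D \<omega>) - f \<omega> (?y \<omega>) - f1 \<omega> (?y \<omega>) * ?h \<omega> - f2 \<omega> (?y \<omega>) * (?h \<omega>)\<^sup>2 / 2"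
  have iR: "integrable M ?R" using i0 i0' e1 e2 by (intro Bochner_Integration.integrable_diff) auto
  have R: "\<bar>?R \<omega>\<bar> \<le> C * \<bar>?h \<omega>\<bar> ^ 3" if "\<omega> \<in> space M" for \<omega>
    using taylor2_bound[OF d1[OF that] d2[OF that] d3[OF that] bd(4)[OF that], of "?y \<omega>" "?h \<omega>"]
    by (simp add: algebra_simps)
  have C: "0 \<le> C" using bd(1) not_empty abs_ge_zero order_trans by (metis ex_in_conv)
  have "\<bar>expectation ?R\<bar> \<le> expectation (\<lambda>\<omega>. \<bar>?R \<omega>\<bar>)" by (rule integral_abs_bound)
  also have "\<dots> \<le> expectation (\<lambda>\<omega>. C * \<bar>?h \<omega>\<bar> ^ 3)"
    by (rule integral_mono) (use iR R mom(5) in auto)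
  also have "\<dots> \<le> C * (2 * sqrt (v - u) ^ 3)" using C mom(6) by (simp add: mult_left_mono)
  finally have bound: "\<bar>expectation ?R\<bar> \<le> 2 * C * sqrt (v - u) ^ 3" by simp
  have "expectation (\<lambda>\<omega>. f \<omega> (B v \<omega> + D \<omega>) - f \<omega> (?y \<omega>) - f2 \<omega> (?y \<omega>) / 2 * (v - u)) = expectation ?R"
    using i0 i0' i2 e1 e2 by (simp add: Bochner_Integration.integrable_diff)
  then show ?thesis using bound by simp
qed

end


section \<open>Ito's formula in expectation\<close>

lemma rectangle_rule_error:
  fixes q :: "real \<Rightarrow> real"
  assumes q: "continuous_on {0..T} q" and e: "0 < e"
  shows "\<exists>d>0. \<forall>u v. 0 \<le> u \<longrightarrow> u \<le> v \<longrightarrow> v \<le> T \<longrightarrow> v - u < d \<longrightarrow>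
    \<bar>q u * (v - u) - integral {u..v} q\<bar> \<le> e * (v - u)"
proof -
  have "uniformly_continuous_on {0..T} q" using q by (intro compact_uniformly_continuous) auto
  then obtain d where d: "0 < d" "\<And>r s. r \<in> {0..T} \<Longrightarrow> s \<in> {0..T} \<Longrightarrow> dist r s < d \<Longrightarrow> dist (q r) (q s) < e"
    using e unfolding uniformly_continuous_on_def by metis
  show ?thesis
  proof (intro exI[of _ d] conjI allI impI)
    fix u v assume uv: "0 \<le> u" "u \<le> v" "v \<le> T" "v - u < d"
    have qi: "q integrable_on {u..v}"
      by (rule integrable_continuous_real, rule continuous_on_subset[OF q]) (use uv in auto)
    have "integral {u..v} (\<lambda>r. q u - q r) = q u * (v - u) - integral {u..v} q"
      using uv qi by (subst Henstock_Kurzweil_Integration.integral_diff) auto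
    moreover have "norm (integral {u..v} (\<lambda>r. q u - q r)) \<le> integral {u..v} (\<lambda>r. e)"
    proof (rule Henstock_Kurzweil_Integration.integral_norm_bound_integral)
      fix r assume "r \<in> {u..v}"
      then show "norm (q u - q r) \<le> e" using d(2)[of u r] uv by (auto simp: dist_real_def)
    qed (use qi in \<open>auto intro: integrable_diff\<close>)
    ultimately show "\<bar>q u * (v - u) - integral {u..v} q\<bar> \<le> e * (v - u)" using uv by (simp add: mult.commute)
  qed (use d in auto)
qed

context brownian_setting
begin

lemma joint_measurable_along:
  assumes u: "0 \<le> u" and f: "(\<lambda>p. f (fst p) (snd p)) \<in> borel_measurable (F u \<Otimes>\<^sub>M borel)"
  shows "Y \<in> borel_measurable (F u) \<Longrightarrow> (\<lambda>\<omega>. f \<omega> (Y \<omega> :: real) :: real) \<in> borel_measurable (F u)"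
    and "Y \<in> borel_measurable M \<Longrightarrow> (\<lambda>\<omega>. f \<omega> (Y \<omega>)) \<in> borel_measurable M"
proof -
  have "(\<lambda>\<omega>. (\<omega>, Y \<omega>)) \<in> measurable N (F u \<Otimes>\<^sub>M borel)"
    if "(\<lambda>\<omega>. \<omega>) \<in> measurable N (F u)" "Y \<in> borel_measurable N" for N
    using that by measurable
  from measurable_compose[OF this f] have *: "(\<lambda>\<omega>. f \<omega> (Y \<omega>)) \<in> borel_measurable N"
    if "(\<lambda>\<omega>. \<omega>) \<in> measurable N (F u)" "Y \<in> borel_measurable N" for N
    using that by simp
  show "Y \<in> borel_measurable (F u) \<Longrightarrow> (\<lambda>\<omega>. f \<omega> (Y \<omega>)) \<in> borel_measurable (F u)"
    by (rule *) auto
  have "(\<lambda>\<omega>. \<omega>) \<in> measurable M (F u)"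
    by (rule measurable_from_subalg[OF subalgebra_F[OF u]]) simp
  then show "Y \<in> borel_measurable M \<Longrightarrow> (\<lambda>\<omega>. f \<omega> (Y \<omega>)) \<in> borel_measurable M"
    by (rule *) 
qed

text \<open>
  The expectation of Ito's formula for a random field \<open>\<phi> \<omega> u\<close> evaluated at \<open>B u + D u\<close>, where \<open>D\<close>
  is nondecreasing and absolutely continuous with density \<open>d\<close>. No stochastic integral appears:
  over a grid, each increment splits into a Brownian step with everything else frozen at the left
  end point (\<open>expected_increment\<close>), and a step of time and of \<open>D\<close> with \<open>B\<close> at the right
  end point (\<open>increment_along_path\<close>); the martingale part has already dropped out in expectation.
  The random majorant \<open>H\<close> is what lets the limit of the Riemann sums pass through the expectation;
  it has to be random, since on the side of the exponential functional the time derivative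
  \<open>\<phi>t\<close> is not bounded uniformly in \<open>\<omega>\<close>.
\<close>

lemma ito_expectation:
  fixes \<phi> \<phi>t \<phi>1 \<phi>2 \<phi>3 :: "'a \<Rightarrow> real \<Rightarrow> real \<Rightarrow> real" and D :: "real \<Rightarrow> 'a \<Rightarrow> real"
    and d k :: "'a \<Rightarrow> real \<Rightarrow> real"
  assumes T: "0 < T"
    and dt: "\<And>\<omega> u y. \<omega> \<in> space M \<Longrightarrow> u \<in> {0..T} \<Longrightarrow>
      ((\<lambda>u. \<phi> \<omega> u y) has_real_derivative \<phi>t \<omega> u y) (at u within {0..T})"
    and d1: "\<And>\<omega> u y. \<omega> \<in> space M \<Longrightarrow> u \<in> {0..T} \<Longrightarrow> (\<phi> \<omega> u has_real_derivative \<phi>1 \<omega> u y) (at y)"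
    and d2: "\<And>\<omega> u y. \<omega> \<in> space M \<Longrightarrow> u \<in> {0..T} \<Longrightarrow> (\<phi>1 \<omega> u has_real_derivative \<phi>2 \<omega> u y) (at y)"
    and d3: "\<And>\<omega> u y. \<omega> \<in> space M \<Longrightarrow> u \<in> {0..T} \<Longrightarrow> (\<phi>2 \<omega> u has_real_derivative \<phi>3 \<omega> u y) (at y)"
    and ct: "\<And>\<omega>. \<omega> \<in> space M \<Longrightarrow> continuous_on ({0..T} \<times> UNIV) (\<lambda>p. \<phi>t \<omega> (fst p) (snd p))"
    and c1: "\<And>\<omega>. \<omega> \<in> space M \<Longrightarrow> continuous_on ({0..T} \<times> UNIV) (\<lambda>p. \<phi>1 \<omega> (fst p) (snd p))"
    and c2: "\<And>\<omega>. \<omega> \<in> space M \<Longrightarrow> continuous_on ({0..T} \<times> UNIV) (\<lambda>p. \<phi>2 \<omega> (fst p) (snd p))"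
    and bd: "\<And>\<omega> u y. \<omega> \<in> space M \<Longrightarrow> u \<in> {0..T} \<Longrightarrow> \<bar>\<phi> \<omega> u y\<bar> \<le> C"
      "\<And>\<omega> u y. \<omega> \<in> space M \<Longrightarrow> u \<in> {0..T} \<Longrightarrow> \<bar>\<phi>1 \<omega> u y\<bar> \<le> C"
      "\<And>\<omega> u y. \<omega> \<in> space M \<Longrightarrow> u \<in> {0..T} \<Longrightarrow> \<bar>\<phi>2 \<omega> u y\<bar> \<le> C"
      "\<And>\<omega> u y. \<omega> \<in> space M \<Longrightarrow> u \<in> {0..T} \<Longrightarrow> \<bar>\<phi>3 \<omega> u y\<bar> \<le> C"
      "\<And>\<omega> u y. \<omega> \<in> space M \<Longrightarrow> u \<in> {0..T} \<Longrightarrow> \<bar>\<phi>t \<omega> u y\<bar> \<le> k \<omega> u"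
    and k: "\<And>\<omega>. \<omega> \<in> space M \<Longrightarrow> k \<omega> integrable_on {0..T}"
    and m: "\<And>u. u \<in> {0..T} \<Longrightarrow> (\<lambda>p. \<phi> (fst p) u (snd p)) \<in> borel_measurable (F u \<Otimes>\<^sub>M borel)"
      "\<And>u. u \<in> {0..T} \<Longrightarrow> (\<lambda>p. \<phi>1 (fst p) u (snd p)) \<in> borel_measurable (F u \<Otimes>\<^sub>M borel)"
      "\<And>u. u \<in> {0..T} \<Longrightarrow> (\<lambda>p. \<phi>2 (fst p) u (snd p)) \<in> borel_measurable (F u \<Otimes>\<^sub>M borel)"
    and Dm: "\<And>u. u \<in> {0..T} \<Longrightarrow> D u \<in> borel_measurable (F u)"
    and Dc: "\<And>\<omega>. \<omega> \<in> space M \<Longrightarrow> continuous_on {0..T} (\<lambda>u. D u \<omega>)"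
    and d: "\<And>\<omega>. \<omega> \<in> space M \<Longrightarrow> d \<omega> integrable_on {0..T}"
      "\<And>\<omega> r. \<omega> \<in> space M \<Longrightarrow> r \<in> {0..T} \<Longrightarrow> 0 \<le> d \<omega> r"
    and Dd: "\<And>\<omega> u v. \<omega> \<in> space M \<Longrightarrow> 0 \<le> u \<Longrightarrow> u \<le> v \<Longrightarrow> v \<le> T \<Longrightarrow> D v \<omega> - D u \<omega> = integral {u..v} (d \<omega>)"
    and H: "integrable M H" "\<And>\<omega>. \<omega> \<in> space M \<Longrightarrow> integral {0..T} (k \<omega>) + integral {0..T} (d \<omega>) \<le> H \<omega>"
  defines "X \<equiv> \<lambda>\<omega> r. B r \<omega> + D r \<omega>"
  defines "Z \<equiv> \<lambda>\<omega>. integral {0..T} (\<lambda>r. \<phi>2 \<omega> r (X \<omega> r) / 2 + \<phi>t \<omega> r (X \<omega> r) + \<phi>1 \<omega> r (X \<omega> r) * d \<omega> r)"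
  shows "integrable M Z \<and>
    expectation (\<lambda>\<omega>. \<phi> \<omega> T (X \<omega> T)) - expectation (\<lambda>\<omega>. \<phi> \<omega> 0 (X \<omega> 0)) = expectation Z"
proof -
  have T0: "0 \<le> T" using T by simp
  have C: "0 \<le> C" using bd(1)[of _ 0] T0 not_empty abs_ge_zero order_trans by (metis ex_in_conv atLeastAtMost_iff order_refl)
  \<comment> \<open>The grid sums of \<open>J\<close> converge to \<open>Z\<close> for every \<open>\<omega>\<close>; \<open>J\<close> differs from the increment of \<open>\<phi>\<close> by the Taylor error \<open>E\<close>.\<close>
  define J where "J \<omega> u v = \<phi>2 \<omega> u (X \<omega> u) / 2 * (v - u) + (\<phi> \<omega> v (B v \<omega> + D v \<omega>) - \<phi> \<omega> u (B v \<omega> + D u \<omega>))" for \<omega> u v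
  define E where "E \<omega> u v = \<phi> \<omega> u (B v \<omega> + D u \<omega>) - \<phi> \<omega> u (B u \<omega> + D u \<omega>) - \<phi>2 \<omega> u (B u \<omega> + D u \<omega>) / 2 * (v - u)" for \<omega> u v
  define S where "S n \<omega> = (\<Sum>i<Suc n. J \<omega> (grid T n i) (grid T n (Suc i)))" for n \<omega>
  have Xm: "(\<lambda>\<omega>. B v \<omega> + D u \<omega>) \<in> borel_measurable M" if "u \<in> {0..T}" "v \<in> {0..T}" for u v
    using B_measurable adapted_measurable[OF _ Dm] that by auto
  have XF: "(\<lambda>\<omega>. B u \<omega> + D u \<omega>) \<in> borel_measurable (F u)" if "u \<in> {0..T}" for u
    using B_adapted Dm that by auto
  note jm = joint_measurable_along[where f = "\<lambda>\<omega>. \<phi> \<omega> u" for u] joint_measurable_along[where f = "\<lambda>\<omega>. \<phi>1 \<omega> u" for u]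
    joint_measurable_along[where f = "\<lambda>\<omega>. \<phi>2 \<omega> u" for u]
  have \<phi>m: "(\<lambda>\<omega>. \<phi> \<omega> u (B v \<omega> + D u \<omega>)) \<in> borel_measurable M" if "u \<in> {0..T}" "v \<in> {0..T}" for u v
    by (rule jm(2)[OF _ m(1)]) (use that Xm in auto)
  have \<phi>2m: "(\<lambda>\<omega>. \<phi>2 \<omega> u (X \<omega> u)) \<in> borel_measurable M" if "u \<in> {0..T}" for u
    unfolding X_def by (rule jm(6)[OF _ m(3)]) (use that Xm in auto)
  have \<phi>i: "integrable M (\<lambda>\<omega>. \<phi> \<omega> u (B v \<omega> + D u \<omega>))" if "u \<in> {0..T}" "v \<in> {0..T}" for u v
    by (rule integrable_const_bound[where B = C]) (use that bd(1) \<phi>m in auto)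
  have \<phi>2i: "integrable M (\<lambda>\<omega>. \<phi>2 \<omega> u (X \<omega> u))" if "u \<in> {0..T}" for u
    by (rule integrable_const_bound[where B = C]) (use that bd(3) \<phi>2m in auto)
  have Ei: "integrable M (\<lambda>\<omega>. E \<omega> u v)" if "u \<in> {0..T}" "v \<in> {0..T}" for u v
    unfolding E_def using \<phi>i[OF that] \<phi>i[of u u] \<phi>2i[of u] that
    by (intro Bochner_Integration.integrable_diff) (auto simp: X_def)
  have Eb: "\<bar>expectation (\<lambda>\<omega>. E \<omega> u v)\<bar> \<le> 2 * C * sqrt (v - u) ^ 3" if "0 \<le> u" "u < v" "v \<le> T" for u v
  proof -
    have u: "u \<in> {0..T}" and v: "v \<in> {0..T}" using that by auto
    show ?thesis unfolding E_def
    proof (rule expected_increment[where ?f1.0 = "\<lambda>\<omega>. \<phi>1 \<omega> u" and ?f3.0 = "\<lambda>\<omega>. \<phi>3 \<omega> u"])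
      show "(\<lambda>\<omega>. \<phi> \<omega> u (B u \<omega> + D u \<omega>)) \<in> borel_measurable (F u)"
        by (rule jm(1)[OF that(1) m(1)[OF u] XF[OF u]])
      show "(\<lambda>\<omega>. \<phi>1 \<omega> u (B u \<omega> + D u \<omega>)) \<in> borel_measurable (F u)"
        by (rule jm(3)[OF that(1) m(2)[OF u] XF[OF u]])
      show "(\<lambda>\<omega>. \<phi>2 \<omega> u (B u \<omega> + D u \<omega>)) \<in> borel_measurable (F u)"
        by (rule jm(5)[OF that(1) m(3)[OF u] XF[OF u]])
    qed (use that u d1 d2 d3 bd \<phi>m[OF u v] in auto)
  qed
  have lim: "(\<lambda>n. S n \<omega>) \<longlonglongrightarrow> Z \<omega>" if \<omega>: "\<omega> \<in> space M" for \<omega>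
  proof -
    have Xc: "continuous_on {0..T} (X \<omega>)" unfolding X_def
      using B_continuous[OF \<omega>] Dc[OF \<omega>] by (intro continuous_intros)
    have qc: "continuous_on {0..T} (\<lambda>r. \<phi>2 \<omega> r (X \<omega> r) / 2)"
      using continuous_on_slice[OF c2[OF \<omega>] Xc] by (intro continuous_intros) auto
    note inc = increment_along_path[OF T0 ct[OF \<omega>] c1[OF \<omega>] dt[OF \<omega>] d1[OF \<omega>] B_continuous[OF \<omega>] Dc[OF \<omega>] d(1)[OF \<omega>] d(2)[OF \<omega>] Dd[OF \<omega>]]
    let ?g = "\<lambda>r. \<phi>t \<omega> r (B r \<omega> + D r \<omega>) + \<phi>1 \<omega> r (B r \<omega> + D r \<omega>) * d \<omega> r"
    let ?q = "\<lambda>r. \<phi>2 \<omega> r (X \<omega> r) / 2"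
    have gi: "?g integrable_on {0..T}" by (rule inc(1))
    have qi: "?q integrable_on {0..T}" by (rule integrable_continuous_real[OF qc])
    have "(\<lambda>n. \<Sum>i<Suc n. J \<omega> (grid T n i) (grid T n (Suc i))) \<longlonglongrightarrow> integral {0..T} (\<lambda>r. ?q r + ?g r)"
    proof (rule grid_sum_tendsto_integral[OF T0, where k = "\<lambda>r. 1 + (1 + d \<omega> r)"])
      show "(\<lambda>r. ?q r + ?g r) integrable_on {0..T}" by (intro integrable_add gi qi)
      show "(\<lambda>r. 1 + (1 + d \<omega> r)) integrable_on {0..T}" by (intro integrable_add d[OF \<omega>]) auto
      fix e :: real assume e: "0 < e"
      from inc(2)[OF _ _ _ _ _ _ e] obtain h1 where h1: "0 < h1" "\<And>u v. 0 \<le> u \<Longrightarrow> u \<le> v \<Longrightarrow> v \<le> T \<Longrightarrow> v - u < h1 \<Longrightarrow>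
        \<bar>\<phi> \<omega> v (B v \<omega> + D v \<omega>) - \<phi> \<omega> u (B v \<omega> + D u \<omega>) - integral {u..v} ?g\<bar> \<le> e * integral {u..v} (\<lambda>r. 1 + d \<omega> r)"
        by auto
      from rectangle_rule_error[OF qc e] obtain h2 where h2: "0 < h2" "\<And>u v. 0 \<le> u \<Longrightarrow> u \<le> v \<Longrightarrow> v \<le> T \<Longrightarrow> v - u < h2 \<Longrightarrow>
        \<bar>?q u * (v - u) - integral {u..v} ?q\<bar> \<le> e * (v - u)" by blast
      show "\<exists>da>0. \<forall>u v. 0 \<le> u \<longrightarrow> u \<le> v \<longrightarrow> v \<le> T \<longrightarrow> v - u < da \<longrightarrow>
        \<bar>J \<omega> u v - integral {u..v} (\<lambda>r. ?q r + ?g r)\<bar> \<le> e * integral {u..v} (\<lambda>r. 1 + (1 + d \<omega> r))"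
      proof (intro exI[of _ "min h1 h2"] conjI allI impI)
        show "0 < min h1 h2" using h1 h2 by simp
        fix u v assume uv: "0 \<le> u" "u \<le> v" "v \<le> T" "v - u < min h1 h2"
        have sub: "{u..v} \<subseteq> {0..T}" using uv by auto
        note si = integrable_subinterval_real[OF _ sub]
        have e1: "integral {u..v} (\<lambda>r. ?q r + ?g r) = integral {u..v} ?q + integral {u..v} ?g"
          by (intro Henstock_Kurzweil_Integration.integral_add si gi qi)
        have e2: "integral {u..v} (\<lambda>r. 1 + (1 + d \<omega> r)) = (v - u) + integral {u..v} (\<lambda>r. 1 + d \<omega> r)"
          using uv by (subst Henstock_Kurzweil_Integration.integral_add) (auto intro!: si integrable_add d[OF \<omega>])
        have "v - u < h1" "v - u < h2" using uv(4) by auto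
        from h1(2)[OF uv(1-3) this(1)] h2(2)[OF uv(1-3) this(2)]
        show "\<bar>J \<omega> u v - integral {u..v} (\<lambda>r. ?q r + ?g r)\<bar> \<le> e * integral {u..v} (\<lambda>r. 1 + (1 + d \<omega> r))"
          unfolding J_def e1 e2 distrib_left by linarith
      qed
    qed
    then show ?thesis unfolding S_def Z_def X_def by (simp add: add.assoc)
  qed
  have dom: "\<bar>S n \<omega>\<bar> \<le> C * T + (C + 1) * H \<omega>" if \<omega>: "\<omega> \<in> space M" for n \<omega>
  proof -
    let ?b = "\<lambda>r. C + (C * d \<omega> r + k \<omega> r)"
    have bi: "?b integrable_on {0..T}" by (intro integrable_add k[OF \<omega>] integrable_on_mult_right d(1)[OF \<omega>]) auto
    have Jb: "\<bar>J \<omega> u v\<bar> \<le> integral {u..v} ?b" if uv: "0 \<le> u" "u \<le> v" "v \<le> T" for u v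
    proof -
      have sub: "{u..v} \<subseteq> {0..T}" using uv by auto
      have uT: "u \<in> {0..T}" and vT: "v \<in> {0..T}" using uv by auto
      note si = integrable_subinterval_real[OF _ sub]
      have "\<bar>\<phi>2 \<omega> u (X \<omega> u) / 2\<bar> \<le> C" using bd(3)[OF \<omega> uT, of "X \<omega> u"] C by linarith
      then have "\<bar>\<phi>2 \<omega> u (X \<omega> u) / 2 * (v - u)\<bar> \<le> C * (v - u)"
        unfolding abs_mult using uv by (intro mult_mono) auto
      moreover have "\<bar>\<phi> \<omega> v (B v \<omega> + D v \<omega>) - \<phi> \<omega> v (B v \<omega> + D u \<omega>)\<bar> \<le> C * integral {u..v} (d \<omega>)"
      proof -
        have "norm (\<phi> \<omega> v (B v \<omega> + D v \<omega>) - \<phi> \<omega> v (B v \<omega> + D u \<omega>))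
            \<le> C * norm ((B v \<omega> + D v \<omega>) - (B v \<omega> + D u \<omega>))"
          by (rule field_differentiable_bound[of UNIV _ "\<phi>1 \<omega> v"]) (use d1[OF \<omega> vT] bd(2)[OF \<omega> vT] in auto)
        moreover have "0 \<le> integral {u..v} (d \<omega>)"
          by (intro Henstock_Kurzweil_Integration.integral_nonneg si d[OF \<omega>]) (use sub in auto)
        ultimately show ?thesis using Dd[OF \<omega> uv] by simp
      qed
      moreover have "\<bar>\<phi> \<omega> v (B v \<omega> + D u \<omega>) - \<phi> \<omega> u (B v \<omega> + D u \<omega>)\<bar> \<le> integral {u..v} (k \<omega>)"
      proof -
        have ft: "((\<lambda>r. \<phi>t \<omega> r (B v \<omega> + D u \<omega>)) has_integral (\<phi> \<omega> v (B v \<omega> + D u \<omega>) - \<phi> \<omega> u (B v \<omega> + D u \<omega>))) {u..v}"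
          using uv(2)
        proof (rule fundamental_theorem_of_calculus)
          fix r assume "r \<in> {u..v}"
          then show "((\<lambda>r. \<phi> \<omega> r (B v \<omega> + D u \<omega>)) has_vector_derivative \<phi>t \<omega> r (B v \<omega> + D u \<omega>)) (at r within {u..v})"
            using has_field_derivative_subset[OF dt[OF \<omega>] sub, of r] sub
            by (auto simp: has_real_derivative_iff_has_vector_derivative)
        qed
        have "norm (integral {u..v} (\<lambda>r. \<phi>t \<omega> r (B v \<omega> + D u \<omega>))) \<le> integral {u..v} (k \<omega>)"
          by (rule Henstock_Kurzweil_Integration.integral_norm_bound_integral)
            (use ft bd(5)[OF \<omega>] sub si[OF k[OF \<omega>]] in \<open>auto simp: has_integral_iff\<close>)
        then show ?thesis using ft by (simp add: has_integral_iff)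
      qed
      moreover have "integral {u..v} ?b = C * (v - u) + (C * integral {u..v} (d \<omega>) + integral {u..v} (k \<omega>))"
        using uv by (subst Henstock_Kurzweil_Integration.integral_add;
           (subst Henstock_Kurzweil_Integration.integral_add)?)
          (auto intro!: integrable_add si k[OF \<omega>] integrable_on_mult_right d(1)[OF \<omega>] simp: mult.commute)
      ultimately show ?thesis unfolding J_def by linarith
    qed
    have "\<bar>S n \<omega>\<bar> \<le> (\<Sum>i<Suc n. integral {grid T n i..grid T n (Suc i)} ?b)"
      unfolding S_def by (rule sum_abs[THEN order_trans], intro sum_mono Jb) (use grid_mem[OF T0] in auto)
    also have "\<dots> = integral {0..T} ?b"
      using sum_integral_partition[OF mono_grid[OF T0, of n], of ?b "Suc n"] bi by simp
    also have "\<dots> = C * T + (C * integral {0..T} (d \<omega>) + integral {0..T} (k \<omega>))"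
      using T0 by (subst Henstock_Kurzweil_Integration.integral_add;
           (subst Henstock_Kurzweil_Integration.integral_add)?)
        (auto intro!: integrable_add k[OF \<omega>] integrable_on_mult_right d(1)[OF \<omega>] simp: mult.commute)
    also have "\<dots> \<le> C * T + (C + 1) * H \<omega>"
    proof -
      have nn: "0 \<le> integral {0..T} (d \<omega>)" "0 \<le> integral {0..T} (k \<omega>)"
        by (intro Henstock_Kurzweil_Integration.integral_nonneg d[OF \<omega>] k[OF \<omega>];
            use d[OF \<omega>] abs_ge_zero bd(5)[OF \<omega>] order_trans in \<open>blast\<close>)+
      have "C * integral {0..T} (d \<omega>) \<le> C * H \<omega>" using nn H(2)[OF \<omega>] C by (intro mult_left_mono) auto
      then show ?thesis using nn H(2)[OF \<omega>] by (simp add: algebra_simps)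
    qed
    finally show ?thesis .
  qed
  have gm: "grid T n i \<in> {0..T}" "grid T n (Suc i) \<in> {0..T}" if "i < Suc n" for n i
    using grid_mem[OF T0 that] by auto
  have Sm: "S n \<in> borel_measurable M" for n
    unfolding S_def J_def X_def
    by (intro borel_measurable_sum borel_measurable_add borel_measurable_diff borel_measurable_times
        borel_measurable_divide borel_measurable_const \<phi>m \<phi>2m[unfolded X_def])
      (rule gm, simp)+
  have Zm: "Z \<in> borel_measurable M"
    by (rule borel_measurable_LIMSEQ_real[OF lim Sm])
  have Hi: "integrable M (\<lambda>\<omega>. C * T + (C + 1) * H \<omega>)" using H(1) by auto
  have "integrable M Z"
    by (rule integrable_dominated_convergence[where s = S and w = "\<lambda>\<omega>. C * T + (C + 1) * H \<omega>"]) (use Zm Sm Hi lim dom in auto)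
  moreover have "(\<lambda>n. expectation (S n)) \<longlonglongrightarrow> expectation Z"
    by (rule integral_dominated_convergence[where s = S and w = "\<lambda>\<omega>. C * T + (C + 1) * H \<omega>"]) (use Zm Sm Hi lim dom in auto)
  moreover have "(\<lambda>n. expectation (S n)) \<longlonglongrightarrow> expectation (\<lambda>\<omega>. \<phi> \<omega> T (X \<omega> T)) - expectation (\<lambda>\<omega>. \<phi> \<omega> 0 (X \<omega> 0))"
  proof -
    let ?\<Delta> = "expectation (\<lambda>\<omega>. \<phi> \<omega> T (X \<omega> T)) - expectation (\<lambda>\<omega>. \<phi> \<omega> 0 (X \<omega> 0))"
    have eq: "expectation (S n) = ?\<Delta> - (\<Sum>i<Suc n. expectation (\<lambda>\<omega>. E \<omega> (grid T n i) (grid T n (Suc i))))" for n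
    proof -
      have "S n \<omega> = \<phi> \<omega> T (X \<omega> T) - \<phi> \<omega> 0 (X \<omega> 0) - (\<Sum>i<Suc n. E \<omega> (grid T n i) (grid T n (Suc i)))" for \<omega>
      proof -
        have "J \<omega> u v = \<phi> \<omega> v (X \<omega> v) - \<phi> \<omega> u (X \<omega> u) - E \<omega> u v" for u v
          by (simp add: J_def E_def X_def)
        then have "S n \<omega> = (\<Sum>i<Suc n. \<phi> \<omega> (grid T n (Suc i)) (X \<omega> (grid T n (Suc i))) - \<phi> \<omega> (grid T n i) (X \<omega> (grid T n i)))
           - (\<Sum>i<Suc n. E \<omega> (grid T n i) (grid T n (Suc i)))"
          unfolding S_def by (simp only: sum_subtractf)
        also have "(\<Sum>i<Suc n. \<phi> \<omega> (grid T n (Suc i)) (X \<omega> (grid T n (Suc i))) - \<phi> \<omega> (grid T n i) (X \<omega> (grid T n i)))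
           = \<phi> \<omega> T (X \<omega> T) - \<phi> \<omega> 0 (X \<omega> 0)"
          by (subst sum_lessThan_telescope) simp
        finally show ?thesis .
      qed
      then have "expectation (S n) = expectation (\<lambda>\<omega>. \<phi> \<omega> T (X \<omega> T) - \<phi> \<omega> 0 (X \<omega> 0) - (\<Sum>i<Suc n. E \<omega> (grid T n i) (grid T n (Suc i))))"
        by presburger
      also have "\<dots> = expectation (\<lambda>\<omega>. \<phi> \<omega> T (X \<omega> T)) - expectation (\<lambda>\<omega>. \<phi> \<omega> 0 (X \<omega> 0))
          - expectation (\<lambda>\<omega>. \<Sum>i<Suc n. E \<omega> (grid T n i) (grid T n (Suc i)))"
        using \<phi>i[of T T] \<phi>i[of 0 0] T0 Ei gm unfolding X_def
        by (subst Bochner_Integration.integral_diff; (subst Bochner_Integration.integral_diff)?)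
          (auto intro!: Bochner_Integration.integrable_sum Bochner_Integration.integrable_diff simp del: sum.lessThan_Suc)
      also have "expectation (\<lambda>\<omega>. \<Sum>i<Suc n. E \<omega> (grid T n i) (grid T n (Suc i)))
          = (\<Sum>i<Suc n. expectation (\<lambda>\<omega>. E \<omega> (grid T n i) (grid T n (Suc i))))"
        by (intro Bochner_Integration.integral_sum Ei gm) auto
      finally show ?thesis .
    qed
    have "(\<lambda>n. \<Sum>i<Suc n. expectation (\<lambda>\<omega>. E \<omega> (grid T n i) (grid T n (Suc i)))) \<longlonglongrightarrow> 0"
    proof (rule Lim_null_comparison)
      show "\<forall>\<^sub>F n in sequentially. norm (\<Sum>i<Suc n. expectation (\<lambda>\<omega>. E \<omega> (grid T n i) (grid T n (Suc i))))
          \<le> 2 * C * T * sqrt (T / real (Suc n))"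
      proof (intro always_eventually allI)
        fix n
        have "norm (\<Sum>i<Suc n. expectation (\<lambda>\<omega>. E \<omega> (grid T n i) (grid T n (Suc i))))
          \<le> (\<Sum>i<Suc n. 2 * C * sqrt (T / real (Suc n)) ^ 3)"
        proof (rule sum_norm_le)
          fix i assume i: "i \<in> {..<Suc n}"
          have "0 < T / real (Suc n)" using T by simp
          then have "grid T n i < grid T n (Suc i)" using grid_Suc[of T n i] by linarith
          then show "norm (expectation (\<lambda>\<omega>. E \<omega> (grid T n i) (grid T n (Suc i)))) \<le> 2 * C * sqrt (T / real (Suc n)) ^ 3"
            using Eb[of "grid T n i" "grid T n (Suc i)"] grid_mem[OF T0, of i n] i by (simp add: grid_Suc del: of_nat_Suc)
        qed
        also have "\<dots> = real (Suc n) * (2 * C * sqrt (T / real (Suc n)) ^ 3)" by simp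
        also have "\<dots> = 2 * C * (real (Suc n) * (sqrt (T / real (Suc n)))\<^sup>2) * sqrt (T / real (Suc n))"
          by (simp add: power3_eq_cube power2_eq_square del: of_nat_Suc real_sqrt_mult_self)
        also have "(sqrt (T / real (Suc n)))\<^sup>2 = T / real (Suc n)" using T by (intro real_sqrt_pow2) simp
        also have "real (Suc n) * (T / real (Suc n)) = T" by simp
        finally show "norm (\<Sum>i<Suc n. expectation (\<lambda>\<omega>. E \<omega> (grid T n i) (grid T n (Suc i))))
          \<le> 2 * C * T * sqrt (T / real (Suc n))" .
      qed
      have "(\<lambda>n. T / real (Suc n)) \<longlonglongrightarrow> 0" by (rule LIMSEQ_Suc[OF lim_const_over_n])
      from tendsto_real_sqrt[OF this] show "(\<lambda>n. 2 * C * T * sqrt (T / real (Suc n))) \<longlonglongrightarrow> 0"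
        using tendsto_mult_left[of "\<lambda>n. sqrt (T / real (Suc n))" 0 sequentially "2 * C * T"] by simp
    qed
    from tendsto_diff[OF tendsto_const[of ?\<Delta>] this] show ?thesis unfolding eq by simp
  qed
  ultimately show ?thesis
    using LIMSEQ_unique by blast
qed

end


section \<open>Differentiation and continuity under the expectation\<close>

context prob_space
begin

lemma has_derivative_expectation:
  fixes f f' :: "'a \<Rightarrow> real \<Rightarrow> real"
  assumes S: "convex S" "\<tau> \<in> S"
    and d: "\<And>\<omega> s. \<omega> \<in> space M \<Longrightarrow> s \<in> S \<Longrightarrow> (f \<omega> has_real_derivative f' \<omega> s) (at s within S)"
    and b: "\<And>\<omega> s. \<omega> \<in> space M \<Longrightarrow> s \<in> S \<Longrightarrow> \<bar>f' \<omega> s\<bar> \<le> C"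
    and i: "\<And>s. s \<in> S \<Longrightarrow> integrable M (\<lambda>\<omega>. f \<omega> s)"
    and m: "(\<lambda>\<omega>. f' \<omega> \<tau>) \<in> borel_measurable M"
  shows "((\<lambda>s. expectation (\<lambda>\<omega>. f \<omega> s)) has_real_derivative expectation (\<lambda>\<omega>. f' \<omega> \<tau>)) (at \<tau> within S)"
  unfolding has_field_derivative_iff tendsto_at_iff_sequentially
proof (intro allI impI)
  fix X :: "nat \<Rightarrow> real" assume X: "\<forall>n. X n \<in> S - {\<tau>}" and lim: "X \<longlonglongrightarrow> \<tau>"
  let ?Q = "\<lambda>n \<omega>. (f \<omega> (X n) - f \<omega> \<tau>) / (X n - \<tau>)"
  have L: "(\<lambda>n. expectation (?Q n)) \<longlonglongrightarrow> expectation (\<lambda>\<omega>. f' \<omega> \<tau>)"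
  proof (rule integral_dominated_convergence[where w = "\<lambda>_. C"])
    show "?Q n \<in> borel_measurable M" for n using i[of "X n"] i[OF S(2)] X by auto
    show "AE \<omega> in M. (\<lambda>n. ?Q n \<omega>) \<longlonglongrightarrow> f' \<omega> \<tau>"
    proof (rule AE_I2)
      fix \<omega> assume "\<omega> \<in> space M"
      from d[OF this S(2)] show "(\<lambda>n. ?Q n \<omega>) \<longlonglongrightarrow> f' \<omega> \<tau>"
        unfolding has_field_derivative_iff tendsto_at_iff_sequentially comp_def using X lim by blast
    qed
    show "AE \<omega> in M. norm (?Q n \<omega>) \<le> C" for n
    proof (rule AE_I2)
      fix \<omega> assume \<omega>: "\<omega> \<in> space M"
      have "norm (f \<omega> (X n) - f \<omega> \<tau>) \<le> C * norm (X n - \<tau>)"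
        by (rule field_differentiable_bound[OF S(1) d[OF \<omega>]]) (use b[OF \<omega>] X S in auto)
      then show "norm (?Q n \<omega>) \<le> C" using X by (auto simp: divide_le_eq)
    qed
  qed (use m in auto)
  have eq: "expectation (?Q n) = (expectation (\<lambda>\<omega>. f \<omega> (X n)) - expectation (\<lambda>\<omega>. f \<omega> \<tau>)) / (X n - \<tau>)" for n
    using Bochner_Integration.integral_diff[OF i[of "X n"] i[OF S(2)]] X by simp
  show "((\<lambda>s. (expectation (\<lambda>\<omega>. f \<omega> s) - expectation (\<lambda>\<omega>. f \<omega> \<tau>)) / (s - \<tau>)) \<circ> X)
      \<longlonglongrightarrow> expectation (\<lambda>\<omega>. f' \<omega> \<tau>)" using L unfolding eq comp_def .
qed

lemma continuous_on_expectation: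
  fixes f :: "'a \<Rightarrow> 'b::{first_countable_topology, t2_space} \<Rightarrow> real"
  assumes c: "\<And>\<omega>. \<omega> \<in> space M \<Longrightarrow> continuous_on S (f \<omega>)"
    and b: "\<And>\<omega> s. \<omega> \<in> space M \<Longrightarrow> s \<in> S \<Longrightarrow> \<bar>f \<omega> s\<bar> \<le> C"
    and m: "\<And>s. s \<in> S \<Longrightarrow> (\<lambda>\<omega>. f \<omega> s) \<in> borel_measurable M"
  shows "continuous_on S (\<lambda>s. expectation (\<lambda>\<omega>. f \<omega> s))"
proof (rule continuous_on_sequentiallyI)
  fix u a assume u: "\<forall>n. u n \<in> S" "a \<in> S" "u \<longlonglongrightarrow> a"
  show "(\<lambda>n. expectation (\<lambda>\<omega>. f \<omega> (u n))) \<longlonglongrightarrow> expectation (\<lambda>\<omega>. f \<omega> a)"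
  proof (rule integral_dominated_convergence[where w = "\<lambda>_. C"])
    show "AE \<omega> in M. (\<lambda>n. f \<omega> (u n)) \<longlonglongrightarrow> f \<omega> a"
      using c u by (intro AE_I2) (auto simp: continuous_on_sequentially comp_def)
  qed (use m b u in auto)
qed

end

text \<open>
  A single term of the exponential series is at most the whole series.
\<close>

lemma power_times_exp_minus_le:
  fixes s :: real assumes "0 \<le> s"
  shows "s ^ k * exp (- s) \<le> fact k"
proof -
  have "(\<Sum>n\<in>{k}. s ^ n /\<^sub>R fact n) \<le> (\<Sum>n. s ^ n /\<^sub>R fact n)"
    by (rule sum_le_suminf[OF summable_exp_generic]) (use assms in auto)
  then have "s ^ k / fact k \<le> exp s" by (simp add: exp_def divide_inverse mult.commute)
  then show ?thesis by (simp add: exp_minus field_simps)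
qed

lemma continuous_on_fst_compose:
  "continuous_on S f \<Longrightarrow> continuous_on (S \<times> T) (\<lambda>p. f (fst p))"
  by (rule continuous_on_compose2[of S f]) (auto intro: continuous_intros)

section \<open>The process driven by the exponential functional\<close>

locale gamma_setting = brownian_setting N G W
  for N :: "'b measure" and G :: "real \<Rightarrow> 'b measure" and W :: "real \<Rightarrow> 'b \<Rightarrow> real" +
  fixes l \<beta> :: real
  assumes past: "\<And>u v. 0 \<le> u \<Longrightarrow> u \<le> v \<Longrightarrow> W u \<in> borel_measurable (G v)"
    and l: "0 < l" and \<beta>: "0 \<le> \<beta>"
begin

text \<open>
  In terms of the statement, \<open>\<Lambda> = l * \<Gamma>\<close>. The factor \<open>\<rho>\<close> is split off because, unlike \<open>\<Lambda>\<close>, it has paths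
  that are differentiable in time: \<open>\<Lambda>\<close> is then a smooth function of the current value of \<open>W\<close> with
  coefficients of finite variation.
\<close>

definition "A = exp_functional W \<beta>"
definition "\<rho> u \<omega> = l * exp (\<beta> * u) / (1 + l * A u \<omega>)"
definition "\<Lambda> u \<omega> = \<rho> u \<omega> * exp (W u \<omega>)"
definition "P u \<omega> = (1 + l * A u \<omega>) powr - (\<beta> + 1/2)"

lemma driver_continuous: "\<omega> \<in> space N \<Longrightarrow> continuous_on {0..T} (\<lambda>u. exp (W u \<omega> + \<beta> * u))"
  using B_continuous by (intro continuous_intros)

lemma A_eq:
  assumes "\<omega> \<in> space N"
  shows "A u \<omega> = integral {0..u} (\<lambda>r. exp (W r \<omega> + \<beta> * r))"
  unfolding A_def exp_functional_def
  by (rule set_borel_integral_eq_integral)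
    (use borel_integrable_atLeastAtMost'[OF driver_continuous[OF assms]] in auto)

lemma A_zero: "\<omega> \<in> space N \<Longrightarrow> A 0 \<omega> = 0"
  by (simp add: A_eq)

lemma A_nonneg: "\<omega> \<in> space N \<Longrightarrow> 0 \<le> A u \<omega>"
  unfolding A_eq
  by (rule Henstock_Kurzweil_Integration.integral_nonneg[OF integrable_continuous_real[OF driver_continuous]]) auto

lemma one_plus_A: "\<omega> \<in> space N \<Longrightarrow> 1 \<le> 1 + l * A u \<omega>" "\<omega> \<in> space N \<Longrightarrow> 0 < 1 + l * A u \<omega>"
  using A_nonneg[of \<omega> u] l by (simp_all add: add_pos_nonneg)

lemma A_has_derivative:
  "\<omega> \<in> space N \<Longrightarrow> u \<in> {0..T} \<Longrightarrow> ((\<lambda>u. A u \<omega>) has_real_derivative exp (W u \<omega> + \<beta> * u)) (at u within {0..T})"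
  using integral_has_real_derivative[OF driver_continuous, of \<omega> u T] by (simp add: A_eq)

text \<open>
  The Riemann sums serve twice: each involves \<open>W\<close> at finitely many past times only, which makes the
  limit adapted, and their expectations are bounded, which makes it integrable.
\<close>

lemma A_sums:
  assumes "\<omega> \<in> space N" "0 \<le> v"
  shows "(\<lambda>n. \<Sum>i<Suc n. exp (W (grid v n i) \<omega> + \<beta> * grid v n i) * (v / real (Suc n))) \<longlonglongrightarrow> A v \<omega>"
proof -
  have "(\<lambda>n. \<Sum>i<Suc n. exp (W (grid v n i) \<omega> + \<beta> * grid v n i) * (grid v n (Suc i) - grid v n i)) \<longlonglongrightarrow> A v \<omega>"
    unfolding A_eq[OF assms(1)]
  proof (rule grid_sum_tendsto_integral[OF assms(2), where k = "\<lambda>_. 1" and J = "\<lambda>u w. exp (W u \<omega> + \<beta> * u) * (w - u)"])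
    show "(\<lambda>r. exp (W r \<omega> + \<beta> * r)) integrable_on {0..v}"
      by (rule integrable_continuous_real[OF driver_continuous[OF assms(1)]])
    fix e :: real assume "0 < e"
    from rectangle_rule_error[OF driver_continuous[OF assms(1), of v] this]
    show "\<exists>d>0. \<forall>u w. 0 \<le> u \<longrightarrow> u \<le> w \<longrightarrow> w \<le> v \<longrightarrow> w - u < d \<longrightarrow>
       \<bar>exp (W u \<omega> + \<beta> * u) * (w - u) - integral {u..w} (\<lambda>r. exp (W r \<omega> + \<beta> * r))\<bar> \<le> e * integral {u..w} (\<lambda>_. 1)"
      by (auto simp: algebra_simps)
  qed auto
  then show ?thesis by (simp only: grid_Suc)
qed

lemma A_adapted: "0 \<le> v \<Longrightarrow> A v \<in> borel_measurable (G v)"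
proof (rule borel_measurable_LIMSEQ_real)
  assume v: "0 \<le> v"
  fix n
  have "W (grid v n i) \<in> borel_measurable (G v)" if "i < Suc n" for i
    by (rule past) (use grid_mem[OF v that] in auto)
  then show "(\<lambda>\<omega>. \<Sum>i<Suc n. exp (W (grid v n i) \<omega> + \<beta> * grid v n i) * (v / real (Suc n))) \<in> borel_measurable (G v)"
    by (intro borel_measurable_sum borel_measurable_times borel_measurable_const borel_measurable_exp[THEN measurable_compose[rotated]] borel_measurable_add) auto
qed (use A_sums space_F in auto)

lemma \<rho>_adapted: "0 \<le> u \<Longrightarrow> \<rho> u \<in> borel_measurable (G u)"
  unfolding \<rho>_def using A_adapted[of u] by measurable

lemma P_adapted: "0 \<le> u \<Longrightarrow> P u \<in> borel_measurable (G u)"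
  unfolding P_def using A_adapted[of u] by measurable

lemma \<Lambda>_adapted: "0 \<le> u \<Longrightarrow> \<Lambda> u \<in> borel_measurable (G u)"
  unfolding \<Lambda>_def using \<rho>_adapted[of u] B_adapted[of u] by measurable

lemma \<Lambda>_measurable: "0 \<le> u \<Longrightarrow> \<Lambda> u \<in> borel_measurable N"
  by (rule adapted_measurable[OF _ \<Lambda>_adapted])

lemma P_measurable: "0 \<le> u \<Longrightarrow> P u \<in> borel_measurable N"
  by (rule adapted_measurable[OF _ P_adapted])

lemma \<rho>_pos: "\<omega> \<in> space N \<Longrightarrow> 0 < \<rho> u \<omega>"
  using one_plus_A[of \<omega> u] l by (simp add: \<rho>_def)

lemma \<Lambda>_pos: "\<omega> \<in> space N \<Longrightarrow> 0 < \<Lambda> u \<omega>"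
  using \<rho>_pos by (simp add: \<Lambda>_def)

lemma P_bounds: "\<omega> \<in> space N \<Longrightarrow> 0 \<le> P u \<omega>" "\<omega> \<in> space N \<Longrightarrow> P u \<omega> \<le> 1"
  using powr_mono2'[of "-(\<beta> + 1/2)" 1 "1 + l * A u \<omega>"] one_plus_A[of \<omega> u] \<beta> by (simp_all add: P_def)

lemma \<Lambda>_le:
  assumes "\<omega> \<in> space N"
  shows "\<Lambda> u \<omega> \<le> l * exp (W u \<omega> + \<beta> * u)"
proof -
  have "l * exp (\<beta> * u) / (1 + l * A u \<omega>) \<le> l * exp (\<beta> * u) / 1"
    using one_plus_A[OF assms, of u] l by (intro divide_left_mono) auto
  then have "\<rho> u \<omega> * exp (W u \<omega>) \<le> l * exp (\<beta> * u) * exp (W u \<omega>)"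
    unfolding \<rho>_def by (intro mult_right_mono) auto
  then show ?thesis by (simp add: \<Lambda>_def exp_add algebra_simps)
qed

text \<open>
  Equivalently \<open>log (1 + l * A)\<close> is the integral of \<open>\<Lambda>\<close>; this gives \<open>\<Lambda>\<close> its quadratic drift term
  and turns \<open>P\<close> into the exponential of \<open>- (\<beta> + 1/2)\<close> times the integral of \<open>\<Lambda>\<close>.
\<close>

lemma \<rho>_has_derivative:
  assumes "\<omega> \<in> space N" "u \<in> {0..T}"
  shows "((\<lambda>u. \<rho> u \<omega>) has_real_derivative \<rho> u \<omega> * (\<beta> - \<Lambda> u \<omega>)) (at u within {0..T})"
proof -
  let ?Q = "1 + l * A u \<omega>" and ?e = "exp (\<beta> * u)"
  have "((\<lambda>u. l * exp (\<beta> * u) / (1 + l * A u \<omega>)) has_real_derivative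
      (l * (\<beta> * ?e) * ?Q - l * ?e * (l * exp (W u \<omega> + \<beta> * u))) / (?Q * ?Q)) (at u within {0..T})"
    by (rule DERIV_divide) (use one_plus_A(2)[OF assms(1), of u] in
      \<open>auto intro!: derivative_eq_intros A_has_derivative[OF assms]\<close>)
  moreover have "(l * (\<beta> * ?e) * ?Q - l * ?e * (l * exp (W u \<omega> + \<beta> * u))) / (?Q * ?Q) = \<rho> u \<omega> * (\<beta> - \<Lambda> u \<omega>)"
    using one_plus_A(2)[OF assms(1), of u] by (simp add: \<rho>_def \<Lambda>_def exp_add field_simps)
  ultimately show ?thesis by (simp add: \<rho>_def)
qed

lemma P_has_derivative:
  assumes "\<omega> \<in> space N" "u \<in> {0..T}"
  shows "((\<lambda>u. P u \<omega>) has_real_derivative - (\<beta> + 1/2) * \<Lambda> u \<omega> * P u \<omega>) (at u within {0..T})"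
proof -
  let ?Q = "\<lambda>u. 1 + l * A u \<omega>"
  have "((\<lambda>u. ?Q u powr - (\<beta> + 1/2)) has_real_derivative
      - (\<beta> + 1/2) * ?Q u powr (- (\<beta> + 1/2) - 1) * (l * exp (W u \<omega> + \<beta> * u))) (at u within {0..T})"
    by (rule DERIV_chain2[where f = "\<lambda>z. z powr - (\<beta> + 1/2)" and g = ?Q])
      (auto intro!: derivative_eq_intros A_has_derivative[OF assms] one_plus_A(2)[OF assms(1)] has_real_derivative_powr)
  moreover have "- (\<beta> + 1/2) * ?Q u powr (- (\<beta> + 1/2) - 1) * (l * exp (W u \<omega> + \<beta> * u))
      = - (\<beta> + 1/2) * \<Lambda> u \<omega> * P u \<omega>"
  proof -
    define p where "p = ?Q u powr - (\<beta> + 1/2)"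
    show ?thesis
      unfolding P_def \<Lambda>_def \<rho>_def powr_diff p_def[symmetric]
      using one_plus_A(2)[OF assms(1), of u] by (simp add: exp_add)
  qed
  ultimately show ?thesis by (simp only: P_def[abs_def])
qed

lemma path_continuous:
  assumes "\<omega> \<in> space N"
  shows "continuous_on {0..T} (\<lambda>u. \<rho> u \<omega>)" "continuous_on {0..T} (\<lambda>u. P u \<omega>)" "continuous_on {0..T} (\<lambda>u. \<Lambda> u \<omega>)"
proof -
  show r: "continuous_on {0..T} (\<lambda>u. \<rho> u \<omega>)"
    by (rule DERIV_continuous_on[OF \<rho>_has_derivative[OF assms]])
  show "continuous_on {0..T} (\<lambda>u. P u \<omega>)"
    by (rule DERIV_continuous_on[OF P_has_derivative[OF assms]])
  show "continuous_on {0..T} (\<lambda>u. \<Lambda> u \<omega>)" unfolding \<Lambda>_def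
    using r B_continuous[OF assms] by (intro continuous_intros)
qed

lemma exp_moment:
  assumes u: "0 \<le> u"
  shows "integrable N (\<lambda>\<omega>. exp (c * W u \<omega>))" "expectation (\<lambda>\<omega>. exp (c * W u \<omega>)) = exp (c\<^sup>2 * u / 2)"
proof -
  have "integrable N (\<lambda>\<omega>. exp (c * W u \<omega>)) \<and> expectation (\<lambda>\<omega>. exp (c * W u \<omega>)) = exp (c\<^sup>2 * u / 2)"
  proof (cases "u = 0")
    case True
    have ae: "AE \<omega> in N. exp (c * W 0 \<omega>) = 1" using B_start by eventually_elim simp
    have "integrable N (\<lambda>\<omega>. exp (c * W 0 \<omega>)) \<longleftrightarrow> integrable N (\<lambda>\<omega>. 1 :: real)"
      by (rule integrable_cong_AE[OF _ _ ae]) (use B_measurable[of 0] in auto)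
    moreover have "expectation (\<lambda>\<omega>. exp (c * W 0 \<omega>)) = expectation (\<lambda>\<omega>. 1 :: real)"
      by (rule integral_cong_AE[OF _ _ ae]) (use B_measurable[of 0] in auto)
    ultimately show ?thesis using True prob_space by simp
  next
    case False
    with u have u: "0 < u" by simp
    have ae: "AE \<omega> in N. exp (c * W u \<omega>) = exp (c * (W u \<omega> - W 0 \<omega>))"
      using B_start by eventually_elim simp
    have sq: "sqrt u > 0" using u by simp
    \<comment> \<open>Completing the square turns the exponentially tilted density into a shifted one.\<close>
    have dens: "normal_density 0 (sqrt u) z * exp (c * z) = exp (c\<^sup>2 * u / 2) * normal_density (c * u) (sqrt u) z" for z
    proof -
      have "- (z - 0)\<^sup>2 / (2 * (sqrt u)\<^sup>2) + c * z = c\<^sup>2 * u / 2 + - (z - c * u)\<^sup>2 / (2 * (sqrt u)\<^sup>2)"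
        using u by (simp add: field_simps power2_eq_square)
      then have "exp (- (z - 0)\<^sup>2 / (2 * (sqrt u)\<^sup>2)) * exp (c * z) = exp (c\<^sup>2 * u / 2) * exp (- (z - c * u)\<^sup>2 / (2 * (sqrt u)\<^sup>2))"
        by (simp only: exp_add[symmetric])
      then show ?thesis by (simp add: normal_density_def)
    qed
    have "integrable lborel (normal_density (c * u) (sqrt u))"
      using integrable_normal_moment[OF sq, of "c * u" 0] by simp
    then have "integrable N (\<lambda>\<omega>. exp (c * (W u \<omega> - W 0 \<omega>)))"
      using increment_integral(2)[of 0 u "\<lambda>z. exp (c * z)"] u by (simp add: dens)
    moreover have "expectation (\<lambda>\<omega>. exp (c * (W u \<omega> - W 0 \<omega>))) = exp (c\<^sup>2 * u / 2)"
      using increment_integral(1)[of 0 u "\<lambda>z. exp (c * z)"] u integral_normal_density[OF sq] by (simp add: dens)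
    moreover have "integrable N (\<lambda>\<omega>. exp (c * W u \<omega>)) \<longleftrightarrow> integrable N (\<lambda>\<omega>. exp (c * (W u \<omega> - W 0 \<omega>)))"
      by (rule integrable_cong_AE[OF _ _ ae]) (use B_measurable[of 0] B_measurable[of u] u in auto)
    moreover have "expectation (\<lambda>\<omega>. exp (c * W u \<omega>)) = expectation (\<lambda>\<omega>. exp (c * (W u \<omega> - W 0 \<omega>)))"
      by (rule integral_cong_AE[OF _ _ ae]) (use B_measurable[of 0] B_measurable[of u] u in auto)
    ultimately show ?thesis by simp
  qed
  then show "integrable N (\<lambda>\<omega>. exp (c * W u \<omega>))" "expectation (\<lambda>\<omega>. exp (c * W u \<omega>)) = exp (c\<^sup>2 * u / 2)" by auto
qed

lemma driver_expectation_le: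
  assumes "0 \<le> u" "u \<le> T"
  shows "integrable N (\<lambda>\<omega>. exp (W u \<omega> + \<beta> * u) ^ k)"
    "expectation (\<lambda>\<omega>. exp (W u \<omega> + \<beta> * u) ^ k) \<le> exp (real k * \<beta> * T + (real k)\<^sup>2 * T / 2)"
proof -
  have eq: "exp (W u \<omega> + \<beta> * u) ^ k = exp (real k * \<beta> * u) * exp (real k * W u \<omega>)" for \<omega>
    by (simp add: exp_of_nat_mult[symmetric] exp_add[symmetric] algebra_simps)
  show "integrable N (\<lambda>\<omega>. exp (W u \<omega> + \<beta> * u) ^ k)"
    unfolding eq using exp_moment(1)[OF assms(1)] by simp
  have "expectation (\<lambda>\<omega>. exp (W u \<omega> + \<beta> * u) ^ k) = exp (real k * \<beta> * u + (real k)\<^sup>2 * u / 2)"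
    unfolding eq using exp_moment(2)[OF assms(1), of "real k"] by (simp add: exp_add)
  also have "\<dots> \<le> exp (real k * \<beta> * T + (real k)\<^sup>2 * T / 2)"
    using assms \<beta> by (intro exp_le_cancel_iff[THEN iffD2] add_mono mult_left_mono divide_right_mono) auto
  finally show "expectation (\<lambda>\<omega>. exp (W u \<omega> + \<beta> * u) ^ k) \<le> exp (real k * \<beta> * T + (real k)\<^sup>2 * T / 2)" .
qed

text \<open>
  By Fatou's lemma along the Riemann sums.
\<close>

lemma A_integrable:
  assumes T: "0 \<le> T"
  shows "integrable N (A T)"
proof (rule integrableI_nonneg)
  show Am: "A T \<in> borel_measurable N" by (rule adapted_measurable[OF T A_adapted[OF T]])
  show "AE \<omega> in N. 0 \<le> A T \<omega>" using A_nonneg by (intro AE_I2)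
  let ?s = "\<lambda>n \<omega>. \<Sum>i<Suc n. exp (W (grid T n i) \<omega> + \<beta> * grid T n i) * (T / real (Suc n))"
  let ?c = "T * exp (\<beta> * T + T / 2)"
  have si: "integrable N (?s n)" and sb: "expectation (?s n) \<le> ?c" for n
  proof -
    have g: "0 \<le> grid T n i" "grid T n i \<le> T" if "i < Suc n" for i using grid_mem[OF T that] by auto
    have ei: "integrable N (\<lambda>\<omega>. exp (W (grid T n i) \<omega> + \<beta> * grid T n i) * (T / real (Suc n)))" if "i < Suc n" for i
      using driver_expectation_le(1)[OF g[OF that], of 1] by simp
    then show "integrable N (?s n)" by (intro Bochner_Integration.integrable_sum) auto
    have "expectation (?s n) = (\<Sum>i<Suc n. expectation (\<lambda>\<omega>. exp (W (grid T n i) \<omega> + \<beta> * grid T n i) * (T / real (Suc n))))"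
      by (rule Bochner_Integration.integral_sum) (use ei in auto)
    also have "\<dots> \<le> (\<Sum>i<Suc n. exp (\<beta> * T + T / 2) * (T / real (Suc n)))"
    proof (rule sum_mono)
      fix i assume "i \<in> {..<Suc n}"
      then have "expectation (\<lambda>\<omega>. exp (W (grid T n i) \<omega> + \<beta> * grid T n i)) * (T / real (Suc n)) \<le> exp (\<beta> * T + T / 2) * (T / real (Suc n))"
        using driver_expectation_le(2)[OF g, of i 1] T by (intro mult_right_mono) auto
      then show "expectation (\<lambda>\<omega>. exp (W (grid T n i) \<omega> + \<beta> * grid T n i) * (T / real (Suc n))) \<le> exp (\<beta> * T + T / 2) * (T / real (Suc n))"
        by simp
    qed
    also have "\<dots> = ?c" by (simp del: of_nat_Suc)
    finally show "expectation (?s n) \<le> ?c" .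
  qed
  have s0: "0 \<le> ?s n \<omega>" for n \<omega> using T by (intro sum_nonneg) auto
  have "(\<integral>\<^sup>+\<omega>. ennreal (A T \<omega>) \<partial>N) = (\<integral>\<^sup>+\<omega>. liminf (\<lambda>n. ennreal (?s n \<omega>)) \<partial>N)"
    by (rule nn_integral_cong) (use A_sums[OF _ T] in \<open>intro lim_imp_Liminf[symmetric] tendsto_ennrealI, auto\<close>)
  also have "\<dots> \<le> liminf (\<lambda>n. \<integral>\<^sup>+\<omega>. ennreal (?s n \<omega>) \<partial>N)"
    by (rule nn_integral_liminf) (use si in auto)
  also have "\<dots> \<le> liminf (\<lambda>n. ennreal ?c)"
    by (rule Liminf_mono) (use nn_integral_eq_integral[OF si] s0 sb in \<open>auto intro!: ennreal_leI always_eventually simp del: sum.lessThan_Suc\<close>)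
  also have "\<dots> = ennreal ?c" by (simp add: Liminf_const)
  also have "\<dots> < \<infinity>" by simp
  finally show "(\<integral>\<^sup>+\<omega>. ennreal (A T \<omega>) \<partial>N) < \<infinity>" .
qed

end


section \<open>Weighted Laplace transforms and their backward equation\<close>

context gamma_setting
begin

text \<open>
  The weighted Laplace transforms of the process of the right-hand side. Up to the factor
  \<open>exp (- l)\<close>, the right-hand side of the identity is \<open>V 0\<close>, evaluated at \<open>\<eta> = cosh x - 1\<close>; the
  higher \<open>V k\<close> are its derivatives in \<open>\<eta>\<close> up to sign.
\<close>

definition V :: "nat \<Rightarrow> real \<Rightarrow> real \<Rightarrow> real" where
  "V k \<tau> \<eta> = expectation (\<lambda>\<omega>. \<Lambda> \<tau> \<omega> ^ k * exp (- (\<eta> * \<Lambda> \<tau> \<omega>)) * P \<tau> \<omega>)"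

lemma V_integrand_measurable: "0 \<le> \<tau> \<Longrightarrow> (\<lambda>\<omega>. \<Lambda> \<tau> \<omega> ^ k * exp (- (\<eta> * \<Lambda> \<tau> \<omega>)) * P \<tau> \<omega>) \<in> borel_measurable N"
  using \<Lambda>_measurable[of \<tau>] P_measurable[of \<tau>] by measurable

lemma V_integrand_bounds:
  assumes \<omega>: "\<omega> \<in> space N" and c: "0 < c" "c \<le> \<eta>"
  shows "0 \<le> \<Lambda> \<tau> \<omega> ^ k * exp (- (\<eta> * \<Lambda> \<tau> \<omega>)) * P \<tau> \<omega>"
    and "\<Lambda> \<tau> \<omega> ^ k * exp (- (\<eta> * \<Lambda> \<tau> \<omega>)) * P \<tau> \<omega> \<le> fact k / c ^ k"
proof -
  note L = \<Lambda>_pos[OF \<omega>, of \<tau>] and P = P_bounds[OF \<omega>, of \<tau>]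
  show "0 \<le> \<Lambda> \<tau> \<omega> ^ k * exp (- (\<eta> * \<Lambda> \<tau> \<omega>)) * P \<tau> \<omega>" using L P by simp
  have "\<Lambda> \<tau> \<omega> ^ k * exp (- (\<eta> * \<Lambda> \<tau> \<omega>)) * P \<tau> \<omega> \<le> \<Lambda> \<tau> \<omega> ^ k * exp (- (c * \<Lambda> \<tau> \<omega>)) * 1"
    using L P c by (intro mult_mono) auto
  also have "\<dots> = (c * \<Lambda> \<tau> \<omega>) ^ k * exp (- (c * \<Lambda> \<tau> \<omega>)) / c ^ k"
    using c by (simp add: power_mult_distrib)
  also have "\<dots> \<le> fact k / c ^ k"
    using power_times_exp_minus_le[of "c * \<Lambda> \<tau> \<omega>" k] L c by (intro divide_right_mono) auto
  finally show "\<Lambda> \<tau> \<omega> ^ k * exp (- (\<eta> * \<Lambda> \<tau> \<omega>)) * P \<tau> \<omega> \<le> fact k / c ^ k" .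
qed

lemma V_integrand_abs:
  assumes "\<omega> \<in> space N" "0 < c" "c \<le> \<eta>"
  shows "\<bar>\<Lambda> \<tau> \<omega> ^ k * exp (- (\<eta> * \<Lambda> \<tau> \<omega>)) * P \<tau> \<omega>\<bar> \<le> fact k / c ^ k"
  using V_integrand_bounds[OF assms, of \<tau> k] by (simp only: abs_of_nonneg)

lemma V_integrable:
  assumes "0 \<le> \<tau>" "0 < \<eta>"
  shows "integrable N (\<lambda>\<omega>. \<Lambda> \<tau> \<omega> ^ k * exp (- (\<eta> * \<Lambda> \<tau> \<omega>)) * P \<tau> \<omega>)"
  by (rule integrable_const_bound[where B = "fact k / \<eta> ^ k"])
    (use V_integrand_measurable[OF assms(1)] V_integrand_abs[OF _ assms(2) order_refl] in \<open>auto simp only: real_norm_def intro!: AE_I2\<close>)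

lemma V_bounds:
  assumes "0 \<le> \<tau>" "0 < \<eta>"
  shows "0 \<le> V k \<tau> \<eta>" "V k \<tau> \<eta> \<le> fact k / \<eta> ^ k"
proof -
  show "0 \<le> V k \<tau> \<eta>" unfolding V_def
    by (rule Bochner_Integration.integral_nonneg_AE, rule AE_I2) (use V_integrand_bounds[OF _ assms(2) order_refl] in auto)
  show "V k \<tau> \<eta> \<le> fact k / \<eta> ^ k" unfolding V_def
    by (rule integral_le_const[OF V_integrable[OF assms]], rule AE_I2) (rule V_integrand_bounds[OF _ assms(2) order_refl])
qed

lemma V_has_derivative:
  assumes \<tau>: "0 \<le> \<tau>" and \<eta>: "0 < \<eta>"
  shows "(V k \<tau> has_real_derivative - V (Suc k) \<tau> \<eta>) (at \<eta>)"
proof -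
  have "((\<lambda>\<eta>. expectation (\<lambda>\<omega>. \<Lambda> \<tau> \<omega> ^ k * exp (- (\<eta> * \<Lambda> \<tau> \<omega>)) * P \<tau> \<omega>)) has_real_derivative
      expectation (\<lambda>\<omega>. - (\<Lambda> \<tau> \<omega> ^ Suc k * exp (- (\<eta> * \<Lambda> \<tau> \<omega>)) * P \<tau> \<omega>))) (at \<eta> within {\<eta>/2<..})"
  proof (rule has_derivative_expectation[where C = "fact (Suc k) / (\<eta>/2) ^ Suc k"])
    show "\<eta> \<in> {\<eta>/2<..}" using \<eta> by simp
    show "integrable N (\<lambda>\<omega>. \<Lambda> \<tau> \<omega> ^ k * exp (- (s * \<Lambda> \<tau> \<omega>)) * P \<tau> \<omega>)" if "s \<in> {\<eta>/2<..}" for s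
      by (rule V_integrable) (use \<tau> \<eta> that in auto)
    show "\<bar>- (\<Lambda> \<tau> \<omega> ^ Suc k * exp (- (s * \<Lambda> \<tau> \<omega>)) * P \<tau> \<omega>)\<bar> \<le> fact (Suc k) / (\<eta>/2) ^ Suc k"
      if "\<omega> \<in> space N" "s \<in> {\<eta>/2<..}" for \<omega> s
      unfolding abs_minus_cancel by (rule V_integrand_abs) (use \<eta> that in auto)
    show "(\<lambda>\<omega>. - (\<Lambda> \<tau> \<omega> ^ Suc k * exp (- (\<eta> * \<Lambda> \<tau> \<omega>)) * P \<tau> \<omega>)) \<in> borel_measurable N"
      by (rule borel_measurable_uminus[OF V_integrand_measurable[OF \<tau>]])
  qed (auto intro!: derivative_eq_intros)
  moreover have "at \<eta> within {\<eta>/2<..} = at \<eta>" using \<eta> by (intro at_within_open) auto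
  ultimately show ?thesis by (simp add: V_def[abs_def])
qed

lemma V_continuous:
  assumes c: "0 < c"
  shows "continuous_on ({0..T} \<times> {c..}) (\<lambda>p. V k (fst p) (snd p))"
  unfolding V_def
proof (rule continuous_on_expectation[where C = "fact k / c ^ k"])
  fix \<omega> assume \<omega>: "\<omega> \<in> space N"
  note [continuous_intros] = continuous_on_fst_compose[OF path_continuous(2)[OF \<omega>]] continuous_on_fst_compose[OF path_continuous(3)[OF \<omega>]]
  show "continuous_on ({0..T} \<times> {c..}) (\<lambda>p. \<Lambda> (fst p) \<omega> ^ k * exp (- (snd p * \<Lambda> (fst p) \<omega>)) * P (fst p) \<omega>)"
    by (intro continuous_intros)
qed (use V_integrand_abs[OF _ c] V_integrand_measurable in auto)

text \<open>
  Only for \<open>k = 0\<close> is the integrand bounded down to \<open>\<eta> = 0\<close>, the value that belongs to a process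
  starting at the origin.
\<close>

lemma V_zero_continuous: "0 \<le> \<tau> \<Longrightarrow> continuous_on {0..} (V 0 \<tau>)"
  unfolding V_def
proof (rule continuous_on_expectation[where C = 1])
  assume \<tau>: "0 \<le> \<tau>"
  show "(\<lambda>\<omega>. \<Lambda> \<tau> \<omega> ^ 0 * exp (- (s * \<Lambda> \<tau> \<omega>)) * P \<tau> \<omega>) \<in> borel_measurable N" for s
    by (rule V_integrand_measurable[OF \<tau>])
  fix \<omega> s assume \<omega>: "\<omega> \<in> space N" and s: "s \<in> {0::real..}"
  have "exp (- (s * \<Lambda> \<tau> \<omega>)) * P \<tau> \<omega> \<le> 1 * 1"
    using P_bounds[OF \<omega>, of \<tau>] \<Lambda>_pos[OF \<omega>, of \<tau>] s by (intro mult_mono) auto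
  then show "\<bar>\<Lambda> \<tau> \<omega> ^ 0 * exp (- (s * \<Lambda> \<tau> \<omega>)) * P \<tau> \<omega>\<bar> \<le> 1"
    using P_bounds[OF \<omega>, of \<tau>] by (simp add: abs_mult)
qed (intro continuous_intros)

lemma V_at_start: "V 0 0 \<eta> = exp (- (\<eta> * l))"
proof -
  have "AE \<omega> in N. \<Lambda> 0 \<omega> ^ 0 * exp (- (\<eta> * \<Lambda> 0 \<omega>)) * P 0 \<omega> = exp (- (\<eta> * l))"
    using B_start AE_space by eventually_elim (simp add: \<Lambda>_def \<rho>_def P_def A_zero)
  then have "V 0 0 \<eta> = expectation (\<lambda>\<omega>. exp (- (\<eta> * l)))" unfolding V_def
    by (intro integral_cong_AE) (use V_integrand_measurable[of 0 0 \<eta>] in simp_all)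
  then show ?thesis using prob_space by simp
qed

definition "moment_bound T = l * exp (\<beta> * T + T / 2) + l\<^sup>2 * exp (2 * \<beta> * T + 2 * T)"

text \<open>
  In contrast to \<open>V_bounds\<close>, these bounds do not blow up as \<open>\<eta>\<close> tends to \<open>0\<close>. They come from the
  first two moments of geometric Brownian motion, which dominates \<open>\<Lambda>\<close>; the factor \<open>\<eta>\<close> is absorbed
  by \<open>\<eta> * \<Lambda> * exp (- \<eta> * \<Lambda>) \<le> 1\<close>.
\<close>

lemma V_moment_bounds:
  assumes \<tau>: "0 \<le> \<tau>" "\<tau> \<le> T" and \<eta>: "0 < \<eta>"
  shows "V 1 \<tau> \<eta> \<le> moment_bound T" "(\<eta> + 1) * V 2 \<tau> \<eta> \<le> moment_bound T"
proof -
  let ?w = "\<lambda>\<omega>. exp (W \<tau> \<omega> + \<beta> * \<tau>)"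
  let ?g = "\<lambda>\<omega>. l * ?w \<omega> ^ 1 + l\<^sup>2 * ?w \<omega> ^ 2"
  note i1 = driver_expectation_le[OF \<tau>, of 1] and i2 = driver_expectation_le[OF \<tau>, of 2]
  have gi: "integrable N ?g" using i1(1) i2(1) by auto
  have "expectation ?g = l * expectation (\<lambda>\<omega>. ?w \<omega> ^ 1) + l\<^sup>2 * expectation (\<lambda>\<omega>. ?w \<omega> ^ 2)"
    using i1(1) i2(1) by simp
  also have "\<dots> \<le> moment_bound T"
    unfolding moment_bound_def using i1(2) i2(2) l by (intro add_mono mult_left_mono) auto
  finally have gb: "expectation ?g \<le> moment_bound T" .
  have pw: "\<Lambda> \<tau> \<omega> ^ 1 * exp (- (\<eta> * \<Lambda> \<tau> \<omega>)) * P \<tau> \<omega> \<le> ?g \<omega> \<and>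
      (\<eta> + 1) * (\<Lambda> \<tau> \<omega> ^ 2 * exp (- (\<eta> * \<Lambda> \<tau> \<omega>)) * P \<tau> \<omega>) \<le> ?g \<omega>" if \<omega>: "\<omega> \<in> space N" for \<omega>
  proof -
    note L = \<Lambda>_pos[OF \<omega>, of \<tau>] and P = P_bounds[OF \<omega>, of \<tau>] and le = \<Lambda>_le[OF \<omega>, of \<tau>]
    have sq: "\<Lambda> \<tau> \<omega> ^ 2 \<le> l\<^sup>2 * ?w \<omega> ^ 2" using power_mono[OF le, of 2] L by (simp add: power_mult_distrib)
    have e1: "exp (- (\<eta> * \<Lambda> \<tau> \<omega>)) \<le> 1" using L \<eta> by simp
    have e2: "\<eta> * \<Lambda> \<tau> \<omega> * exp (- (\<eta> * \<Lambda> \<tau> \<omega>)) \<le> 1"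
      using power_times_exp_minus_le[of "\<eta> * \<Lambda> \<tau> \<omega>" 1] L \<eta> by simp
    have "\<Lambda> \<tau> \<omega> ^ 1 * exp (- (\<eta> * \<Lambda> \<tau> \<omega>)) * P \<tau> \<omega> \<le> \<Lambda> \<tau> \<omega> ^ 1 * 1 * 1"
      using L P e1 by (intro mult_mono) auto
    also have "\<dots> \<le> ?g \<omega>" using le l by (simp add: add_increasing2)
    finally have A: "\<Lambda> \<tau> \<omega> ^ 1 * exp (- (\<eta> * \<Lambda> \<tau> \<omega>)) * P \<tau> \<omega> \<le> ?g \<omega>" .
    have "(\<eta> + 1) * (\<Lambda> \<tau> \<omega> ^ 2 * exp (- (\<eta> * \<Lambda> \<tau> \<omega>)) * P \<tau> \<omega>)
        = (\<Lambda> \<tau> \<omega> * (\<eta> * \<Lambda> \<tau> \<omega> * exp (- (\<eta> * \<Lambda> \<tau> \<omega>))) + \<Lambda> \<tau> \<omega> ^ 2 * exp (- (\<eta> * \<Lambda> \<tau> \<omega>))) * P \<tau> \<omega>"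
      by (simp add: algebra_simps power2_eq_square)
    also have "\<dots> \<le> (\<Lambda> \<tau> \<omega> * 1 + \<Lambda> \<tau> \<omega> ^ 2 * 1) * 1"
      using L P e1 e2 \<eta> by (intro mult_mono add_mono mult_left_mono) auto
    also have "\<dots> \<le> ?g \<omega>" using le sq by simp
    finally show ?thesis using A by simp
  qed
  have "V 1 \<tau> \<eta> \<le> expectation ?g" unfolding V_def
    by (rule integral_mono[OF V_integrable[OF \<tau>(1) \<eta>] gi]) (use pw in auto)
  then show "V 1 \<tau> \<eta> \<le> moment_bound T" using gb by simp
  have "(\<eta> + 1) * V 2 \<tau> \<eta> = expectation (\<lambda>\<omega>. (\<eta> + 1) * (\<Lambda> \<tau> \<omega> ^ 2 * exp (- (\<eta> * \<Lambda> \<tau> \<omega>)) * P \<tau> \<omega>))"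
    unfolding V_def by simp
  also have "\<dots> \<le> expectation ?g"
    by (rule integral_mono[OF _ gi]) (use pw V_integrable[OF \<tau>(1) \<eta>, of 2] in auto)
  finally show "(\<eta> + 1) * V 2 \<tau> \<eta> \<le> moment_bound T" using gb by simp
qed

text \<open>
  With \<open>s = \<eta> * \<Lambda>\<close>, the field \<open>exp (- s) * p\<close> and its first three derivatives in \<open>W\<close>, where
  \<open>s\<close> is its own derivative. The constant is \<open>3! + 3 * 2! + 1!\<close>, from the last of them.
\<close>

lemma gamma_test_bounds:
  fixes s p :: real
  assumes "0 \<le> s" "0 \<le> p" "p \<le> 1"
  shows "\<bar>exp (- s) * p\<bar> \<le> 13" "\<bar>- s * exp (- s) * p\<bar> \<le> 13" "\<bar>(s\<^sup>2 - s) * exp (- s) * p\<bar> \<le> 13"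
    "\<bar>(- (s ^ 3) + 3 * s\<^sup>2 - s) * exp (- s) * p\<bar> \<le> 13"
proof -
  have e: "0 \<le> s ^ k * exp (- s)" "s ^ k * exp (- s) \<le> fact k" for k
    using power_times_exp_minus_le[OF assms(1)] assms(1) by auto
  have e0: "exp (- s) \<le> 1" and e1: "0 \<le> s * exp (- s)" "s * exp (- s) \<le> 1" and e2: "0 \<le> s\<^sup>2 * exp (- s)" "s\<^sup>2 * exp (- s) \<le> 2"
    and e3: "0 \<le> s ^ 3 * exp (- s)" "s ^ 3 * exp (- s) \<le> 6"
    using e[of 0] e[of 1] e[of 2] e[of 3] assms(1) by (simp_all add: fact_numeral)
  have red: "\<bar>x * p\<bar> \<le> 13" if "\<bar>x\<bar> \<le> 13" for x
    using mult_mono[OF that, of p 1] assms by (simp add: abs_mult)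
  show "\<bar>exp (- s) * p\<bar> \<le> 13" by (rule red) (use e0 exp_gt_zero[of "- s"] in linarith)
  show "\<bar>- s * exp (- s) * p\<bar> \<le> 13" by (rule red) (use e1 in simp)
  have ar: "\<bar>x2 - x1\<bar> \<le> 13" "\<bar>- x3 + 3 * x2 - x1\<bar> \<le> 13"
    if "0 \<le> x1" "x1 \<le> 1" "0 \<le> x2" "x2 \<le> 2" "0 \<le> x3" "x3 \<le> 6" for x1 x2 x3 :: real
    using that by (simp_all add: abs_le_iff)
  have q1: "(s\<^sup>2 - s) * exp (- s) = s\<^sup>2 * exp (- s) - s * exp (- s)"
    by (simp add: algebra_simps)
  have q2: "(- (s ^ 3) + 3 * s\<^sup>2 - s) * exp (- s) = - (s ^ 3 * exp (- s)) + 3 * (s\<^sup>2 * exp (- s)) - s * exp (- s)"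
    by (simp add: algebra_simps)
  show "\<bar>(s\<^sup>2 - s) * exp (- s) * p\<bar> \<le> 13"
    by (rule red, unfold q1, rule ar(1)[OF e1 e2 e3])
  show "\<bar>(- (s ^ 3) + 3 * s\<^sup>2 - s) * exp (- s) * p\<bar> \<le> 13"
    by (rule red, unfold q2, rule ar(2)[OF e1 e2 e3])
qed

text \<open>
  The sum of the second order and the time derivative terms that Ito's formula produces for
  \<open>exp (- \<eta> * \<Lambda>) * P\<close>.
\<close>

definition V_drift :: "real \<Rightarrow> 'b \<Rightarrow> real \<Rightarrow> real" where
  "V_drift \<eta> \<omega> r = (1/2 * (\<eta>\<^sup>2 + 2 * \<eta>) * \<Lambda> r \<omega> ^ 2 - (\<beta> + 1/2) * (\<eta> + 1) * \<Lambda> r \<omega> ^ 1) * exp (- (\<eta> * \<Lambda> r \<omega>)) * P r \<omega>"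

lemma V_drift_continuous: "\<omega> \<in> space N \<Longrightarrow> continuous_on {0..T} (V_drift \<eta> \<omega>)"
  unfolding V_drift_def by (intro continuous_intros path_continuous)

lemma V_drift_split: "V_drift \<eta> \<omega> r = 1/2 * (\<eta>\<^sup>2 + 2 * \<eta>) * (\<Lambda> r \<omega> ^ 2 * exp (- (\<eta> * \<Lambda> r \<omega>)) * P r \<omega>)
   - (\<beta> + 1/2) * (\<eta> + 1) * (\<Lambda> r \<omega> ^ 1 * exp (- (\<eta> * \<Lambda> r \<omega>)) * P r \<omega>)"
  by (simp add: V_drift_def algebra_simps)

lemma V_increment:
  assumes T: "0 < T" and \<eta>: "0 < \<eta>"
  shows "integrable N (\<lambda>\<omega>. integral {0..T} (V_drift \<eta> \<omega>))"
    and "V 0 T \<eta> - V 0 0 \<eta> = expectation (\<lambda>\<omega>. integral {0..T} (V_drift \<eta> \<omega>))"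
proof -
  define s where "s \<omega> u y = \<eta> * (\<rho> u \<omega> * exp y)" for \<omega> u and y :: real
  define \<phi> where "\<phi> \<omega> u y = exp (- s \<omega> u y) * P u \<omega>" for \<omega> u y
  define \<phi>1 where "\<phi>1 \<omega> u y = - s \<omega> u y * exp (- s \<omega> u y) * P u \<omega>" for \<omega> u y
  define \<phi>2 where "\<phi>2 \<omega> u y = ((s \<omega> u y)\<^sup>2 - s \<omega> u y) * exp (- s \<omega> u y) * P u \<omega>" for \<omega> u y
  define \<phi>3 where "\<phi>3 \<omega> u y = (- (s \<omega> u y ^ 3) + 3 * (s \<omega> u y)\<^sup>2 - s \<omega> u y) * exp (- s \<omega> u y) * P u \<omega>" for \<omega> u y
  define \<phi>t where "\<phi>t \<omega> u y = (- s \<omega> u y * (\<beta> - \<Lambda> u \<omega>) - (\<beta> + 1/2) * \<Lambda> u \<omega>) * exp (- s \<omega> u y) * P u \<omega>" for \<omega> u y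
  define k where "k \<omega> u = \<beta> + (\<beta> + 3/2) * l * exp (W u \<omega> + \<beta> * u)" for \<omega> u
  have s0: "0 \<le> s \<omega> u y" if "\<omega> \<in> space N" for \<omega> u y using \<rho>_pos[OF that, of u] \<eta> by (simp add: s_def)
  have sd: "((\<lambda>y. s \<omega> u y) has_real_derivative s \<omega> u y) (at y)" for \<omega> u y
    unfolding s_def by (auto intro!: derivative_eq_intros)
  have st: "((\<lambda>u. s \<omega> u y) has_real_derivative s \<omega> u y * (\<beta> - \<Lambda> u \<omega>)) (at u within {0..T})"
    if "\<omega> \<in> space N" "u \<in> {0..T}" for \<omega> u y
    unfolding s_def by (rule derivative_eq_intros \<rho>_has_derivative[OF that] refl | simp add: algebra_simps)+
  have sW: "s \<omega> u (W u \<omega>) = \<eta> * \<Lambda> u \<omega>" for \<omega> u by (simp add: s_def \<Lambda>_def)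
  have T0: "0 \<le> T" using T by simp
  have Zeq: "integral {0..T} (\<lambda>r. \<phi>2 \<omega> r (W r \<omega> + 0) / 2 + \<phi>t \<omega> r (W r \<omega> + 0) + \<phi>1 \<omega> r (W r \<omega> + 0) * 0)
      = integral {0..T} (V_drift \<eta> \<omega>)" for \<omega>
    by (intro arg_cong[where f = "integral {0..T}"] ext)
      (simp add: \<phi>2_def \<phi>t_def V_drift_def sW field_simps power2_eq_square)
  note ito = ito_expectation[where \<phi> = \<phi> and ?\<phi>1.0 = \<phi>1 and ?\<phi>2.0 = \<phi>2 and ?\<phi>3.0 = \<phi>3 and \<phi>t = \<phi>t and T = T and C = 13
      and D = "\<lambda>_ _. 0" and d = "\<lambda>_ _. 0" and k = k and H = "\<lambda>\<omega>. \<beta> * T + (\<beta> + 3/2) * l * A T \<omega>", OF T]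
  have ito_ok: "integrable N (\<lambda>\<omega>. integral {0..T} (V_drift \<eta> \<omega>)) \<and>
    expectation (\<lambda>\<omega>. \<phi> \<omega> T (W T \<omega>)) - expectation (\<lambda>\<omega>. \<phi> \<omega> 0 (W 0 \<omega>)) = expectation (\<lambda>\<omega>. integral {0..T} (V_drift \<eta> \<omega>))"
  proof (rule ito[unfolded Zeq, simplified add_0_right])
    fix \<omega> u y assume \<omega>: "\<omega> \<in> space N" and u: "u \<in> {0..T}"
    note P = P_bounds[OF \<omega>, of u]
    show "((\<lambda>u. \<phi> \<omega> u y) has_real_derivative \<phi>t \<omega> u y) (at u within {0..T})"
      unfolding \<phi>_def \<phi>t_def
      by (rule derivative_eq_intros st[OF \<omega> u] P_has_derivative[OF \<omega> u] refl)+ (simp add: algebra_simps)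
    show "(\<phi> \<omega> u has_real_derivative \<phi>1 \<omega> u y) (at y)"
      unfolding \<phi>_def[abs_def] \<phi>1_def
      by (rule derivative_eq_intros sd refl)+ (simp add: algebra_simps)
    show "(\<phi>1 \<omega> u has_real_derivative \<phi>2 \<omega> u y) (at y)"
      unfolding \<phi>1_def[abs_def] \<phi>2_def
      by (rule derivative_eq_intros sd refl)+ (simp add: algebra_simps power2_eq_square)
    show "(\<phi>2 \<omega> u has_real_derivative \<phi>3 \<omega> u y) (at y)"
      unfolding \<phi>2_def[abs_def] \<phi>3_def
      by (rule derivative_eq_intros sd refl)+ (simp add: algebra_simps power2_eq_square power3_eq_cube)
    show "\<bar>\<phi> \<omega> u y\<bar> \<le> 13" "\<bar>\<phi>1 \<omega> u y\<bar> \<le> 13" "\<bar>\<phi>2 \<omega> u y\<bar> \<le> 13" "\<bar>\<phi>3 \<omega> u y\<bar> \<le> 13"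
      unfolding \<phi>_def \<phi>1_def \<phi>2_def \<phi>3_def by (rule gamma_test_bounds[OF s0[OF \<omega>] P])+
    show "\<bar>\<phi>t \<omega> u y\<bar> \<le> k \<omega> u"
    proof -
      note L = \<Lambda>_pos[OF \<omega>, of u] and S = s0[OF \<omega>, of u y]
      have a1: "\<bar>s \<omega> u y * exp (- s \<omega> u y)\<bar> \<le> 1" using power_times_exp_minus_le[OF S, of 1] S by simp
      have a2: "\<bar>exp (- s \<omega> u y)\<bar> \<le> 1" using S by simp
      have "(- s \<omega> u y * (\<beta> - \<Lambda> u \<omega>) - (\<beta> + 1/2) * \<Lambda> u \<omega>) * exp (- s \<omega> u y)
          = (s \<omega> u y * exp (- s \<omega> u y)) * (\<Lambda> u \<omega> - \<beta>) - ((\<beta> + 1/2) * \<Lambda> u \<omega>) * exp (- s \<omega> u y)"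
        by (simp add: algebra_simps)
      also have "\<bar>\<dots>\<bar> \<le> \<bar>(s \<omega> u y * exp (- s \<omega> u y)) * (\<Lambda> u \<omega> - \<beta>)\<bar> + \<bar>((\<beta> + 1/2) * \<Lambda> u \<omega>) * exp (- s \<omega> u y)\<bar>"
        by (rule abs_triangle_ineq4)
      also have "\<dots> \<le> 1 * (\<Lambda> u \<omega> + \<beta>) + ((\<beta> + 1/2) * \<Lambda> u \<omega>) * 1"
        unfolding abs_mult[of "s \<omega> u y * exp (- s \<omega> u y)"] abs_mult[of "(\<beta> + 1/2) * \<Lambda> u \<omega>"]
        using a1 a2 L \<beta> by (intro add_mono mult_mono) (auto simp: abs_mult)
      also have "\<dots> = \<beta> + (\<beta> + 3/2) * \<Lambda> u \<omega>" by (simp add: algebra_simps)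
      also have "\<dots> \<le> k \<omega> u" unfolding k_def
        using mult_left_mono[OF \<Lambda>_le[OF \<omega>, of u], of "\<beta> + 3/2"] \<beta> by (simp add: mult.assoc)
      finally have b: "\<bar>(- s \<omega> u y * (\<beta> - \<Lambda> u \<omega>) - (\<beta> + 1/2) * \<Lambda> u \<omega>) * exp (- s \<omega> u y)\<bar> \<le> k \<omega> u" .
      have "\<bar>\<phi>t \<omega> u y\<bar> \<le> k \<omega> u * 1"
        unfolding \<phi>t_def abs_mult[of _ "P u \<omega>"] using b P by (intro mult_mono) auto
      then show ?thesis by simp
    qed
  next
    fix \<omega> assume \<omega>: "\<omega> \<in> space N"
    note [continuous_intros] = continuous_on_fst_compose[OF path_continuous(1)[OF \<omega>]] continuous_on_fst_compose[OF path_continuous(2)[OF \<omega>]] continuous_on_fst_compose[OF path_continuous(3)[OF \<omega>]]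
    show "continuous_on ({0..T} \<times> UNIV) (\<lambda>p. \<phi>t \<omega> (fst p) (snd p))"
      unfolding \<phi>t_def s_def by (intro continuous_intros)
    show "continuous_on ({0..T} \<times> UNIV) (\<lambda>p. \<phi>1 \<omega> (fst p) (snd p))"
      unfolding \<phi>1_def s_def by (intro continuous_intros)
    show "continuous_on ({0..T} \<times> UNIV) (\<lambda>p. \<phi>2 \<omega> (fst p) (snd p))"
      unfolding \<phi>2_def s_def by (intro continuous_intros)
    have hk: "(k \<omega> has_integral (\<beta> * T + (\<beta> + 3/2) * l * A T \<omega>)) {0..T}"
      unfolding k_def[abs_def] A_eq[OF \<omega>]
      using has_integral_add[OF has_integral_const_real[of \<beta> 0 T]
          has_integral_mult_right[OF integrable_integral[OF integrable_continuous_real[OF driver_continuous[OF \<omega>]]], of "(\<beta> + 3/2) * l" T]] T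
      by (simp add: mult.commute mult.left_commute)
    then show "k \<omega> integrable_on {0..T}" by blast
    show "integral {0..T} (k \<omega>) + integral {0..T} (\<lambda>_. 0) \<le> \<beta> * T + (\<beta> + 3/2) * l * A T \<omega>"
      using hk by (simp add: integral_unique)
  next
    fix u assume u: "u \<in> {0..T}"
    have [measurable]: "\<rho> u \<in> borel_measurable (G u)" "P u \<in> borel_measurable (G u)" using u \<rho>_adapted P_adapted by auto
    show "(\<lambda>p. \<phi> (fst p) u (snd p)) \<in> borel_measurable (G u \<Otimes>\<^sub>M borel)"
      unfolding \<phi>_def s_def by measurable
    show "(\<lambda>p. \<phi>1 (fst p) u (snd p)) \<in> borel_measurable (G u \<Otimes>\<^sub>M borel)"
      unfolding \<phi>1_def s_def by measurable
    show "(\<lambda>p. \<phi>2 (fst p) u (snd p)) \<in> borel_measurable (G u \<Otimes>\<^sub>M borel)"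
      unfolding \<phi>2_def s_def by measurable
  qed (use A_integrable[OF T0] in auto)
  show "integrable N (\<lambda>\<omega>. integral {0..T} (V_drift \<eta> \<omega>))" using ito_ok by simp
  show "V 0 T \<eta> - V 0 0 \<eta> = expectation (\<lambda>\<omega>. integral {0..T} (V_drift \<eta> \<omega>))"
    using ito_ok unfolding V_def by (simp add: \<phi>_def sW)
qed

text \<open>
  The backward equation. As \<open>- V 1\<close> and \<open>V 2\<close> are the first and the second \<open>\<eta>\<close>-derivative of
  \<open>V 0\<close>, the right-hand side is the generator \<open>1/2 * (\<theta>\<^sup>2 - 1) * f'' + (\<alpha> + 1) * \<theta> * f'\<close> of
  \<open>\<theta> = cosh R\<close>, applied to \<open>V 0 \<tau>\<close> at \<open>\<theta> = \<eta> + 1\<close>: this is the duality between \<open>\<Lambda>\<close> and \<open>cosh R\<close>.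
\<close>

lemma V_time_derivative:
  assumes \<tau>: "\<tau> \<in> {0..T}" and \<eta>: "0 < \<eta>"
  shows "((\<lambda>\<tau>. V 0 \<tau> \<eta>) has_real_derivative
     1/2 * (\<eta>\<^sup>2 + 2 * \<eta>) * V 2 \<tau> \<eta> - (\<beta> + 1/2) * (\<eta> + 1) * V 1 \<tau> \<eta>) (at \<tau> within {0..T})"
proof -
  let ?C = "1/2 * (\<eta>\<^sup>2 + 2 * \<eta>) * (fact 2 / \<eta> ^ 2) + (\<beta> + 1/2) * (\<eta> + 1) * (fact 1 / \<eta> ^ 1)"
  have zb: "\<bar>V_drift \<eta> \<omega> r\<bar> \<le> ?C" if \<omega>: "\<omega> \<in> space N" for \<omega> r
  proof -
    have "\<bar>V_drift \<eta> \<omega> r\<bar> \<le> \<bar>1/2 * (\<eta>\<^sup>2 + 2 * \<eta>) * (\<Lambda> r \<omega> ^ 2 * exp (- (\<eta> * \<Lambda> r \<omega>)) * P r \<omega>)\<bar>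
       + \<bar>(\<beta> + 1/2) * (\<eta> + 1) * (\<Lambda> r \<omega> ^ 1 * exp (- (\<eta> * \<Lambda> r \<omega>)) * P r \<omega>)\<bar>"
      unfolding V_drift_split by (rule abs_triangle_ineq4)
    also have "\<dots> \<le> ?C"
      unfolding abs_mult[of "1/2 * (\<eta>\<^sup>2 + 2 * \<eta>)"] abs_mult[of "(\<beta> + 1/2) * (\<eta> + 1)"]
      using \<eta> \<beta> by (intro add_mono mult_mono V_integrand_abs[OF \<omega> \<eta> order_refl]) auto
    finally show ?thesis .
  qed
  have iI: "integrable N (\<lambda>\<omega>. integral {0..s} (V_drift \<eta> \<omega>))" if "s \<in> {0..T}" for s
    using V_increment(1)[OF _ \<eta>, of s] that by (cases "s = 0") auto
  have Veq: "V 0 s \<eta> = V 0 0 \<eta> + expectation (\<lambda>\<omega>. integral {0..s} (V_drift \<eta> \<omega>))" if "s \<in> {0..T}" for s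
    using V_increment(2)[OF _ \<eta>, of s] that by (cases "s = 0") auto
  have zE: "integrable N (\<lambda>\<omega>. V_drift \<eta> \<omega> \<tau>)"
    "expectation (\<lambda>\<omega>. V_drift \<eta> \<omega> \<tau>) = 1/2 * (\<eta>\<^sup>2 + 2 * \<eta>) * V 2 \<tau> \<eta> - (\<beta> + 1/2) * (\<eta> + 1) * V 1 \<tau> \<eta>"
    unfolding V_drift_split V_def using V_integrable[OF _ \<eta>, of \<tau> 1] V_integrable[OF _ \<eta>, of \<tau> 2] \<tau>
    by (simp_all add: Bochner_Integration.integrable_diff Bochner_Integration.integral_diff)
  have "((\<lambda>s. expectation (\<lambda>\<omega>. integral {0..s} (V_drift \<eta> \<omega>))) has_real_derivative expectation (\<lambda>\<omega>. V_drift \<eta> \<omega> \<tau>)) (at \<tau> within {0..T})"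
    by (rule has_derivative_expectation[where C = ?C])
      (use \<tau> zb iI zE integral_has_real_derivative[OF V_drift_continuous] in auto)
  from DERIV_add[OF DERIV_const[of "V 0 0 \<eta>"] this]
  have "((\<lambda>s. V 0 0 \<eta> + expectation (\<lambda>\<omega>. integral {0..s} (V_drift \<eta> \<omega>))) has_real_derivative
     1/2 * (\<eta>\<^sup>2 + 2 * \<eta>) * V 2 \<tau> \<eta> - (\<beta> + 1/2) * (\<eta> + 1) * V 1 \<tau> \<eta>) (at \<tau> within {0..T})"
    by (simp add: zE(2))
  from has_field_derivative_transform_within[OF this zero_less_one \<tau>, of "\<lambda>\<tau>. V 0 \<tau> \<eta>"]
  show ?thesis using Veq[symmetric] by blast
qed

end


section \<open>Duality along the hyperbolic Bessel process\<close>

text \<open>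
  Stopping a nondecreasing primitive when it reaches the level \<open>c\<close> amounts to switching off its
  density from the first time \<open>\<sigma>\<close> at which the level is attained.
\<close>

lemma truncated_primitive:
  fixes D d :: "real \<Rightarrow> real"
  assumes D: "continuous_on {0..T} D"
    and d: "d integrable_on {0..T}" "\<And>r. r \<in> {0..T} \<Longrightarrow> 0 \<le> d r"
    and Dd: "\<And>u v. 0 \<le> u \<Longrightarrow> u \<le> v \<Longrightarrow> v \<le> T \<Longrightarrow> D v - D u = integral {u..v} d"
    and c: "D 0 < c" and uv: "0 \<le> u" "u \<le> v" "v \<le> T"
  shows "((\<lambda>r. if D r < c then d r else 0) has_integral (min (D v) c - min (D u) c)) {u..v}"
proof -
  let ?d = "\<lambda>r. if D r < c then d r else 0"
  have hd: "(d has_integral (D w - D s)) {s..w}" if "0 \<le> s" "s \<le> w" "w \<le> T" for s w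
    using integrable_integral[OF integrable_subinterval_real[OF d(1), of s w]] Dd[OF that] that by simp
  have Dmono: "D s \<le> D w" if "0 \<le> s" "s \<le> w" "w \<le> T" for s w
    using has_integral_nonneg[OF hd[OF that]] d(2) that by simp
  show ?thesis
  proof (cases "D T < c")
    case True
    have lt: "D r < c" if "0 \<le> r" "r \<le> T" for r using Dmono[of r T] that True by simp
    show ?thesis
      using has_integral_eq[OF _ hd[OF uv], of ?d] lt[of u] lt[of v] uv lt by simp
  next
    case False
    have T: "0 \<le> T" using uv by simp
    let ?S = "{r \<in> {0..T}. c \<le> D r}"
    have S: "closed ?S" "?S \<noteq> {}" "bdd_below ?S"
      using continuous_closed_preimage[OF D, of "{c..}"] False T by (auto simp: vimage_def Int_def intro: bdd_belowI[of _ 0])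
    define \<sigma> where "\<sigma> = Inf ?S"
    have \<sigma>: "\<sigma> \<in> ?S" unfolding \<sigma>_def by (rule closed_contains_Inf[OF S(2,3,1)])
    have below: "D r < c" if "0 \<le> r" "r < \<sigma>" for r
      using cInf_lower[OF _ S(3), of r] \<sigma> that unfolding \<sigma>_def[symmetric] by force
    have above: "c \<le> D r" if "\<sigma> \<le> r" "r \<le> T" for r
      using Dmono[of \<sigma> r] \<sigma> that by simp
    have "\<exists>r. 0 \<le> r \<and> r \<le> \<sigma> \<and> D r = c"
      by (rule IVT') (use c \<sigma> continuous_on_subset[OF D, of "{0..\<sigma>}"] in auto)
    then have D\<sigma>: "D \<sigma> = c" using below by force
    have left: "(?d has_integral (D w - D s)) {s..w}" if "0 \<le> s" "s \<le> w" "w \<le> \<sigma>" for s w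
    proof (rule has_integral_spike_finite[where S = "{w}" and f = d])
      show "(d has_integral (D w - D s)) {s..w}" by (rule hd) (use that \<sigma> in auto)
      show "?d r = d r" if "r \<in> {s..w} - {w}" for r
        using below[of r] that \<open>0 \<le> s\<close> \<open>w \<le> \<sigma>\<close> by auto
    qed auto
    have right: "(?d has_integral 0) {s..w}" if "\<sigma> \<le> s" "w \<le> T" for s w
    proof (rule has_integral_is_0)
      fix r assume "r \<in> {s..w}"
      then have "c \<le> D r" using above that by auto
      then show "?d r = 0" by simp
    qed
    have mn: "min (D r) c = (if r \<le> \<sigma> then D r else c)" if "0 \<le> r" "r \<le> T" for r
      using Dmono[of r \<sigma>] Dmono[of \<sigma> r] \<sigma> D\<sigma> that by (auto simp: min_def)
    consider "v \<le> \<sigma>" | "\<sigma> \<le> u" | "u < \<sigma>" "\<sigma> < v" by linarith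
    then show ?thesis
    proof cases
      case 1 then show ?thesis using left[of u v] mn uv by simp
    next
      case 2 then show ?thesis using right[of u v] mn[of u] mn[of v] uv D\<sigma> by (auto split: if_splits)
    next
      case 3
      have "(?d has_integral (D \<sigma> - D u) + 0) {u..v}"
        by (rule has_integral_combine[of u \<sigma> v]) (use 3 uv left[of u \<sigma>] right[of \<sigma> v] in auto)
      then show ?thesis using mn[of u] mn[of v] uv D\<sigma> 3 by simp
    qed
  qed
qed

text \<open>
  \<open>x + B + D\<close> stands for the hyperbolic Bessel process, with \<open>D\<close> its accumulated drift. The only
  trace of the equation that is kept is \<open>sinh (X r) * D' r = \<beta> * cosh (X r)\<close> for almost every time;
  multiplied by \<open>sinh\<close> the drift has no singularity left. In this form the degenerate index
  \<open>- 1/2\<close> is included: there \<open>\<beta> = 0\<close> and \<open>D = 0\<close>, and \<open>\<bar>x + B\<bar>\<close> may be replaced by \<open>x + B\<close>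
  because \<open>cosh\<close> is even.
\<close>

locale duality_setting = bes: brownian_setting M F B + gam: gamma_setting N G W l \<beta>
  for M :: "'a measure" and F :: "real \<Rightarrow> 'a measure" and B :: "real \<Rightarrow> 'a \<Rightarrow> real"
    and N :: "'b measure" and G :: "real \<Rightarrow> 'b measure" and W :: "real \<Rightarrow> 'b \<Rightarrow> real" and l \<beta> :: real +
  fixes D :: "real \<Rightarrow> 'a \<Rightarrow> real" and d :: "'a \<Rightarrow> real \<Rightarrow> real" and x T :: real
  assumes T: "0 < T"
    and D_adapted: "\<And>u. u \<in> {0..T} \<Longrightarrow> D u \<in> borel_measurable (F u)"
    and D_continuous: "\<And>\<omega>. \<omega> \<in> space M \<Longrightarrow> continuous_on {0..T} (\<lambda>u. D u \<omega>)"
    and D_zero: "\<And>\<omega>. \<omega> \<in> space M \<Longrightarrow> D 0 \<omega> = 0"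
    and d_integrable: "\<And>\<omega>. \<omega> \<in> space M \<Longrightarrow> d \<omega> integrable_on {0..T}"
    and d_nonneg: "\<And>\<omega> r. \<omega> \<in> space M \<Longrightarrow> r \<in> {0..T} \<Longrightarrow> 0 \<le> d \<omega> r"
    and D_primitive: "\<And>\<omega> u v. \<omega> \<in> space M \<Longrightarrow> 0 \<le> u \<Longrightarrow> u \<le> v \<Longrightarrow> v \<le> T \<Longrightarrow> D v \<omega> - D u \<omega> = integral {u..v} (d \<omega>)"
    and coth_drift: "AE \<omega> in M. \<exists>S. negligible S \<and> (\<forall>r\<in>{0..T} - S.
      sinh (x + B r \<omega> + D r \<omega>) * d \<omega> r = \<beta> * cosh (x + B r \<omega> + D r \<omega>))"
begin

lemma D_measurable: "u \<in> {0..T} \<Longrightarrow> D u \<in> borel_measurable M"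
  using bes.adapted_measurable[OF _ D_adapted] by auto

text \<open>
  With \<open>\<eta> \<ge> \<epsilon>\<close>, powers of \<open>cosh\<close> and \<open>sinh\<close> up to the order \<open>k\<close> are compensated by the decay of
  \<open>V k\<close> in \<open>\<eta>\<close>; this is why the test function below has bounded derivatives although \<open>cosh R\<close> is
  unbounded.
\<close>

lemma V_weighted_bound:
  assumes e: "0 < \<epsilon>" "\<epsilon> \<le> \<eta>" and \<tau>: "0 \<le> \<tau>" and a: "\<bar>a\<bar> \<le> (\<eta> + 1) ^ k" and k: "k \<le> 3"
  shows "\<bar>a * gam.V k \<tau> \<eta>\<bar> \<le> fact k * (1 + 1 / \<epsilon>) ^ 3"
proof -
  have \<eta>: "0 < \<eta>" using e by simp
  note V = gam.V_bounds[OF \<tau> \<eta>, of k]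
  have q: "(\<eta> + 1) / \<eta> \<le> 1 + 1 / \<epsilon>" using e by (simp add: field_simps)
  have "\<bar>a * gam.V k \<tau> \<eta>\<bar> \<le> (\<eta> + 1) ^ k * (fact k / \<eta> ^ k)"
    unfolding abs_mult using V a by (intro mult_mono) auto
  also have "\<dots> = fact k * ((\<eta> + 1) / \<eta>) ^ k" by (simp add: power_divide)
  also have "\<dots> \<le> fact k * (1 + 1 / \<epsilon>) ^ k" using q \<eta> by (intro mult_left_mono power_mono) auto
  also have "\<dots> \<le> fact k * (1 + 1 / \<epsilon>) ^ 3"
    using e k by (intro mult_left_mono power_increasing) auto
  finally show ?thesis .
qed

text \<open>
  The spatial argument of \<open>V\<close> shifted away from \<open>0\<close> by \<open>\<epsilon>\<close>, as the bounds on \<open>V k\<close> degenerate there.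
\<close>

definition h :: "real \<Rightarrow> real \<Rightarrow> real" where "h \<epsilon> y = cosh (x + y) - 1 + \<epsilon>"

lemma h_ge: "\<epsilon> \<le> h \<epsilon> y" by (simp add: h_def cosh_real_ge_1)

lemma h_plus_one: "0 < \<epsilon> \<Longrightarrow> cosh (x + y) \<le> h \<epsilon> y + 1" "0 < \<epsilon> \<Longrightarrow> \<bar>sinh (x + y)\<bar> \<le> h \<epsilon> y + 1"
proof -
  assume e: "0 < \<epsilon>"
  show c: "cosh (x + y) \<le> h \<epsilon> y + 1" using e by (simp add: h_def)
  have "\<bar>sinh (x + y)\<bar> \<le> cosh (x + y)"
  proof (rule power2_le_imp_le)
    show "\<bar>sinh (x + y)\<bar>\<^sup>2 \<le> (cosh (x + y))\<^sup>2" by (simp add: cosh_square_eq)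
  qed simp
  then show "\<bar>sinh (x + y)\<bar> \<le> h \<epsilon> y + 1" using c by simp
qed

text \<open>
  The test function \<open>f0\<close> runs the backward equation in reversed time, so that at \<open>u = T\<close> it is
  \<open>exp (- l * h)\<close>; \<open>f1\<close>, \<open>f2\<close>, \<open>f3\<close> are its derivatives in space and \<open>ft\<close> in time.
\<close>

definition "f0 \<epsilon> u y = gam.V 0 (T - u) (h \<epsilon> y)"
definition "f1 \<epsilon> u y = - (sinh (x + y) * gam.V 1 (T - u) (h \<epsilon> y))"
definition "f2 \<epsilon> u y = (sinh (x + y))\<^sup>2 * gam.V 2 (T - u) (h \<epsilon> y) - cosh (x + y) * gam.V 1 (T - u) (h \<epsilon> y)"
definition "f3 \<epsilon> u y = - ((sinh (x + y)) ^ 3 * gam.V 3 (T - u) (h \<epsilon> y))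
  + 3 * ((sinh (x + y) * cosh (x + y)) * gam.V 2 (T - u) (h \<epsilon> y)) - sinh (x + y) * gam.V 1 (T - u) (h \<epsilon> y)"
definition "ft \<epsilon> u y = (\<beta> + 1/2) * ((h \<epsilon> y + 1) * gam.V 1 (T - u) (h \<epsilon> y))
  - 1/2 * (((h \<epsilon> y)\<^sup>2 + 2 * h \<epsilon> y) * gam.V 2 (T - u) (h \<epsilon> y))"

lemma V_h_derivative:
  assumes "u \<in> {0..T}" "0 < \<epsilon>"
  shows "((\<lambda>y. gam.V k (T - u) (h \<epsilon> y)) has_real_derivative - (gam.V (Suc k) (T - u) (h \<epsilon> y) * sinh (x + y))) (at y)"
proof -
  have "(h \<epsilon> has_real_derivative sinh (x + y)) (at y)"
    unfolding h_def[abs_def] by (auto intro!: derivative_eq_intros)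
  from DERIV_chain2[OF gam.V_has_derivative this, of "T - u" k] show ?thesis
    using assms h_ge[of \<epsilon> y] by (simp add: mult.commute)
qed

lemma f_derivatives:
  assumes u: "u \<in> {0..T}" and e: "0 < \<epsilon>"
  shows "(f0 \<epsilon> u has_real_derivative f1 \<epsilon> u y) (at y)"
    and "(f1 \<epsilon> u has_real_derivative f2 \<epsilon> u y) (at y)"
    and "(f2 \<epsilon> u has_real_derivative f3 \<epsilon> u y) (at y)"
proof -
  note V = V_h_derivative[OF u e]
  have V0: "((\<lambda>y. gam.V 0 (T - u) (h \<epsilon> y)) has_real_derivative - (gam.V 1 (T - u) (h \<epsilon> y) * sinh (x + y))) (at y)"
    and V1: "((\<lambda>y. gam.V 1 (T - u) (h \<epsilon> y)) has_real_derivative - (gam.V 2 (T - u) (h \<epsilon> y) * sinh (x + y))) (at y)"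
    and V2: "((\<lambda>y. gam.V 2 (T - u) (h \<epsilon> y)) has_real_derivative - (gam.V 3 (T - u) (h \<epsilon> y) * sinh (x + y))) (at y)"
    using V[of 0 y] V[of 1 y] V[of 2 y] by (simp_all add: numeral_2_eq_2 numeral_3_eq_3)
  have s: "((\<lambda>y. sinh (x + y)) has_real_derivative cosh (x + y)) (at y)"
    "((\<lambda>y. cosh (x + y)) has_real_derivative sinh (x + y)) (at y)"
    by (auto intro!: derivative_eq_intros)
  show "(f0 \<epsilon> u has_real_derivative f1 \<epsilon> u y) (at y)"
    unfolding f0_def[abs_def] f1_def using V0 by (simp add: mult.commute)
  show "(f1 \<epsilon> u has_real_derivative f2 \<epsilon> u y) (at y)"
    unfolding f1_def[abs_def] f2_def
    by (rule derivative_eq_intros V1 s refl)+ (simp add: algebra_simps power2_eq_square)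
  show "(f2 \<epsilon> u has_real_derivative f3 \<epsilon> u y) (at y)"
    unfolding f2_def[abs_def] f3_def
    by (rule derivative_eq_intros V1 V2 s refl)+ (simp add: algebra_simps power2_eq_square power3_eq_cube)
qed

lemma f_time_derivative:
  assumes u: "u \<in> {0..T}" and e: "0 < \<epsilon>"
  shows "((\<lambda>u. f0 \<epsilon> u y) has_real_derivative ft \<epsilon> u y) (at u within {0..T})"
proof -
  have hp: "0 < h \<epsilon> y" using h_ge[of \<epsilon> y] e by simp
  have im: "(\<lambda>u. T - u) ` {0..T} = {0..T}" by simp
  have "T - u \<in> {0..T}" using u by auto
  from gam.V_time_derivative[OF this hp]
  have "((\<lambda>\<tau>. gam.V 0 \<tau> (h \<epsilon> y)) has_real_derivative - ft \<epsilon> u y) (at (T - u) within (\<lambda>u. T - u) ` {0..T})"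
    unfolding im ft_def by (simp add: algebra_simps)
  moreover have "((\<lambda>u. T - u) has_real_derivative - 1) (at u within {0..T})"
    by (auto intro!: derivative_eq_intros)
  ultimately have "((\<lambda>\<tau>. gam.V 0 \<tau> (h \<epsilon> y)) \<circ> (\<lambda>u. T - u) has_real_derivative - ft \<epsilon> u y * - 1) (at u within {0..T})"
    by (rule DERIV_image_chain)
  then show ?thesis unfolding f0_def by (simp add: comp_def)
qed

lemma f_bounds:
  assumes u: "u \<in> {0..T}" and e: "0 < \<epsilon>"
  defines "C \<equiv> (\<beta> + 13) * (1 + 1 / \<epsilon>) ^ 3"
  shows "\<bar>f0 \<epsilon> u y\<bar> \<le> C" "\<bar>f1 \<epsilon> u y\<bar> \<le> C" "\<bar>f2 \<epsilon> u y\<bar> \<le> C" "\<bar>f3 \<epsilon> u y\<bar> \<le> C" "\<bar>ft \<epsilon> u y\<bar> \<le> C"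
proof -
  let ?Q = "(1 + 1 / \<epsilon>) ^ 3" and ?c = "cosh (x + y)" and ?s = "sinh (x + y)" and ?h = "h \<epsilon> y"
  have Q: "0 \<le> ?Q" using e by simp
  have \<tau>: "0 \<le> T - u" using u by simp
  note w = V_weighted_bound[OF e h_ge[of \<epsilon> y] \<tau>]
  note hc = h_plus_one[OF e, of y]
  have c1: "1 \<le> ?c" by (rule cosh_real_ge_1)
  have hp: "0 < ?h" using h_ge[of \<epsilon> y] e by simp
  have C: "C = \<beta> * ?Q + 13 * ?Q" by (simp add: C_def algebra_simps)
  have \<beta>Q: "0 \<le> \<beta> * ?Q" using gam.\<beta> Q by simp
  have b0: "\<bar>1 * gam.V 0 (T - u) ?h\<bar> \<le> ?Q" using w[of 1 0] by simp
  have b1: "\<bar>?s * gam.V 1 (T - u) ?h\<bar> \<le> ?Q" using w[of ?s 1] hc by simp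
  have b1c: "\<bar>?c * gam.V 1 (T - u) ?h\<bar> \<le> ?Q" using w[of ?c 1] hc c1 by simp
  have b1h: "\<bar>(?h + 1) * gam.V 1 (T - u) ?h\<bar> \<le> ?Q" using w[of "?h + 1" 1] hp by simp
  have b2: "\<bar>?s\<^sup>2 * gam.V 2 (T - u) ?h\<bar> \<le> 2 * ?Q"
    using w[of "?s\<^sup>2" 2] power_mono[OF hc(2), of 2] by (simp add: fact_numeral)
  have "\<bar>?s * ?c\<bar> \<le> (?h + 1) ^ 2"
    unfolding abs_mult power2_eq_square using hc c1 hp by (intro mult_mono) auto
  then have b2c: "\<bar>(?s * ?c) * gam.V 2 (T - u) ?h\<bar> \<le> 2 * ?Q"
    using w[of "?s * ?c" 2] by (simp add: fact_numeral)
  have "\<bar>?h\<^sup>2 + 2 * ?h\<bar> \<le> (?h + 1) ^ 2" using hp by (simp add: power2_eq_square algebra_simps)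
  then have b2h: "\<bar>(?h\<^sup>2 + 2 * ?h) * gam.V 2 (T - u) ?h\<bar> \<le> 2 * ?Q"
    using w[of "?h\<^sup>2 + 2 * ?h" 2] by (simp add: fact_numeral)
  have b3: "\<bar>?s ^ 3 * gam.V 3 (T - u) ?h\<bar> \<le> 6 * ?Q"
    using w[of "?s ^ 3" 3] power_mono[OF hc(2), of 3] by (simp add: fact_numeral power_abs)
  show "\<bar>f0 \<epsilon> u y\<bar> \<le> C" using b0 \<beta>Q Q unfolding C f0_def by simp
  show "\<bar>f1 \<epsilon> u y\<bar> \<le> C" using b1 \<beta>Q Q unfolding C f1_def by linarith
  show "\<bar>f2 \<epsilon> u y\<bar> \<le> C" using b2 b1c \<beta>Q Q unfolding C f2_def by linarith
  show "\<bar>f3 \<epsilon> u y\<bar> \<le> C" using b3 b2c b1 \<beta>Q Q unfolding C f3_def by linarith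
  have "\<bar>(\<beta> + 1/2) * ((?h + 1) * gam.V 1 (T - u) ?h)\<bar> \<le> (\<beta> + 1/2) * ?Q"
    unfolding abs_mult[of "\<beta> + 1/2"] using b1h gam.\<beta> by (intro mult_mono) auto
  then have "\<bar>(\<beta> + 1/2) * ((?h + 1) * gam.V 1 (T - u) ?h)\<bar> \<le> \<beta> * ?Q + 1/2 * ?Q" by (simp only: distrib_right)
  then show "\<bar>ft \<epsilon> u y\<bar> \<le> C" using b2h Q unfolding C ft_def by linarith
qed

lemma f_continuous:
  assumes e: "0 < \<epsilon>"
  shows "continuous_on ({0..T} \<times> UNIV) (\<lambda>p. f1 \<epsilon> (fst p) (snd p))"
    and "continuous_on ({0..T} \<times> UNIV) (\<lambda>p. f2 \<epsilon> (fst p) (snd p))"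
    and "continuous_on ({0..T} \<times> UNIV) (\<lambda>p. ft \<epsilon> (fst p) (snd p))"
proof -
  have hc: "continuous_on S (\<lambda>p. h \<epsilon> (snd p))" for S :: "(real \<times> real) set"
    unfolding h_def by (intro continuous_intros)
  have Vc: "continuous_on ({0..T} \<times> UNIV) (\<lambda>p. gam.V k (T - fst p) (h \<epsilon> (snd p)))" for k
  proof -
    have "continuous_on ({0..T} \<times> UNIV) (\<lambda>p. (\<lambda>q. gam.V k (fst q) (snd q)) (T - fst p, h \<epsilon> (snd p)))"
      by (rule continuous_on_compose2[OF gam.V_continuous[OF e, of T k]])
        (use h_ge in \<open>auto intro!: continuous_intros hc\<close>)
    then show ?thesis by simp
  qed
  note [continuous_intros] = Vc hc
  show "continuous_on ({0..T} \<times> UNIV) (\<lambda>p. f1 \<epsilon> (fst p) (snd p))"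
    unfolding f1_def by (intro continuous_intros)
  show "continuous_on ({0..T} \<times> UNIV) (\<lambda>p. f2 \<epsilon> (fst p) (snd p))"
    unfolding f2_def by (intro continuous_intros)
  show "continuous_on ({0..T} \<times> UNIV) (\<lambda>p. ft \<epsilon> (fst p) (snd p))"
    unfolding ft_def by (intro continuous_intros)
qed

lemma f_measurable:
  assumes u: "u \<in> {0..T}" and e: "0 < \<epsilon>"
  shows "f0 \<epsilon> u \<in> borel_measurable borel" "f1 \<epsilon> u \<in> borel_measurable borel" "f2 \<epsilon> u \<in> borel_measurable borel"
  using f_derivatives[OF u e]
  by (auto intro!: borel_measurable_continuous_onI continuous_at_imp_continuous_on DERIV_isCont)

text \<open>
  At \<open>\<epsilon> = 0\<close> the left-hand side would vanish, by the backward equation. The shift makes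
  \<open>V\<close> solve the equation at \<open>cosh + \<epsilon>\<close> instead of \<open>cosh\<close>, which leaves a multiple of \<open>\<epsilon>\<close> whose
  coefficient is bounded by moments of \<open>\<Lambda>\<close>, uniformly in \<open>\<epsilon>\<close> and in the position.
\<close>

lemma generator_mismatch:
  assumes u: "u \<in> {0..T}" and e: "0 < \<epsilon>" and r: "sinh (x + y) * \<delta> = \<beta> * cosh (x + y)"
  shows "\<bar>f2 \<epsilon> u y / 2 + ft \<epsilon> u y + f1 \<epsilon> u y * \<delta>\<bar> \<le> \<epsilon> * ((\<beta> + 3/2) * gam.moment_bound T)"
proof -
  let ?c = "cosh (x + y)" and ?V1 = "gam.V 1 (T - u) (h \<epsilon> y)" and ?V2 = "gam.V 2 (T - u) (h \<epsilon> y)"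
  have hp: "0 < h \<epsilon> y" using h_ge[of \<epsilon> y] e by simp
  have \<tau>: "0 \<le> T - u" "T - u \<le> T" using u by auto
  have V0: "0 \<le> ?V1" "0 \<le> ?V2" using gam.V_bounds[OF \<tau>(1) hp] by auto
  note mb = gam.V_moment_bounds[OF \<tau> hp]
  have s2: "(sinh (x + y))\<^sup>2 = ?c\<^sup>2 - 1" by (simp add: cosh_square_eq)
  have f1d: "f1 \<epsilon> u y * \<delta> = - (\<beta> * ?c * ?V1)"
  proof -
    have "f1 \<epsilon> u y * \<delta> = - ((sinh (x + y) * \<delta>) * ?V1)" by (simp add: f1_def)
    then show ?thesis by (simp only: r)
  qed
  have eq: "f2 \<epsilon> u y / 2 + ft \<epsilon> u y + f1 \<epsilon> u y * \<delta> = \<epsilon> * ((\<beta> + 1/2) * ?V1 - (?c + \<epsilon> / 2) * ?V2)"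
    unfolding f1d f2_def ft_def s2 unfolding h_def by (simp add: field_simps power2_eq_square)
  have c0: "0 \<le> ?c" by simp
  have A: "0 \<le> (\<beta> + 1/2) * ?V1" "(\<beta> + 1/2) * ?V1 \<le> (\<beta> + 1/2) * gam.moment_bound T"
    using V0 mb gam.\<beta> by (auto intro: mult_left_mono)
  have "(?c + \<epsilon> / 2) * ?V2 \<le> (h \<epsilon> y + 1) * ?V2"
    using V0 e by (intro mult_right_mono) (auto simp: h_def)
  then have B: "0 \<le> (?c + \<epsilon> / 2) * ?V2" "(?c + \<epsilon> / 2) * ?V2 \<le> gam.moment_bound T"
    using V0 c0 e mb by auto
  have "\<bar>(\<beta> + 1/2) * ?V1 - (?c + \<epsilon> / 2) * ?V2\<bar> \<le> (\<beta> + 1/2) * gam.moment_bound T + gam.moment_bound T"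
    using A B by linarith
  also have "\<dots> = (\<beta> + 3/2) * gam.moment_bound T" by (simp add: algebra_simps)
  finally show ?thesis unfolding eq abs_mult using e by (simp add: mult_left_mono)
qed

text \<open>
  The accumulated drift is capped at \<open>c\<close>, since its integrability is not known beforehand. After
  the cap is reached the process moves without drift and the integrand is merely bounded, which
  costs the probability of reaching \<open>c\<close>. It matters that the bound holds pointwise in time: a bound
  through the integral of the capped drift would have an extra factor \<open>c\<close>.
\<close>

lemma truncated_estimate:
  assumes e: "0 < \<epsilon>" and c: "0 < c"
  defines "C \<equiv> (\<beta> + 13) * (1 + 1 / \<epsilon>) ^ 3"
  shows "\<bar>bes.expectation (\<lambda>\<omega>. exp (- (h \<epsilon> (B T \<omega> + min (D T \<omega>) c) * l))) - gam.V 0 T (cosh x - 1 + \<epsilon>)\<bar>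
    \<le> T * (\<epsilon> * ((\<beta> + 3/2) * gam.moment_bound T)) + 2 * C * T * bes.expectation (indicator {\<omega> \<in> space M. c \<le> D T \<omega>})"
proof -
  let ?D = "\<lambda>u \<omega>. min (D u \<omega>) c" and ?d = "\<lambda>\<omega> r. if D r \<omega> < c then d \<omega> r else 0"
  let ?K = "\<epsilon> * ((\<beta> + 3/2) * gam.moment_bound T)" and ?I = "indicator {\<omega> \<in> space M. c \<le> D T \<omega>} :: 'a \<Rightarrow> real"
  define X where "X \<omega> r = B r \<omega> + ?D r \<omega>" for \<omega> r
  define g where "g \<omega> r = f2 \<epsilon> r (X \<omega> r) / 2 + ft \<epsilon> r (X \<omega> r) + f1 \<epsilon> r (X \<omega> r) * ?d \<omega> r" for \<omega> r
  define Z where "Z \<omega> = integral {0..T} (g \<omega>)" for \<omega>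
  have T0: "0 \<le> T" using T by simp
  note b = f_bounds[OF _ e, folded C_def]
  have C0: "0 \<le> C" unfolding C_def using e gam.\<beta> by simp
  have tr: "(?d \<omega> has_integral (?D v \<omega> - ?D u \<omega>)) {u..v}" if "\<omega> \<in> space M" "0 \<le> u" "u \<le> v" "v \<le> T" for \<omega> u v
    by (rule truncated_primitive[where T = T]) (use that c D_continuous d_integrable d_nonneg D_primitive D_zero in auto)
  have DTm: "D T \<in> borel_measurable M"
    by (rule D_measurable) (use T0 in simp)
  have Im: "{\<omega> \<in> space M. c \<le> D T \<omega>} \<in> sets M" using DTm by measurable
  have Ii: "integrable M ?I"
    by (rule bes.integrable_const_bound[where B = 1]) (use Im in \<open>auto simp: indicator_def\<close>)
  have Ki: "integrable M (\<lambda>\<omega>. T * ?K + 2 * C * T * ?I \<omega>)"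
    by (intro Bochner_Integration.integrable_add integrable_mult_right Ii) auto
  have ito: "integrable M Z \<and>
      bes.expectation (\<lambda>\<omega>. f0 \<epsilon> T (X \<omega> T)) - bes.expectation (\<lambda>\<omega>. f0 \<epsilon> 0 (X \<omega> 0)) = bes.expectation Z"
    unfolding Z_def[abs_def] g_def[abs_def] X_def
  proof (rule bes.ito_expectation[where \<phi> = "\<lambda>_. f0 \<epsilon>" and ?\<phi>1.0 = "\<lambda>_. f1 \<epsilon>" and ?\<phi>2.0 = "\<lambda>_. f2 \<epsilon>" and ?\<phi>3.0 = "\<lambda>_. f3 \<epsilon>"
      and \<phi>t = "\<lambda>_. ft \<epsilon>" and D = ?D and d = ?d and k = "\<lambda>_ _. C" and H = "\<lambda>_. C * T + c" and C = C])
    fix \<omega> u v assume \<omega>: "\<omega> \<in> space M" and uv: "0 \<le> u" "u \<le> v" "v \<le> T"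
    show "?D v \<omega> - ?D u \<omega> = integral {u..v} (?d \<omega>)" using integral_unique[OF tr[OF \<omega> uv]] by simp
  next
    fix \<omega> assume \<omega>: "\<omega> \<in> space M"
    have hi: "(?d \<omega> has_integral (?D T \<omega> - ?D 0 \<omega>)) {0..T}" by (rule tr[OF \<omega>]) (use T0 in auto)
    show "?d \<omega> integrable_on {0..T}" using hi by blast
    have "integral {0..T} (?d \<omega>) \<le> c" using integral_unique[OF hi] D_zero[OF \<omega>] c by simp
    then show "integral {0..T} (\<lambda>_. C) + integral {0..T} (?d \<omega>) \<le> C * T + c"
      using T0 by (simp add: mult.commute)
    show "continuous_on {0..T} (\<lambda>u. ?D u \<omega>)" by (intro continuous_on_min D_continuous[OF \<omega>] continuous_on_const)
  next
    fix u assume u: "u \<in> {0..T}"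
    show "?D u \<in> borel_measurable (F u)" using D_adapted[OF u] by measurable
    note [measurable] = f_measurable[OF u e]
    show "(\<lambda>p. f0 \<epsilon> u (snd p)) \<in> borel_measurable (F u \<Otimes>\<^sub>M borel)" by measurable
    show "(\<lambda>p. f1 \<epsilon> u (snd p)) \<in> borel_measurable (F u \<Otimes>\<^sub>M borel)" by measurable
    show "(\<lambda>p. f2 \<epsilon> u (snd p)) \<in> borel_measurable (F u \<Otimes>\<^sub>M borel)" by measurable
  qed (use T f_derivatives[OF _ e] f_time_derivative[OF _ e] f_continuous[OF e] b d_nonneg in auto)
  have Zb: "AE \<omega> in M. \<bar>Z \<omega>\<bar> \<le> T * ?K + 2 * C * T * ?I \<omega>"
    using coth_drift AE_space
  proof eventually_elim
    case (elim \<omega>)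
    then obtain S where S: "negligible S" and rel: "\<And>r. r \<in> {0..T} - S \<Longrightarrow>
      sinh (x + B r \<omega> + D r \<omega>) * d \<omega> r = \<beta> * cosh (x + B r \<omega> + D r \<omega>)" and \<omega>: "\<omega> \<in> space M" by blast
    have K0: "0 \<le> ?K"
      using e gam.\<beta> gam.l by (simp add: gam.moment_bound_def)
    have gi: "g \<omega> integrable_on {0..T}"
    proof -
      have Xc: "continuous_on {0..T} (X \<omega>)" unfolding X_def[abs_def]
        by (intro continuous_intros continuous_on_min bes.B_continuous[OF \<omega>] D_continuous[OF \<omega>])
      have "?d \<omega> integrable_on {0..T}" using tr[OF \<omega>, of 0 T] T0 by blast
      then have "(\<lambda>r. f1 \<epsilon> r (X \<omega> r) * ?d \<omega> r) integrable_on {0..T}"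
        by (rule integrable_continuous_mult[OF continuous_on_slice[OF f_continuous(1)[OF e] Xc]])
          (use d_nonneg[OF \<omega>] in auto)
      moreover have "(\<lambda>r. f2 \<epsilon> r (X \<omega> r) / 2 + ft \<epsilon> r (X \<omega> r)) integrable_on {0..T}"
        by (intro integrable_continuous_real continuous_intros continuous_on_slice[OF f_continuous(2)[OF e] Xc]
            continuous_on_slice[OF f_continuous(3)[OF e] Xc]) auto
      ultimately show ?thesis unfolding g_def[abs_def] by (rule integrable_add[rotated])
    qed
    \<comment> \<open>The exceptional times, where the drift relation fails, do not affect the integral.\<close>
    define g' where "g' r = (if r \<in> S then 0 else g \<omega> r)" for r
    have g': "(g' has_integral Z \<omega>) {0..T}" unfolding Z_def
      by (rule has_integral_spike[OF S _ integrable_integral[OF gi]]) (auto simp: g'_def)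
    have bnd: "norm (g' r) \<le> ?K + 2 * C * ?I \<omega>" if r: "r \<in> {0..T}" for r
    proof (cases "r \<in> S")
      case True then show ?thesis using K0 C0 by (simp add: g'_def)
    next
      case False
      show ?thesis
      proof (cases "D r \<omega> < c")
        case True
        have "sinh (x + X \<omega> r) * ?d \<omega> r = \<beta> * cosh (x + X \<omega> r)"
          using rel[of r] r False True by (simp add: X_def min_def add.assoc)
        from generator_mismatch[OF r e this] have "\<bar>g \<omega> r\<bar> \<le> ?K" by (simp add: g_def)
        moreover have "0 \<le> 2 * C * ?I \<omega>" using C0 by simp
        ultimately show ?thesis using False by (simp add: g'_def)
      next
        case ge: False
        have "0 \<le> integral {r..T} (d \<omega>)"
          by (intro Henstock_Kurzweil_Integration.integral_nonneg integrable_subinterval_real[OF d_integrable[OF \<omega>]])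
            (use r d_nonneg[OF \<omega>] in auto)
        then have "D r \<omega> \<le> D T \<omega>" using D_primitive[OF \<omega>, of r T] r by simp
        then have I1: "?I \<omega> = 1" using ge \<omega> by simp
        have "\<bar>g \<omega> r\<bar> \<le> 2 * C"
          using b(3)[OF r, of "X \<omega> r"] b(5)[OF r, of "X \<omega> r"] ge unfolding g_def by simp
        then show ?thesis using False K0 I1 by (simp add: g'_def)
      qed
    qed
    have "norm (integral {0..T} g') \<le> integral {0..T} (\<lambda>_. ?K + 2 * C * ?I \<omega>)"
      by (rule Henstock_Kurzweil_Integration.integral_norm_bound_integral) (use g' bnd in auto)
    then show ?case using integral_unique[OF g'] T0 by (simp add: algebra_simps)
  qed
  have "\<bar>bes.expectation Z\<bar> \<le> bes.expectation (\<lambda>\<omega>. \<bar>Z \<omega>\<bar>)" by (rule integral_abs_bound)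
  also have "\<dots> \<le> bes.expectation (\<lambda>\<omega>. T * ?K + 2 * C * T * ?I \<omega>)"
    by (rule integral_mono_AE) (use ito Zb Ki in auto)
  also have "\<dots> = T * ?K + 2 * C * T * bes.expectation ?I"
    using Ii bes.prob_space by (subst Bochner_Integration.integral_add) auto
  finally have ZE: "\<bar>bes.expectation Z\<bar> \<le> T * ?K + 2 * C * T * bes.expectation ?I" .
  have fT: "f0 \<epsilon> T (X \<omega> T) = exp (- (h \<epsilon> (B T \<omega> + ?D T \<omega>) * l))" for \<omega>
    by (simp add: f0_def gam.V_at_start X_def)
  have "bes.expectation (\<lambda>\<omega>. f0 \<epsilon> 0 (X \<omega> 0)) = bes.expectation (\<lambda>_. gam.V 0 T (cosh x - 1 + \<epsilon>))"
  proof (rule integral_cong_AE)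
    show "AE \<omega> in M. f0 \<epsilon> 0 (X \<omega> 0) = gam.V 0 T (cosh x - 1 + \<epsilon>)"
      using bes.B_start AE_space by eventually_elim (use c in \<open>simp add: f0_def X_def D_zero h_def\<close>)
    have [measurable]: "f0 \<epsilon> 0 \<in> borel_measurable borel" "B 0 \<in> borel_measurable M" "D 0 \<in> borel_measurable M"
      using f_measurable(1)[OF _ e, of 0] T0 bes.B_measurable[of 0] D_measurable[of 0] by auto
    show "(\<lambda>\<omega>. f0 \<epsilon> 0 (X \<omega> 0)) \<in> borel_measurable M" unfolding X_def by measurable
  qed simp
  then have f0: "bes.expectation (\<lambda>\<omega>. f0 \<epsilon> 0 (X \<omega> 0)) = gam.V 0 T (cosh x - 1 + \<epsilon>)"
    using bes.prob_space by simp
  show ?thesis using ito ZE unfolding fT f0 by simp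
qed

lemma final_state_measurable: "(\<lambda>\<omega>. B T \<omega> + D T \<omega>) \<in> borel_measurable M"
  using bes.B_measurable[of T] D_measurable[of T] T by auto

text \<open>
  The cap is removed first, while \<open>\<epsilon>\<close> keeps the derivatives of the test function bounded.
\<close>

lemma duality_estimate:
  assumes e: "0 < \<epsilon>"
  shows "\<bar>bes.expectation (\<lambda>\<omega>. exp (- (h \<epsilon> (B T \<omega> + D T \<omega>) * l))) - gam.V 0 T (cosh x - 1 + \<epsilon>)\<bar>
    \<le> T * (\<epsilon> * ((\<beta> + 3/2) * gam.moment_bound T))"
proof -
  let ?K = "T * (\<epsilon> * ((\<beta> + 3/2) * gam.moment_bound T))" and ?C = "(\<beta> + 13) * (1 + 1 / \<epsilon>) ^ 3"
  have [measurable]: "B T \<in> borel_measurable M" "D T \<in> borel_measurable M"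
    using bes.B_measurable[of T] D_measurable[of T] T by auto
  have eventually_below: "\<forall>\<^sub>F n in sequentially. D T \<omega> < real (Suc n)" for \<omega>
  proof -
    obtain m :: nat where "D T \<omega> < real m" using reals_Archimedean2 by blast
    then show ?thesis by (intro eventually_sequentiallyI[of m]) simp
  qed
  have hpos: "0 \<le> h \<epsilon> y" for y using h_ge[of \<epsilon> y] e by simp
  have [measurable]: "h \<epsilon> \<in> borel_measurable borel"
    unfolding h_def[abs_def] by (intro borel_measurable_continuous_onI continuous_intros)
  have "(\<lambda>n. bes.expectation (\<lambda>\<omega>. exp (- (h \<epsilon> (B T \<omega> + min (D T \<omega>) (real (Suc n))) * l))))
      \<longlonglongrightarrow> bes.expectation (\<lambda>\<omega>. exp (- (h \<epsilon> (B T \<omega> + D T \<omega>) * l)))"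
  proof (rule integral_dominated_convergence[where w = "\<lambda>_. 1"])
    show "AE \<omega> in M. (\<lambda>n. exp (- (h \<epsilon> (B T \<omega> + min (D T \<omega>) (real (Suc n))) * l))) \<longlonglongrightarrow> exp (- (h \<epsilon> (B T \<omega> + D T \<omega>) * l))"
    proof (intro AE_I2 tendsto_eventually)
      fix \<omega> show "\<forall>\<^sub>F n in sequentially. exp (- (h \<epsilon> (B T \<omega> + min (D T \<omega>) (real (Suc n))) * l)) = exp (- (h \<epsilon> (B T \<omega> + D T \<omega>) * l))"
        using eventually_below[of \<omega>] by eventually_elim simp
    qed
    show "AE \<omega> in M. norm (exp (- (h \<epsilon> (B T \<omega> + min (D T \<omega>) (real (Suc n))) * l))) \<le> 1" for n
      using hpos gam.l by (intro AE_I2) simp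
  qed auto
  then have L: "(\<lambda>n. \<bar>bes.expectation (\<lambda>\<omega>. exp (- (h \<epsilon> (B T \<omega> + min (D T \<omega>) (real (Suc n))) * l))) - gam.V 0 T (cosh x - 1 + \<epsilon>)\<bar>)
      \<longlonglongrightarrow> \<bar>bes.expectation (\<lambda>\<omega>. exp (- (h \<epsilon> (B T \<omega> + D T \<omega>) * l))) - gam.V 0 T (cosh x - 1 + \<epsilon>)\<bar>"
    by (intro tendsto_intros)
  have "(\<lambda>n. bes.expectation (indicator {\<omega> \<in> space M. real (Suc n) \<le> D T \<omega>} :: 'a \<Rightarrow> real)) \<longlonglongrightarrow> bes.expectation (\<lambda>_. 0)"
  proof (rule integral_dominated_convergence[where w = "\<lambda>_. 1"])
    show "AE \<omega> in M. (\<lambda>n. indicator {\<omega> \<in> space M. real (Suc n) \<le> D T \<omega>} \<omega> :: real) \<longlonglongrightarrow> 0"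
    proof (intro AE_I2 tendsto_eventually)
      fix \<omega> show "\<forall>\<^sub>F n in sequentially. indicator {\<omega> \<in> space M. real (Suc n) \<le> D T \<omega>} \<omega> = (0 :: real)"
        using eventually_below[of \<omega>] by eventually_elim simp
    qed
  qed (auto intro!: AE_I2 simp: indicator_def)
  then have "(\<lambda>n. ?K + 2 * ?C * T * bes.expectation (indicator {\<omega> \<in> space M. real (Suc n) \<le> D T \<omega>})) \<longlonglongrightarrow> ?K + 2 * ?C * T * 0"
    by (intro tendsto_intros) simp
  then have R: "(\<lambda>n. ?K + 2 * ?C * T * bes.expectation (indicator {\<omega> \<in> space M. real (Suc n) \<le> D T \<omega>})) \<longlonglongrightarrow> ?K"
    by simp
  show ?thesis
    by (rule LIMSEQ_le[OF L R]) (use truncated_estimate[OF e] in auto)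
qed

lemma duality:
  "bes.expectation (\<lambda>\<omega>. exp (- ((cosh (x + B T \<omega> + D T \<omega>) - 1) * l))) = gam.V 0 T (cosh x - 1)"
proof -
  let ?K = "(\<beta> + 3/2) * gam.moment_bound T"
  let ?e = "\<lambda>n. inverse (real (Suc n))"
  have e0: "?e \<longlonglongrightarrow> 0" by (rule LIMSEQ_inverse_real_of_nat)
  note [measurable] = final_state_measurable
  have ch: "(\<lambda>y. cosh (x + y) :: real) \<in> borel_measurable borel"
    by (intro borel_measurable_continuous_onI continuous_intros)
  have cm: "(\<lambda>\<omega>. cosh (x + (B T \<omega> + D T \<omega>))) \<in> borel_measurable M"
    using measurable_compose[OF final_state_measurable ch] .
  have "(\<lambda>n. bes.expectation (\<lambda>\<omega>. exp (- (h (?e n) (B T \<omega> + D T \<omega>) * l))))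
      \<longlonglongrightarrow> bes.expectation (\<lambda>\<omega>. exp (- ((cosh (x + (B T \<omega> + D T \<omega>)) - 1 + 0) * l)))"
    unfolding h_def
  proof (rule integral_dominated_convergence[where w = "\<lambda>_. 1"])
    show "AE \<omega> in M. (\<lambda>n. exp (- ((cosh (x + (B T \<omega> + D T \<omega>)) - 1 + ?e n) * l))) \<longlonglongrightarrow> exp (- ((cosh (x + (B T \<omega> + D T \<omega>)) - 1 + 0) * l))"
      by (intro AE_I2 tendsto_intros e0)
    show "AE \<omega> in M. norm (exp (- ((cosh (x + (B T \<omega> + D T \<omega>)) - 1 + ?e n) * l))) \<le> 1" for n
      using h_ge[of "?e n"] gam.l by (intro AE_I2) (simp add: cosh_real_ge_1)
  qed (use cm in auto)
  moreover have "(\<lambda>n. gam.V 0 T (cosh x - 1 + ?e n)) \<longlonglongrightarrow> gam.V 0 T (cosh x - 1 + 0)"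
  proof (rule continuous_on_tendsto_compose[OF gam.V_zero_continuous[of T]])
    show "(\<lambda>n. cosh x - 1 + ?e n) \<longlonglongrightarrow> cosh x - 1 + 0" by (intro tendsto_intros e0)
  qed (use T cosh_real_ge_1[of x] in auto)
  ultimately have L: "(\<lambda>n. \<bar>bes.expectation (\<lambda>\<omega>. exp (- (h (?e n) (B T \<omega> + D T \<omega>) * l))) - gam.V 0 T (cosh x - 1 + ?e n)\<bar>)
      \<longlonglongrightarrow> \<bar>bes.expectation (\<lambda>\<omega>. exp (- ((cosh (x + (B T \<omega> + D T \<omega>)) - 1 + 0) * l))) - gam.V 0 T (cosh x - 1 + 0)\<bar>"
    by (intro tendsto_intros)
  have "(\<lambda>n. T * (?e n * ?K)) \<longlonglongrightarrow> T * (0 * ?K)" by (intro tendsto_intros e0)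
  then have "\<bar>bes.expectation (\<lambda>\<omega>. exp (- ((cosh (x + (B T \<omega> + D T \<omega>)) - 1 + 0) * l))) - gam.V 0 T (cosh x - 1 + 0)\<bar> \<le> T * (0 * ?K)"
    by (rule LIMSEQ_le[OF L]) (use duality_estimate in auto)
  then show ?thesis by (simp add: add.assoc)
qed

end


section \<open>From the hyperbolic Bessel process to the duality\<close>

lemma adapted_natural_filtration:
  assumes "0 \<le> u" "u \<le> v"
  shows "X u \<in> borel_measurable (natural_filtration M X v)"
proof (rule measurableI)
  fix A :: "real set" assume A: "A \<in> sets borel"
  let ?G = "\<Union>u\<in>{0..v}. {X u -` A \<inter> space M |A. A \<in> sets borel}"
  have "X u -` A \<inter> space M \<in> {X u -` A \<inter> space M |A. A \<in> sets borel}" using A by blast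
  then have "X u -` A \<inter> space M \<in> ?G" by (rule UN_I[rotated]) (use assms in simp)
  moreover have "?G \<subseteq> Pow (space M)" by auto
  ultimately show "X u -` A \<inter> space (natural_filtration M X v) \<in> sets (natural_filtration M X v)"
    unfolding natural_filtration_def by (auto simp: space_measure_of)
qed simp

lemma gamma_setting_standard:
  assumes N: "prob_space N" and W: "standard_brownian_motion N W" and "0 < l" "0 \<le> \<beta>"
  shows "gamma_setting N (natural_filtration N W) W l \<beta>"
proof -
  interpret prob_space N by fact
  show ?thesis
  proof
    show "brownian_motion_wrt N (natural_filtration N W) W"
      using W by (simp add: standard_brownian_motion_def)
    show "space (natural_filtration N W u) = space N" for u
      unfolding natural_filtration_def by (rule space_measure_of) auto
  qed (use assms adapted_natural_filtration in auto)
qed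

context usual_filtered_prob_space
begin

text \<open>
  As the filtration contains all null sets, a process can be redefined on an exceptional set
  without losing adaptedness.
\<close>

lemma sets_F_of_AE:
  assumes P: "AE \<omega> in M. P \<omega>" and u: "0 \<le> u"
  shows "{\<omega> \<in> space M. P \<omega>} \<in> sets (F u)"
proof -
  obtain Z where Z: "{\<omega> \<in> space M. \<not> P \<omega>} \<subseteq> Z" "Z \<in> null_sets M"
    using AE_E[OF P] by (auto simp: null_sets_def)
  then have "{\<omega> \<in> space M. \<not> P \<omega>} \<in> null_sets M"
    using complete[OF Z] by (auto intro: null_sets_subset)
  then have "{\<omega> \<in> space M. \<not> P \<omega>} \<in> sets (F u)"
    using null_sets_F0 sets_F_mono[OF u] by auto
  then have "space (F u) - {\<omega> \<in> space M. \<not> P \<omega>} \<in> sets (F u)" by (rule sets.compl_sets)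
  moreover have "space (F u) - {\<omega> \<in> space M. \<not> P \<omega>} = {\<omega> \<in> space M. P \<omega>}"
    using space_F by auto
  ultimately show ?thesis by simp
qed

lemma brownian_setting: "brownian_motion_wrt M F B \<Longrightarrow> brownian_setting M F B"
  by unfold_locales (use space_F in auto)

end

text \<open>
  For \<open>\<alpha> > - 1/2\<close> the drift is read off from the process itself, as \<open>R - x - B\<close>, which makes it adapted, and it is
  set to \<open>0\<close> where the defining properties fail, so that its regularity holds for every \<open>\<omega>\<close>. The
  relation between drift and \<open>coth\<close> holds off the zero set of \<open>R\<close>; this is where that set being
  Lebesgue-null enters.
\<close>

lemma hyperbolic_bessel_decomposition:
  fixes M :: "'a measure"
  assumes "usual_filtered_prob_space M F" and bm: "brownian_motion_wrt M F B"
    and \<alpha>: "\<alpha> \<ge> - 1 / 2" and R: "hyperbolic_bessel M F B \<alpha> x R"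
    and gam: "gamma_setting N G W l (\<alpha> + 1/2)" and T: "0 < T"
  obtains D d where "duality_setting M F B N G W l (\<alpha> + 1/2) D d x T"
    and "AE \<omega> in M. cosh (R T \<omega>) = cosh (x + B T \<omega> + D T \<omega>)"
proof -
  interpret usual_filtered_prob_space M F by fact
  interpret bes: brownian_setting M F B by (rule brownian_setting[OF bm])
  interpret gam: gamma_setting N G W l "\<alpha> + 1/2" by fact
  have T0: "0 \<le> T" using T by simp
  show ?thesis
  proof (cases "\<alpha> = - 1 / 2")
    case True
    show ?thesis
    proof (rule that[of "\<lambda>_ _. 0" "\<lambda>_ _. 0"])
      show "duality_setting M F B N G W l (\<alpha> + 1/2) (\<lambda>_ _. 0) (\<lambda>_ _. 0) x T"
        by unfold_locales (use T True in \<open>auto intro!: AE_I2\<close>)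
      have "AE \<omega> in M. \<forall>t\<ge>0. R t \<omega> = \<bar>x + B t \<omega>\<bar>"
        using R True unfolding hyperbolic_bessel_def by blast
      then show "AE \<omega> in M. cosh (R T \<omega>) = cosh (x + B T \<omega> + 0)"
        by eventually_elim (use T0 in simp)
    qed
  next
    case False
    then have \<alpha>: "\<alpha> > - 1 / 2" using \<alpha> by simp
    define good where "good \<omega> \<longleftrightarrow> continuous_on {0..} (\<lambda>t. R t \<omega>) \<and> (\<forall>t\<ge>0. 0 \<le> R t \<omega>) \<and>
        {u. 0 \<le> u \<and> R u \<omega> = 0} \<in> null_sets lborel \<and>
           (\<forall>t\<ge>0. set_integrable lborel {0..t} (\<lambda>u. coth (R u \<omega>)) \<and>
              R t \<omega> = x + B t \<omega> + (\<alpha> + 1 / 2) * (LINT u:{0..t}|lborel. coth (R u \<omega>)))" for \<omega>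
    have "AE \<omega> in M. continuous_on {0..} (\<lambda>t. R t \<omega>) \<and> (\<forall>t\<ge>0. 0 \<le> R t \<omega>)"
      using R unfolding hyperbolic_bessel_def by blast
    moreover have "AE \<omega> in M. {u. 0 \<le> u \<and> R u \<omega> = 0} \<in> null_sets lborel \<and>
           (\<forall>t\<ge>0. set_integrable lborel {0..t} (\<lambda>u. coth (R u \<omega>)) \<and>
              R t \<omega> = x + B t \<omega> + (\<alpha> + 1 / 2) * (LINT u:{0..t}|lborel. coth (R u \<omega>)))"
      using R \<alpha> unfolding hyperbolic_bessel_def by blast
    ultimately have good: "AE \<omega> in M. good \<omega>" by eventually_elim (simp add: good_def)
    define D where "D u \<omega> = (if good \<omega> then R u \<omega> - x - B u \<omega> else 0)" for u \<omega>
    define d where "d \<omega> r = (if good \<omega> then (\<alpha> + 1/2) * coth (R r \<omega>) else 0)" for \<omega> r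
    have hD: "(d \<omega> has_integral D t \<omega>) {0..t}" if "0 \<le> t" for \<omega> t
    proof (cases "good \<omega>")
      case True
      then have si: "set_integrable lborel {0..t} (\<lambda>u. coth (R u \<omega>))"
        and eq: "R t \<omega> = x + B t \<omega> + (\<alpha> + 1 / 2) * (LINT u:{0..t}|lborel. coth (R u \<omega>))"
        using that by (simp_all add: good_def)
      show ?thesis
        using has_integral_mult_right[OF integrable_integral[OF set_borel_integral_eq_integral(1)[OF si]], of "\<alpha> + 1/2"]
          eq set_borel_integral_eq_integral(2)[OF si] True by (simp add: D_def d_def[abs_def])
    qed (simp add: D_def d_def[abs_def])
    have "duality_setting M F B N G W l (\<alpha> + 1/2) D d x T"
    proof
      fix u assume u: "u \<in> {0..T}"
      have "{\<omega> \<in> space (F u). good \<omega>} \<in> sets (F u)" using sets_F_of_AE[OF good, of u] u space_F by simp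
      moreover have "R u \<in> borel_measurable (F u)" "B u \<in> borel_measurable (F u)"
        using R bes.B_adapted u unfolding hyperbolic_bessel_def by auto
      ultimately show "D u \<in> borel_measurable (F u)" unfolding D_def[abs_def] by measurable
    next
      fix \<omega> assume \<omega>: "\<omega> \<in> space M"
      show "continuous_on {0..T} (\<lambda>u. D u \<omega>)"
      proof (cases "good \<omega>")
        case True
        then have "continuous_on {0..T} (\<lambda>t. R t \<omega>)" unfolding good_def by (auto intro: continuous_on_subset)
        then show ?thesis using True bes.B_continuous[OF \<omega>] by (simp add: D_def continuous_intros)
      qed (simp add: D_def)
      show "D 0 \<omega> = 0" using hD[of 0 \<omega>] by (simp add: has_integral_iff)
      show di: "d \<omega> integrable_on {0..T}" using hD[OF T0] by blast
      show "0 \<le> d \<omega> r" if "r \<in> {0..T}" for r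
      proof (cases "good \<omega>")
        case True
        then have "\<forall>t\<ge>0. 0 \<le> R t \<omega>" unfolding good_def by blast
        then have "0 \<le> R r \<omega>" using that by simp
        then show ?thesis using \<alpha> by (simp add: d_def coth_def)
      qed (simp add: d_def)
      show "D v \<omega> - D u \<omega> = integral {u..v} (d \<omega>)" if "0 \<le> u" "u \<le> v" "v \<le> T" for u v
        using Henstock_Kurzweil_Integration.integral_combine[of 0 u v "d \<omega>"] hD[of u \<omega>] hD[of v \<omega>] that
        by (simp add: has_integral_iff)
    next
      show "AE \<omega> in M. \<exists>S. negligible S \<and> (\<forall>r\<in>{0..T} - S.
        sinh (x + B r \<omega> + D r \<omega>) * d \<omega> r = (\<alpha> + 1/2) * cosh (x + B r \<omega> + D r \<omega>))"
        using good
      proof eventually_elim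
        case (elim \<omega>)
        show ?case
        proof (intro exI[of _ "{u. 0 \<le> u \<and> R u \<omega> = 0}"] conjI ballI)
          have "{u. 0 \<le> u \<and> R u \<omega> = 0} \<in> null_sets lborel" using elim by (simp add: good_def)
          then show "negligible {u. 0 \<le> u \<and> R u \<omega> = 0}"
            by (auto simp: negligible_iff_null_sets intro: null_sets_completionI)
          fix r assume "r \<in> {0..T} - {u. 0 \<le> u \<and> R u \<omega> = 0}"
          then have "R r \<omega> \<noteq> 0" by auto
          moreover have "x + B r \<omega> + D r \<omega> = R r \<omega>" using elim by (simp add: D_def)
          ultimately show "sinh (x + B r \<omega> + D r \<omega>) * d \<omega> r = (\<alpha> + 1/2) * cosh (x + B r \<omega> + D r \<omega>)"
            using elim by (simp add: d_def coth_def)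
        qed
      qed
    qed (rule T)
    moreover have "AE \<omega> in M. cosh (R T \<omega>) = cosh (x + B T \<omega> + D T \<omega>)"
      using good by eventually_elim (simp add: D_def)
    ultimately show ?thesis by (rule that)
  qed
qed

theorem theorem2p9:
  fixes M :: "'a measure" and F :: "real \<Rightarrow> 'a measure" and B R :: "real \<Rightarrow> 'a \<Rightarrow> real"
    and N :: "'b measure" and W :: "real \<Rightarrow> 'b \<Rightarrow> real"
    and \<alpha> x t l :: real
  assumes "usual_filtered_prob_space M F"
    and "brownian_motion_wrt M F B"
    and "\<alpha> \<ge> - 1 / 2" and "x \<ge> 0"
    and "hyperbolic_bessel M F B \<alpha> x R"
    and "prob_space N" and "standard_brownian_motion N W"
    and "t > 0" and "l > 0"
  shows "prob_space.expectation M (\<lambda>\<omega>. exp (- l * cosh (R t \<omega>))) =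
    exp (- l) * prob_space.expectation N (\<lambda>\<omega>.
      exp (- l * (cosh x - 1) * Gamma_process W l (\<alpha> + 1 / 2) t \<omega>) *
      (1 + l * exp_functional W (\<alpha> + 1 / 2) t \<omega>) powr (- \<alpha> - 1))"
proof -
  have gam: "gamma_setting N (natural_filtration N W) W l (\<alpha> + 1/2)"
    by (rule gamma_setting_standard) (use assms in auto)
  obtain D d where "duality_setting M F B N (natural_filtration N W) W l (\<alpha> + 1/2) D d x t"
    and D: "AE \<omega> in M. cosh (R t \<omega>) = cosh (x + B t \<omega> + D t \<omega>)"
    by (rule hyperbolic_bessel_decomposition[OF assms(1-3,5) gam assms(8)])
  then interpret duality_setting M F B N "natural_filtration N W" W l "\<alpha> + 1/2" D d x t by simp
  have [measurable]: "(\<lambda>\<omega>. B t \<omega> + D t \<omega>) \<in> borel_measurable M" by (rule final_state_measurable)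
  have Rm [measurable]: "R t \<in> borel_measurable M"
    by (rule bes.adapted_measurable[of t]) (use assms in \<open>auto simp: hyperbolic_bessel_def\<close>)
  have [measurable]: "(\<lambda>y. cosh y :: real) \<in> borel_measurable borel"
    by (intro borel_measurable_continuous_onI continuous_intros)
  have "bes.expectation (\<lambda>\<omega>. exp (- l * cosh (R t \<omega>))) =
      bes.expectation (\<lambda>\<omega>. exp (- l) * exp (- ((cosh (x + (B t \<omega> + D t \<omega>)) - 1) * l)))"
  proof (rule integral_cong_AE)
    show "AE \<omega> in M. exp (- l * cosh (R t \<omega>)) = exp (- l) * exp (- ((cosh (x + (B t \<omega> + D t \<omega>)) - 1) * l))"
      using D by eventually_elim (simp add: exp_add[symmetric] algebra_simps)
  qed measurable
  also have "\<dots> = exp (- l) * gam.V 0 t (cosh x - 1)"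
    using duality by (simp add: add.assoc)
  also have "gam.V 0 t (cosh x - 1) = gam.expectation (\<lambda>\<omega>.
      exp (- l * (cosh x - 1) * Gamma_process W l (\<alpha> + 1 / 2) t \<omega>) *
      (1 + l * exp_functional W (\<alpha> + 1 / 2) t \<omega>) powr (- \<alpha> - 1))"
  proof -
    have eqs: "gam.\<Lambda> t \<omega> = l * Gamma_process W l (\<alpha> + 1/2) t \<omega>"
      "- (\<alpha> + 1/2 + 1/2) = - \<alpha> - 1" "- (c * (l * y)) = - l * c * y" for \<omega> c y
      by (simp_all add: gam.\<Lambda>_def gam.\<rho>_def gam.A_def Gamma_process_def exp_add)
    show ?thesis
      unfolding gam.V_def gam.P_def gam.A_def eqs power_0 mult_1_left ..
  qed
  finally show ?thesis .
qed

end
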